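(* Let $n\in\mathbb N$, $n\ge2$, $n'=\frac n{n-1}$, $\alpha\in[\frac1{n'},1]$, and let $\|\cdot\|_{X(0,1)}$ be a rearrangement-invariant function norm. Let $k,h\in\mathbb N$. Assume that $\Omega\in\mathcal J_\alpha$. Then $$(X_{k,\alpha})_{h,\alpha}(\Omega)=X_{k+h,\alpha}(\Omega),$$ up to equivalent norms.
   Context: Domains $\Omega\subset\mathbb R^n$ are open connected sets, equipped with Lebesgue measure, normalized so that $|\Omega|=1$. For measurable $E\subset\Omega$, $P(E,\Omega)=\mathcal H^{n-1}(\Omega\cap\partial^ME)$, where $\partial^ME$ is the essential boundary of $E$. The isoperimetric function of $\Omega$ is $I_\Omega(s)=\inf\{P(E,\Omega):E\subset\Omega,\ s\le|E|\le\frac12\}$ for $s\in[0,\frac12]$. The Maz'ya class $\mathcal J_\alpha$, $\alpha\in[\frac1{n'},1]$, is the class of all domains $\Omega\subset\mathbb R^n$ for which there is a constant $C>0$ with $I_\Omega(s)\ge Cs^\alpha$ for $s\in[0,\frac12]$. Rearrangement-invariant (r.i.) spaces. $\mathcal M_+(0,1)$ is the set of measurable functions $(0,1)\to[0,\infty]$. For a measurable $u:\Omega\to[-\infty,\infty]$, $u^*(s)=\sup\{t\in\mathbb R:|\{x\in\Omega:|u(x)|>t\}|>s\}$ for $s\in(0,1)$ (similarly for functions on $(0,1)$). An r.i. function norm is a functional $\|\cdot\|_{X(0,1)}:\mathcal M_+(0,1)\to[0,\infty]$ such that for all $f,g,f_j\in\mathcal M_+(0,1)$ and $\lambda\ge0$: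 (P1) $\|f\|=0$ iff $f=0$ a.e., $\|\lambda f\|=\lambda\|f\|$, $\|f+g\|\le\|f\|+\|g\|$; (P2) $f\le g$ a.e. implies $\|f\|\le\|g\|$; (P3) $f_j\nearrow f$ a.e. implies $\|f_j\|\nearrow\|f\|$; (P4) $\|1\|<\infty$; (P5) $\int_0^1f\,dx\le C\|f\|$ with $C$ independent of $f$; (P6) $\|f\|=\|g\|$ whenever $f^*=g^*$. The associate norm is $\|g\|_{X'(0,1)}=\sup\{\int_0^1fg\,ds:f\ge0,\ \|f\|_{X(0,1)}\le1\}$, again an r.i. function norm, and $X''=X$. The space $X(\Omega)$ consists of all measurable $u$ on $\Omega$ with $\|u\|_{X(\Omega)}:=\|u^*\|_{X(0,1)}<\infty$. For $m\in\mathbb N$ and an r.i. function norm $\|\cdot\|_{X(0,1)}$, $\|\cdot\|_{X_{m,\alpha}(0,1)}$ is the r.i. function norm whose associate norm is, for $f\in\mathcal M_+(0,1)$, $\|f\|_{X'_{m,\alpha}(0,1)}=\big\|s^{-1+m(1-\alpha)}\int_0^sf^*(r)\,dr\big\|_{X'(0,1)}$ if $\alpha\in[\frac1{n'},1)$, and $\|f\|_{X'_{m,\alpha}(0,1)}=\big\|\frac1s\int_0^s(\log\frac sr)^{m-1}f^*(r)\,dr\big\|_{X'(0,1)}$ if $\alpha=1$. The space $(X_{k,\alpha})_{h,\alpha}$ is obtained by applying this construction with $m=h$ to the norm $\|\cdot\|_{X_{k,\alpha}(0,1)}$. *)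

theory Defs
  imports "HOL-Analysis.Analysis"
begin

section \<open>Hausdorff measure, essential boundary, perimeter\<close>

text \<open>The normalization is the one for which the \<open>d\<close>-dimensional Hausdorff measure on
  \<open>d\<close>-dimensional Euclidean space is Lebesgue measure. Empty members of a cover cost nothing;
  the explicit case only matters for \<open>d = 0\<close>, where \<open>0 ^ 0 = 1\<close>.\<close>

definition hausdorff_premeasure :: "nat \<Rightarrow> real \<Rightarrow> 'a::metric_space set \<Rightarrow> ennreal" where
  "hausdorff_premeasure d \<delta> A =
     (INF U \<in> {U :: nat \<Rightarrow> 'a set. A \<subseteq> (\<Union>i. U i) \<and> (\<forall>i. bounded (U i) \<and> diameter (U i) \<le> \<delta>)}.
        \<Sum>i. if U i = {} then 0 else ennreal (unit_ball_vol (real d) * (diameter (U i) / 2) ^ d))"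

definition hausdorff_measure :: "nat \<Rightarrow> 'a::metric_space set \<Rightarrow> ennreal" where
  "hausdorff_measure d A = (SUP \<delta>\<in>{0<..}. hausdorff_premeasure d \<delta> A)"

definition has_density :: "'a::euclidean_space set \<Rightarrow> 'a \<Rightarrow> real \<Rightarrow> bool" where
  "has_density E x \<theta> \<longleftrightarrow>
     ((\<lambda>r. measure lebesgue (E \<inter> ball x r) / measure lebesgue (ball x r)) \<longlongrightarrow> \<theta>) (at_right 0)"

definition essential_boundary :: "'a::euclidean_space set \<Rightarrow> 'a set" where
  "essential_boundary E = {x. \<not> has_density E x 0 \<and> \<not> has_density E x 1}"

definition perimeter :: "(real^'n) set \<Rightarrow> (real^'n) set \<Rightarrow> ennreal" where
  "perimeter E \<Omega> = hausdorff_measure (CARD('n) - 1) (\<Omega> \<inter> essential_boundary E)"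


section \<open>The isoperimetric function and the Maz'ya classes\<close>

definition isoperimetric_function :: "(real^'n) set \<Rightarrow> real \<Rightarrow> ennreal" where
  "isoperimetric_function \<Omega> s =
     (INF E \<in> {E. E \<in> sets lebesgue \<and> E \<subseteq> \<Omega> \<and>
                   ennreal s \<le> emeasure lebesgue E \<and> emeasure lebesgue E \<le> ennreal (1/2)}.
        perimeter E \<Omega>)"

definition mazya_class :: "real \<Rightarrow> (real^'n) set set" where
  "mazya_class \<alpha> =
     {\<Omega>. open \<Omega> \<and> connected \<Omega> \<and> emeasure lebesgue \<Omega> = 1 \<and>
          (\<exists>C>0. \<forall>s\<in>{0..1/2}. ennreal (C * s powr \<alpha>) \<le> isoperimetric_function \<Omega> s)}"


section \<open>Rearrangement-invariant function norms\<close>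

text \<open>Functions on \<open>(0,1)\<close> are total functions on the reals of which only the restriction to
  \<open>(0,1)\<close> matters: measurability and almost-everywhere statements refer to Lebesgue measure on
  \<open>(0,1)\<close>.\<close>

abbreviation leb01 :: "real measure" where
  "leb01 \<equiv> lebesgue_on {0<..<1}"

abbreviation Mplus :: "(real \<Rightarrow> ennreal) set" where
  "Mplus \<equiv> borel_measurable leb01"

text \<open>On a space of measure \<open>1\<close> and for \<open>s \<in> (0,1)\<close>, the supremum contains all negative \<open>t\<close>,
  so it is nonnegative and the conversion \<^const>\<open>e2ennreal\<close> loses nothing.\<close>

definition rearrangement :: "'a measure \<Rightarrow> ('a \<Rightarrow> ereal) \<Rightarrow> real \<Rightarrow> ennreal" where
  "rearrangement M u s =
     e2ennreal (SUP t \<in> {t::real. emeasure M {x \<in> space M. \<bar>u x\<bar> > ereal t} > ennreal s}. ereal t)"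

abbreviation rearr01 :: "(real \<Rightarrow> ennreal) \<Rightarrow> real \<Rightarrow> ennreal" where
  "rearr01 f \<equiv> rearrangement leb01 (\<lambda>x. enn2ereal (f x))"

locale ri_function_norm =
  fixes N :: "(real \<Rightarrow> ennreal) \<Rightarrow> ennreal"
  assumes P1_zero: "\<And>f. f \<in> Mplus \<Longrightarrow> N f = 0 \<longleftrightarrow> (AE x in leb01. f x = 0)"
    and P1_scale: "\<And>f c. f \<in> Mplus \<Longrightarrow> (0::real) \<le> c \<Longrightarrow>
                     N (\<lambda>x. ennreal c * f x) = ennreal c * N f"
    and P1_triangle: "\<And>f g. f \<in> Mplus \<Longrightarrow> g \<in> Mplus \<Longrightarrow> N (\<lambda>x. f x + g x) \<le> N f + N g"
    and P2: "\<And>f g. f \<in> Mplus \<Longrightarrow> g \<in> Mplus \<Longrightarrow> (AE x in leb01. f x \<le> g x) \<Longrightarrow> N f \<le> N g"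
    and P3: "\<And>(F :: nat \<Rightarrow> real \<Rightarrow> ennreal) f.
               (\<And>j. F j \<in> Mplus) \<Longrightarrow> f \<in> Mplus \<Longrightarrow>
               (AE x in leb01. incseq (\<lambda>j. F j x) \<and> (\<lambda>j. F j x) \<longlonglongrightarrow> f x) \<Longrightarrow>
               incseq (\<lambda>j. N (F j)) \<and> (\<lambda>j. N (F j)) \<longlonglongrightarrow> N f"
    and P4: "N (\<lambda>x. 1) < \<infinity>"
    and P5: "\<exists>C::real. 0 \<le> C \<and> (\<forall>f\<in>Mplus. (\<integral>\<^sup>+x. f x \<partial>leb01) \<le> ennreal C * N f)"
    and P6: "\<And>f g. f \<in> Mplus \<Longrightarrow> g \<in> Mplus \<Longrightarrow>
               (\<forall>s\<in>{0<..<1}. rearr01 f s = rearr01 g s) \<Longrightarrow> N f = N g"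

definition associate_norm :: "((real \<Rightarrow> ennreal) \<Rightarrow> ennreal) \<Rightarrow> (real \<Rightarrow> ennreal) \<Rightarrow> ennreal" where
  "associate_norm N g = (SUP f \<in> {f \<in> Mplus. N f \<le> 1}. \<integral>\<^sup>+s. f s * g s \<partial>leb01)"

definition ri_norm_on :: "((real \<Rightarrow> ennreal) \<Rightarrow> ennreal) \<Rightarrow> (real^'n) set \<Rightarrow> (real^'n \<Rightarrow> ereal) \<Rightarrow> ennreal"
  where "ri_norm_on N \<Omega> u = N (rearrangement (lebesgue_on \<Omega>) u)"

definition ri_space :: "((real \<Rightarrow> ennreal) \<Rightarrow> ennreal) \<Rightarrow> (real^'n) set \<Rightarrow> (real^'n \<Rightarrow> ereal) set" where
  "ri_space N \<Omega> = {u \<in> borel_measurable (lebesgue_on \<Omega>). ri_norm_on N \<Omega> u < \<infinity>}"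


section \<open>The norms \<open>X\<^bsub>m,\<alpha>\<^esub>\<close>\<close>

definition assoc_functional ::
  "nat \<Rightarrow> real \<Rightarrow> ((real \<Rightarrow> ennreal) \<Rightarrow> ennreal) \<Rightarrow> (real \<Rightarrow> ennreal) \<Rightarrow> ennreal" where
  "assoc_functional m \<alpha> N f =
     (if \<alpha> = 1
      then associate_norm N (\<lambda>s. ennreal (1 / s) *
             (\<integral>\<^sup>+r\<in>{0<..<s}. ennreal (ln (s / r) ^ (m - 1)) * rearr01 f r \<partial>lebesgue))
      else associate_norm N (\<lambda>s. ennreal (s powr (- 1 + real m * (1 - \<alpha>))) *
             (\<integral>\<^sup>+r\<in>{0<..<s}. rearr01 f r \<partial>lebesgue)))"

text \<open>The r.i. function norm whose associate norm is the functional above. On \<^const>\<open>Mplus\<close> it is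
  determined uniquely (an r.i. function norm equals its second associate norm there); its values
  at nonmeasurable functions are immaterial, which is why a choice operator is used
  rather than a definite description.\<close>

definition optimal_norm ::
  "nat \<Rightarrow> real \<Rightarrow> ((real \<Rightarrow> ennreal) \<Rightarrow> ennreal) \<Rightarrow> (real \<Rightarrow> ennreal) \<Rightarrow> ennreal" where
  "optimal_norm m \<alpha> N =
     (SOME Y. ri_function_norm Y \<and> (\<forall>f\<in>Mplus. associate_norm Y f = assoc_functional m \<alpha> N f))"

end

theory Submission
  imports Defs
begin

text \<open>Writing \<open>T\<^sub>m\<close> for the integral operator in the definition of \<open>X\<^sub>m\<^sub>,\<^sub>\<alpha>\<close>, the associate
  norm of \<open>(X\<^sub>k\<^sub>,\<^sub>\<alpha>)\<^sub>h\<^sub>,\<^sub>\<alpha>\<close> at \<open>f\<close> is \<open>\<parallel>T\<^sub>k ((T\<^sub>h f\<^sup>*)\<^sup>*)\<parallel>\<close> in \<open>X'\<close>, and that of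
  \<open>X\<^sub>k\<^sub>+\<^sub>h\<^sub>,\<^sub>\<alpha>\<close> is \<open>\<parallel>T\<^sub>k\<^sub>+\<^sub>h f\<^sup>*\<parallel>\<close>. The kernel of \<open>T\<^sub>k\<close> is nonincreasing in the inner variable,
  so the inner rearrangement only increases the former, and \<open>T\<^sub>k T\<^sub>h\<close> is comparable to
  \<open>T\<^sub>k\<^sub>+\<^sub>h\<close> on nonincreasing functions. For the converse estimate, if \<open>\<alpha> = 1\<close> then
  \<open>T\<^sub>h f\<^sup>*\<close> is itself nonincreasing; if \<open>\<alpha> < 1\<close> then the extra rearrangement costs at most a
  geometric series of dilations of \<open>T\<^sub>k\<^sub>+\<^sub>h f\<^sup>*\<close>, none of which increases the norm of \<open>X'\<close>.
  Equivalent associate norms belong to equivalent norms by the Lorentz--Luxemburg theorem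
  \<open>X'' = X\<close>.\<close>

section \<open>Rearrangements\<close>

text \<open>The norms \<open>optimal_norm\<close> come from a choice operator, so nothing is known
  about them until the prescribed functional is shown to be the associate norm of some r.i. norm.
  That existence proof needs rearrangement invariance of associate norms, hence the sharpness of the
  Hardy--Littlewood inequality. For \<alpha> < 1 the kernel does not depend on the inner variable
  where it is nonzero: \<open>T_op m \<alpha> f s\<close> is s^(m(1-\<alpha>)) times the mean of f
  over (0,s), so T_(k+h) f and T_h f differ only by the factor s^a with a = k(1-\<alpha>). The
  obstacle is that, for nonincreasing f, T_h f is an increasing power times a decreasing mean. The
  ratio 2^(-a) of the geometric series comes from rewriting s^a as 2^(-a) (2s)^a, and a dilation
  does not increase the norm because it shrinks all superlevel sets. For \<alpha> = 1 the kernel of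
  T_k T_h is, in logarithmic variables, a convolution of powers, which has the order of the power
  with exponent k+h-1.\<close>

lemma less_e2ennrealD:
  assumes "c < e2ennreal x"
  shows "enn2ereal c < x"
proof -
  have "0 \<le> x"
    using assms by (cases "0 \<le> x") (auto simp: e2ennreal_neg not_le)
  then show ?thesis
    using assms by (simp add: less_ennreal.rep_eq enn2ereal_e2ennreal)
qed

lemma less_e2ennrealI: "0 \<le> r \<Longrightarrow> ereal r < x \<Longrightarrow> ennreal r < e2ennreal x"
proof -
  assume "0 \<le> r" "ereal r < x"
  moreover from this have "0 \<le> x"
    by (cases x) auto
  ultimately show ?thesis
    by (simp add: less_ennreal.rep_eq enn2ereal_e2ennreal enn2ereal_ennreal)
qed

text \<open>The superlevel sets at c + 1/(n+1) increase to the one at c, so continuity from below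
  produces a real t above c inside the defining supremum. Later arguments use this equivalence
  instead of the supremum.\<close>

lemma less_rearrangement_iff:
  assumes u: "u \<in> borel_measurable M"
  shows "c < rearrangement M u s \<longleftrightarrow>
    ennreal s < emeasure M {x \<in> space M. enn2ereal c < \<bar>u x\<bar>}"
proof
  let ?A = "{t::real. emeasure M {x \<in> space M. \<bar>u x\<bar> > ereal t} > ennreal s}"
  assume "c < rearrangement M u s"
  then have "enn2ereal c < (SUP t\<in>?A. ereal t)"
    unfolding rearrangement_def by (rule less_e2ennrealD)
  then obtain t where t: "t \<in> ?A" "enn2ereal c < ereal t"
    by (auto simp: less_SUP_iff)
  have "emeasure M {x \<in> space M. \<bar>u x\<bar> > ereal t} \<le> emeasure M {x \<in> space M. enn2ereal c < \<bar>u x\<bar>}"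
    using u t(2) by (intro emeasure_mono) auto
  with t(1) show "ennreal s < emeasure M {x \<in> space M. enn2ereal c < \<bar>u x\<bar>}"
    by auto
next
  let ?A = "{t::real. emeasure M {x \<in> space M. \<bar>u x\<bar> > ereal t} > ennreal s}"
  assume *: "ennreal s < emeasure M {x \<in> space M. enn2ereal c < \<bar>u x\<bar>}"
  have "c \<noteq> \<infinity>"
    using * by (cases c) auto
  then obtain r where r: "0 \<le> r" "c = ennreal r"
    by (cases c) auto
  let ?B = "\<lambda>n::nat. {x \<in> space M. \<bar>u x\<bar> > ereal (r + 1 / Suc n)}"
  have "(\<Union>n. ?B n) = {x \<in> space M. enn2ereal c < \<bar>u x\<bar>}"
  proof (intro equalityI subsetI)
    fix x assume "x \<in> (\<Union>n. ?B n)"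
    then obtain n where n: "x \<in> space M" "ereal (r + 1 / Suc n) < \<bar>u x\<bar>" by auto
    have "ereal r < ereal (r + 1 / Suc n)" by simp
    also note n(2)
    finally have "ereal r < \<bar>u x\<bar>" .
    then show "x \<in> {x \<in> space M. enn2ereal c < \<bar>u x\<bar>}"
      using r \<open>x \<in> space M\<close> by (auto simp: enn2ereal_ennreal)
  next
    fix x assume x: "x \<in> {x \<in> space M. enn2ereal c < \<bar>u x\<bar>}"
    then have "ereal r < \<bar>u x\<bar>" using r by (auto simp: enn2ereal_ennreal)
    then obtain q where q: "r < q" "ereal q < \<bar>u x\<bar>"
      using ereal_dense2[of "ereal r"] by auto
    obtain n where "1 / Suc n < q - r"
      using q nat_approx_posE[of "q - r"] by auto
    then have "ereal (r + 1 / Suc n) < ereal q"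
      by simp
    also note q(2)
    finally have "ereal (r + 1 / Suc n) < \<bar>u x\<bar>" .
    then show "x \<in> (\<Union>n. ?B n)" using x by auto
  qed
  moreover have "(\<lambda>n. emeasure M (?B n)) \<longlonglongrightarrow> emeasure M (\<Union>n. ?B n)"
  proof (intro Lim_emeasure_incseq)
    show "range ?B \<subseteq> sets M" using u by auto
    show "incseq ?B"
    proof (intro incseq_SucI subsetI)
      fix n x assume x: "x \<in> ?B n"
      have "ereal (r + 1 / Suc (Suc n)) \<le> ereal (r + 1 / Suc n)"
        by (simp add: field_simps)
      with x show "x \<in> ?B (Suc n)" by (auto simp del: of_nat_Suc ereal_less_eq)
    qed
  qed
  ultimately have "(\<lambda>n. emeasure M (?B n)) \<longlonglongrightarrow> emeasure M {x \<in> space M. enn2ereal c < \<bar>u x\<bar>}"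
    by simp
  then have "eventually (\<lambda>n. ennreal s < emeasure M (?B n)) sequentially"
    using * by (rule order_tendstoD(1))
  then obtain n where "ennreal s < emeasure M (?B n)"
    by (auto simp: eventually_sequentially)
  then have n: "r + 1 / Suc n \<in> ?A" by simp
  have "ereal r < ereal (r + 1 / Suc n)" by simp
  also have "\<dots> \<le> (SUP t\<in>?A. ereal t)"
    using n by (rule SUP_upper)
  finally show "c < rearrangement M u s"
    unfolding rearrangement_def r(2) using r(1) by (intro less_e2ennrealI) auto
qed

lemma rearrangement_antimono: "s \<le> t \<Longrightarrow> rearrangement M u t \<le> rearrangement M u s"
  unfolding rearrangement_def
  by (intro e2ennreal_mono SUP_subset_mono) (auto dest: le_less_trans[OF ennreal_leI])

text \<open>Superlevel sets of \<open>w\<close> are closed downwards, so minus the indicator of such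
  a set is a monotone real function, hence Borel.\<close>

lemma borel_measurable_antimono_ennreal:
  fixes w :: "real \<Rightarrow> ennreal"
  assumes "antimono w"
  shows "w \<in> borel_measurable borel"
proof (rule borel_measurableI_greater)
  fix y
  have "mono (\<lambda>x. - indicat_real {x. y < w x} x)"
    using assms by (fastforce simp: mono_def antimono_def indicator_def dest: less_le_trans)
  then have "(\<lambda>x. - indicat_real {x. y < w x} x) \<in> borel_measurable borel"
    by (rule borel_measurable_mono)
  then have "(\<lambda>x. indicat_real {x. y < w x} x) \<in> borel_measurable borel"
    by simp
  then have "{x. y < w x} \<in> sets borel"
    by (simp add: borel_measurable_indicator_iff)
  then show "{x \<in> space borel. y < w x} \<in> sets borel" by simp
qed

lemma rearrangement_borel [measurable]: "rearrangement M u \<in> borel_measurable borel"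
  by (intro borel_measurable_antimono_ennreal antimonoI rearrangement_antimono)

section \<open>Equimeasurability and order properties on the unit interval\<close>

lemma borel_imp_Mplus: "f \<in> borel_measurable borel \<Longrightarrow> f \<in> Mplus"
  by (simp add: measurable_completion measurable_restrict_space1)

lemma rearrangement_Mplus [measurable]: "rearrangement M u \<in> Mplus"
  by (intro borel_imp_Mplus rearrangement_borel)

lemma Mplus_sets: "f \<in> Mplus \<Longrightarrow> {x \<in> {0<..<1}. c < f x} \<in> sets leb01"
  using borel_measurable_less[of "\<lambda>_. c" leb01 f] by simp

lemma less_rearr01_iff:
  assumes "f \<in> Mplus"
  shows "c < rearr01 f s \<longleftrightarrow> ennreal s < emeasure leb01 {x \<in> {0<..<1}. c < f x}"
proof -
  have "(\<lambda>x. enn2ereal (f x)) \<in> borel_measurable leb01"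
    using assms by measurable
  from less_rearrangement_iff[OF this, of c s] show ?thesis
    by (simp add: less_ennreal.rep_eq)
qed

lemma emeasure_leb01_le_1: "emeasure leb01 A \<le> 1"
  using emeasure_space[of leb01 A] by (simp add: emeasure_restrict_space)

lemma emeasure_leb01_lessThan:
  assumes "0 \<le> t" "t \<le> 1"
  shows "emeasure leb01 {x \<in> {0<..<1}. x < t} = ennreal t"
proof -
  have "{x \<in> {0<..<1}. x < t} = {0<..<t}"
    using assms by auto
  moreover have "emeasure leb01 {0<..<t} = emeasure lebesgue {0<..<t}"
    using assms by (intro emeasure_restrict_space) auto
  ultimately have "emeasure leb01 {x \<in> {0<..<1}. x < t} = emeasure lebesgue {0<..<t}"
    by (rule ssubst)
  also have "\<dots> = ennreal t"
    using assms by simp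
  finally show ?thesis .
qed

lemma emeasure_leb01_ennreal_lessThan:
  assumes "e \<le> 1"
  shows "emeasure leb01 {x \<in> {0<..<1}. ennreal x < e} = e"
proof -
  obtain t where t: "0 \<le> t" "t \<le> 1" "e = ennreal t"
    using assms by (cases e) (auto simp: top_unique)
  have "{x \<in> {0<..<1}. ennreal x < e} = {x \<in> {0<..<1}. x < t}"
    using t by (auto simp: ennreal_less_iff)
  then show ?thesis using emeasure_leb01_lessThan[of t] t by simp
qed

text \<open>Superlevel sets of the rearrangement are initial intervals whose length is the measure
  of the corresponding superlevel set of f.\<close>

lemma emeasure_rearr01:
  assumes "f \<in> Mplus"
  shows "emeasure leb01 {x \<in> {0<..<1}. c < rearr01 f x} = emeasure leb01 {x \<in> {0<..<1}. c < f x}"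
  unfolding less_rearr01_iff[OF assms]
  by (rule emeasure_leb01_ennreal_lessThan[OF emeasure_leb01_le_1])

lemma rearr01_mono:
  assumes "f \<in> Mplus" "g \<in> Mplus"
    and "\<And>c. emeasure leb01 {x \<in> {0<..<1}. c < f x} \<le> emeasure leb01 {x \<in> {0<..<1}. c < g x}"
  shows "rearr01 f s \<le> rearr01 g s"
proof (rule ccontr)
  assume "\<not> rearr01 f s \<le> rearr01 g s"
  then have "ennreal s < emeasure leb01 {x \<in> {0<..<1}. rearr01 g s < f x}"
    by (simp only: not_le less_rearr01_iff[OF assms(1)])
  also note assms(3)
  finally have "rearr01 g s < rearr01 g s"
    by (simp only: less_rearr01_iff[OF assms(2)])
  then show False by simp
qed

lemma rearr01_cong:
  assumes "f \<in> Mplus" "g \<in> Mplus"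
    and "\<And>c. emeasure leb01 {x \<in> {0<..<1}. c < f x} = emeasure leb01 {x \<in> {0<..<1}. c < g x}"
  shows "rearr01 f s = rearr01 g s"
  using assms by (intro antisym rearr01_mono) auto

lemma rearr01_rearr01: "f \<in> Mplus \<Longrightarrow> rearr01 (rearr01 f) s = rearr01 f s"
  by (intro rearr01_cong emeasure_rearr01) measurable

text \<open>If g stays below w on [s,1), then the set where g exceeds w lies in (0,s) and has
  measure at most s. With w = \<open>g s\<close> this serves nonincreasing functions; with any other
  bound on [s,1) it replaces the monotonicity that T_h F lacks for \<alpha> < 1.\<close>

lemma rearr01_le_of_antimono:
  assumes "g \<in> Mplus" "s \<in> {0<..<1}" "\<And>r. r \<in> {0<..<1} \<Longrightarrow> s \<le> r \<Longrightarrow> g r \<le> w"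
  shows "rearr01 g s \<le> w"
proof (rule ccontr)
  assume "\<not> rearr01 g s \<le> w"
  then have "ennreal s < emeasure leb01 {x \<in> {0<..<1}. w < g x}"
    using less_rearr01_iff[OF assms(1), of w s] by (simp add: not_le)
  also have "\<dots> \<le> emeasure leb01 {x \<in> {0<..<1}. x < s}"
  proof (intro emeasure_mono)
    show "{x \<in> {0<..<1}. w < g x} \<subseteq> {x \<in> {0<..<1}. x < s}"
      using assms(3) leD by (fastforce intro: leI)
    have "(\<lambda>x. x) \<in> borel_measurable leb01"
      by (simp add: measurable_completion measurable_restrict_space1)
    then show "{x \<in> {0<..<1}. x < s} \<in> sets leb01"
      using borel_measurable_less[of "\<lambda>x. x" leb01 "\<lambda>_. s"] by simp
  qed
  also have "\<dots> = ennreal s"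
    using assms(2) by (intro emeasure_leb01_lessThan) auto
  finally show False by simp
qed

lemma rearr01_scale:
  assumes f: "f \<in> Mplus" and "0 \<le> c"
  shows "rearr01 (\<lambda>x. ennreal c * f x) s = ennreal c * rearr01 f s"
proof (cases "c = 0")
  case True
  have "\<not> 0 < rearr01 (\<lambda>x. 0) s"
    by (subst less_rearr01_iff) auto
  then show ?thesis using True by simp
next
  case False
  with \<open>0 \<le> c\<close> have c: "0 < ennreal c" "ennreal c \<noteq> top" "ennreal c \<noteq> 0" by auto
  have less: "d < ennreal c * e \<longleftrightarrow> d / ennreal c < e" for d e :: ennreal
    using c by (simp add: divide_less_ennreal mult.commute)
  have "(\<lambda>x. ennreal c * f x) \<in> Mplus" using f by measurable
  then have "d < rearr01 (\<lambda>x. ennreal c * f x) s \<longleftrightarrow> d < ennreal c * rearr01 f s" for d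
    using f by (simp add: less less_rearr01_iff)
  \<comment> \<open>In a linear order, two elements with the same strict lower bounds
    coincide.\<close>
  then show ?thesis by (metis linorder_neq_iff less_irrefl)
qed

section \<open>The Hardy--Littlewood inequality\<close>

lemma sigma_finite_leb01: "sigma_finite_measure leb01"
  by (rule finite_measure.axioms(1)) (intro finite_measure_lebesgue_on, simp)

lemma ennreal_layers:
  "(\<integral>\<^sup>+l. indicator {l. 0 < l \<and> ennreal l < v} l \<partial>lborel) = v"
proof (cases v)
  case (real r)
  then have "{l. 0 < l \<and> ennreal l < v} = {0<..<r}"
    by (auto simp: ennreal_less_iff)
  then show ?thesis using real by simp
next
  case top
  then have "{l. 0 < l \<and> ennreal l < v} = {0<..}" by auto
  moreover have "emeasure lborel {0::real<..} = top"
  proof (rule ccontr)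
    assume "emeasure lborel {0::real<..} \<noteq> top"
    then obtain r where r: "0 \<le> r" "emeasure lborel {0::real<..} = ennreal r"
      by (cases "emeasure lborel {0::real<..}") auto
    have "emeasure lborel {0<..<r + 1} \<le> emeasure lborel {0::real<..}"
      by (intro emeasure_mono) auto
    then show False using r by simp
  qed
  ultimately show ?thesis using top by simp
qed

text \<open>Each value \<open>f x\<close> is the length of the interval of levels l with 0 < l <
  \<open>f x\<close>; Tonelli exchanges the integrations over levels and points.\<close>

lemma layer_cake:
  fixes f g :: "real \<Rightarrow> ennreal"
  assumes [measurable]: "f \<in> Mplus" "g \<in> Mplus"
  shows "(\<integral>\<^sup>+x. f x * g x \<partial>leb01) =
    (\<integral>\<^sup>+l. indicator {0<..} l * (\<integral>\<^sup>+x. indicator {x. ennreal l < f x} x * g x \<partial>leb01) \<partial>lborel)"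
proof -
  interpret pair_sigma_finite leb01 "lborel :: real measure"
    unfolding pair_sigma_finite_def using sigma_finite_leb01 lborel.sigma_finite_measure_axioms
    by blast
  let ?h = "\<lambda>x l. indicator {0<..} l * (indicator {x. ennreal l < f x} x * g x)"
  have m: "case_prod ?h \<in> borel_measurable (leb01 \<Otimes>\<^sub>M lborel)"
    unfolding indicator_def mem_Collect_eq by measurable
  have "(\<integral>\<^sup>+x. f x * g x \<partial>leb01) = (\<integral>\<^sup>+x. (\<integral>\<^sup>+l. ?h x l \<partial>lborel) \<partial>leb01)"
  proof (intro nn_integral_cong)
    fix x
    have "f x * g x = (\<integral>\<^sup>+l. indicator {l. 0 < l \<and> ennreal l < f x} l \<partial>lborel) * g x"
      by (simp add: ennreal_layers)
    also have "\<dots> = (\<integral>\<^sup>+l. indicator {l. 0 < l \<and> ennreal l < f x} l * g x \<partial>lborel)"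
      by (intro nn_integral_multc[symmetric]) measurable
    also have "\<dots> = (\<integral>\<^sup>+l. ?h x l \<partial>lborel)"
      by (intro nn_integral_cong) (auto simp: indicator_def)
    finally show "f x * g x = (\<integral>\<^sup>+l. ?h x l \<partial>lborel)" .
  qed
  also have "\<dots> = (\<integral>\<^sup>+l. (\<integral>\<^sup>+x. ?h x l \<partial>leb01) \<partial>lborel)"
    using Fubini'[OF m] by simp
  also have "\<dots> = (\<integral>\<^sup>+l. indicator {0<..} l * (\<integral>\<^sup>+x. indicator {x. ennreal l < f x} x * g x \<partial>leb01) \<partial>lborel)"
    by (intro nn_integral_cong) (auto simp: indicator_def)
  finally show ?thesis .
qed

lemma nn_integral_indicator_leb01:
  assumes "{x \<in> {0<..<1}. P x} \<in> sets leb01"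
  shows "(\<integral>\<^sup>+x. indicator {x. P x} x \<partial>leb01) = emeasure leb01 {x \<in> {0<..<1}. P x}"
proof -
  have "(\<integral>\<^sup>+x. indicator {x. P x} x \<partial>leb01) = (\<integral>\<^sup>+x. indicator {x \<in> {0<..<1}. P x} x \<partial>leb01)"
    by (intro nn_integral_cong) (auto simp: indicator_def)
  also have "\<dots> = emeasure leb01 {x \<in> {0<..<1}. P x}"
    using assms by (rule nn_integral_indicator)
  finally show ?thesis .
qed

text \<open>Two applications of the layer-cake formula write the integral of a product as a double
  integral, over pairs of levels, of the measure of the joint superlevel set. Comparing these
  measures is therefore enough.\<close>

lemma hardy_littlewood_aux:
  assumes [measurable]: "f \<in> Mplus" "g \<in> Mplus" "f' \<in> Mplus" "g' \<in> Mplus"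
    and le: "\<And>c d. emeasure leb01 {x \<in> {0<..<1}. c < f x \<and> d < g x}
        \<le> emeasure leb01 {x \<in> {0<..<1}. c < f' x \<and> d < g' x}"
  shows "(\<integral>\<^sup>+x. f x * g x \<partial>leb01) \<le> (\<integral>\<^sup>+x. f' x * g' x \<partial>leb01)"
proof -
  have ind: "(\<lambda>x. indicator {x. c < u x} x) \<in> Mplus" if [measurable]: "u \<in> Mplus" for c and u :: "real \<Rightarrow> ennreal"
    unfolding indicator_def mem_Collect_eq by measurable
  have in_sets: "{x \<in> {0<..<1}. c < u x \<and> d < v x} \<in> sets leb01"
    if "u \<in> Mplus" "v \<in> Mplus" for c d and u v :: "real \<Rightarrow> ennreal"
  proof -
    have "{x \<in> {0<..<1}. c < u x \<and> d < v x} = {x \<in> {0<..<1}. c < u x} \<inter> {x \<in> {0<..<1}. d < v x}"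
      by auto
    then show ?thesis using Mplus_sets that by auto
  qed
  have two: "(\<integral>\<^sup>+x. u x * v x \<partial>leb01) =
      (\<integral>\<^sup>+l. indicator {0<..} l * (\<integral>\<^sup>+k. indicator {0<..} k *
         emeasure leb01 {x \<in> {0<..<1}. ennreal l < u x \<and> ennreal k < v x} \<partial>lborel) \<partial>lborel)"
    if [measurable]: "u \<in> Mplus" "v \<in> Mplus" for u v
  proof -
    have "(\<integral>\<^sup>+x. indicator {x. ennreal l < u x} x * v x \<partial>leb01) =
        (\<integral>\<^sup>+k. indicator {0<..} k *
           emeasure leb01 {x \<in> {0<..<1}. ennreal l < u x \<and> ennreal k < v x} \<partial>lborel)" for l
    proof -
      have "(\<integral>\<^sup>+x. indicator {x. ennreal l < u x} x * v x \<partial>leb01) =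
          (\<integral>\<^sup>+x. v x * indicator {x. ennreal l < u x} x \<partial>leb01)"
        by (simp add: mult.commute)
      also have "\<dots> = (\<integral>\<^sup>+k. indicator {0<..} k * (\<integral>\<^sup>+x. indicator {x. ennreal k < v x} x *
           indicator {x. ennreal l < u x} x \<partial>leb01) \<partial>lborel)"
        using that(2) ind[OF that(1)] by (rule layer_cake)
      also have "(\<lambda>k. \<integral>\<^sup>+x. indicator {x. ennreal k < v x} x * indicator {x. ennreal l < u x} x \<partial>leb01)
          = (\<lambda>k. \<integral>\<^sup>+x. indicator {x. ennreal l < u x \<and> ennreal k < v x} x \<partial>leb01)"
        by (intro ext nn_integral_cong) (auto simp: indicator_def)
      finally show ?thesis
        using in_sets[OF that] by (simp add: nn_integral_indicator_leb01)
    qed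
    then show ?thesis using layer_cake[OF that] by simp
  qed
  show ?thesis
    unfolding two[OF assms(1,2)] two[OF assms(3,4)]
    by (intro nn_integral_mono mult_left_mono le) auto
qed

text \<open>Superlevel sets of two rearrangements are initial intervals, hence nested: their
  intersection has the smaller of the two measures, the largest value that any intersection can
  reach.\<close>

theorem hardy_littlewood:
  assumes "f \<in> Mplus" "g \<in> Mplus"
  shows "(\<integral>\<^sup>+x. f x * g x \<partial>leb01) \<le> (\<integral>\<^sup>+x. rearr01 f x * rearr01 g x \<partial>leb01)"
proof (rule hardy_littlewood_aux)
  fix c d
  let ?f = "{x \<in> {0<..<1}. c < f x}" and ?g = "{x \<in> {0<..<1}. d < g x}"
  have "emeasure leb01 {x \<in> {0<..<1}. c < f x \<and> d < g x} \<le> min (emeasure leb01 ?f) (emeasure leb01 ?g)"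
    using Mplus_sets[OF assms(1)] Mplus_sets[OF assms(2)]
    by (intro min.boundedI emeasure_mono) auto
  also have "\<dots> = emeasure leb01 {x \<in> {0<..<1}. ennreal x < min (emeasure leb01 ?f) (emeasure leb01 ?g)}"
    by (intro emeasure_leb01_ennreal_lessThan[symmetric] min.coboundedI1 emeasure_leb01_le_1)
  also have "\<dots> = emeasure leb01 {x \<in> {0<..<1}. c < rearr01 f x \<and> d < rearr01 g x}"
    using assms by (simp add: less_rearr01_iff)
  finally show "emeasure leb01 {x \<in> {0<..<1}. c < f x \<and> d < g x}
     \<le> emeasure leb01 {x \<in> {0<..<1}. c < rearr01 f x \<and> d < rearr01 g x}" .
qed (use assms in measurable)

section \<open>Resonance\<close>

lemma finite_measure_leb01: "finite_measure leb01"
  by (intro finite_measure_lebesgue_on) simp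

lemma leb01_id [measurable]: "(\<lambda>x. x) \<in> borel_measurable leb01"
  by (simp add: measurable_completion measurable_restrict_space1)

text \<open>With l = \<open>rearr01 f t\<close>, the set where f is at least l is a decreasing
  intersection of sets where f exceeds some c < l, and each of these has measure above t. The weak
  inequality matters: the strict superlevel set at l has measure at most t.\<close>

lemma emeasure_rearr01_le_level:
  assumes f: "f \<in> Mplus" and t: "t \<in> {0<..<1}"
  shows "ennreal t \<le> emeasure leb01 {x \<in> {0<..<1}. rearr01 f t \<le> f x}"
proof (cases "rearr01 f t = 0")
  case True
  have "{x::real \<in> {0<..<1}. True} = {x \<in> {0<..<1}. x < 1}" by auto
  then have "emeasure leb01 {x \<in> {0<..<1}. True} = 1"
    using emeasure_leb01_lessThan[of 1] by simp
  with t True show ?thesis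
    by (simp add: ennreal_le_1)
next
  case False
  let ?l = "rearr01 f t"
  have "Sup {..<?l} = ?l"
  proof (intro antisym Sup_least)
    show "?l \<le> Sup {..<?l}"
    proof (rule ccontr)
      assume "\<not> ?l \<le> Sup {..<?l}"
      then obtain d where "Sup {..<?l} < d" "d < ?l"
        using dense[of "Sup {..<?l}" ?l] by (auto simp: not_le)
      then show False using Sup_upper[of d "{..<?l}"] by auto
    qed
  qed auto
  moreover have "0 \<in> {..<?l}" using False by (simp add: zero_less_iff_neq_zero)
  then have "{..<?l} \<noteq> {}" by blast
  ultimately obtain c :: "nat \<Rightarrow> ennreal" where c: "incseq c" "range c \<subseteq> {..<?l}" "(SUP i. c i) = ?l"
    using ennreal_Sup_countable_SUP[of "{..<?l}"] by metis
  let ?B = "\<lambda>n. {x \<in> {0<..<1}. c n < f x}"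
  have "(\<Inter>n. ?B n) = {x \<in> {0<..<1}. ?l \<le> f x}"
  proof (intro equalityI subsetI)
    fix x assume "x \<in> (\<Inter>n. ?B n)"
    then have "x \<in> {0<..<1}" "\<And>n. c n \<le> f x" by (auto intro: less_imp_le)
    then show "x \<in> {x \<in> {0<..<1}. ?l \<le> f x}"
      by (auto simp: c(3)[symmetric] intro: SUP_least)
  next
    fix x assume "x \<in> {x \<in> {0<..<1}. ?l \<le> f x}"
    moreover have "c n < ?l" for n using c(2) by auto
    ultimately show "x \<in> (\<Inter>n. ?B n)"
      using less_le_trans by blast
  qed
  moreover have "(\<lambda>n. emeasure leb01 (?B n)) \<longlonglongrightarrow> emeasure leb01 (\<Inter>n. ?B n)"
  proof (intro Lim_emeasure_decseq)
    show "range ?B \<subseteq> sets leb01" using Mplus_sets[OF f] by auto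
    show "decseq ?B"
      using c(1) by (fastforce simp: decseq_def incseq_def intro: le_less_trans)
    show "emeasure leb01 (?B i) \<noteq> \<infinity>" for i
      using emeasure_leb01_le_1[of "?B i"] by (auto simp: top_unique)
  qed
  moreover have "ennreal t \<le> emeasure leb01 (?B n)" for n
    using c(2) less_rearr01_iff[OF f, of "c n" t] by (auto intro: less_imp_le)
  ultimately show ?thesis
    by (intro LIMSEQ_le_const[of "\<lambda>n. emeasure leb01 (?B n)"]) auto
qed

text \<open>On a plateau of f the superlevel sets jump in measure past t. The gap is filled with the
  part of the plateau to the left of a cut point \<open>a\<close>: at 0 this gives the strict
  superlevel set, at 1 the weak one. The measure is 1-Lipschitz in the cut point, so the
  intermediate value theorem hits t exactly.\<close>

lemma nested_level_sets:
  assumes f: "f \<in> Mplus"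
  obtains E :: "real \<Rightarrow> real set"
  where "\<And>t. t \<in> {0<..<1} \<Longrightarrow> E t \<in> sets leb01"
    and "\<And>t. t \<in> {0<..<1} \<Longrightarrow> measure leb01 (E t) = t"
    and "\<And>t x. t \<in> {0<..<1} \<Longrightarrow> x \<in> E t \<Longrightarrow> rearr01 f t \<le> f x"
    and "\<And>s t. s \<in> {0<..<1} \<Longrightarrow> t \<in> {0<..<1} \<Longrightarrow> s \<le> t \<Longrightarrow> E s \<subseteq> E t"
proof -
  interpret finite_measure leb01 by (rule finite_measure_leb01)
  define H where "H l a = {x \<in> {0<..<1}. l < f x} \<union> {x \<in> {0<..<1}. l \<le> f x \<and> x < a}" for l a
  have H_sets: "H l a \<in> sets leb01" for l a
  proof -
    have "{x \<in> space leb01. l < f x \<or> l \<le> f x \<and> x < a} \<in> sets leb01"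
      using f by measurable
    moreover have "{x \<in> space leb01. l < f x \<or> l \<le> f x \<and> x < a} = H l a"
      by (auto simp: H_def)
    ultimately show ?thesis by simp
  qed
  have H_mono: "H l a \<subseteq> H l b" if "a \<le> b" for l a b
    using that by (auto simp: H_def)
  have cont: "continuous_on {0..1} (\<lambda>a. measure leb01 (H l a))" for l
  proof (rule lipschitz_on_continuous_on)
    have *: "measure leb01 (H l b) - measure leb01 (H l a) \<le> b - a"
      if "0 \<le> a" "a \<le> b" "b \<le> 1" for a b
    proof -
      have ab: "{x \<in> {0<..<1}. a \<le> x \<and> x < b} \<in> sets leb01"
      proof -
        have "{x \<in> space leb01. a \<le> x \<and> x < b} \<in> sets leb01" by measurable
        then show ?thesis by simp
      qed
      have "{x \<in> {0<..<1}. x < b} = {x \<in> {0<..<1}. x < a} \<union> {x \<in> {0<..<1}. a \<le> x \<and> x < b}"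
        using that by auto
      moreover have "{x \<in> {0<..<1}. x < a} \<in> sets leb01"
        using borel_measurable_less[OF leb01_id, of "\<lambda>_. a"] by simp
      ultimately have "measure leb01 {x \<in> {0<..<1}. x < b} =
          measure leb01 {x \<in> {0<..<1}. x < a} + measure leb01 {x \<in> {0<..<1}. a \<le> x \<and> x < b}"
        using ab by (simp add: finite_measure_Union disjoint_iff)
      then have eq: "measure leb01 {x \<in> {0<..<1}. a \<le> x \<and> x < b} = b - a"
        using emeasure_leb01_lessThan[of a] emeasure_leb01_lessThan[of b] that
        by (simp add: measure_def)
      have "H l b \<subseteq> H l a \<union> {x \<in> {0<..<1}. a \<le> x \<and> x < b}"
        by (auto simp: H_def)
      then have "measure leb01 (H l b) \<le> measure leb01 (H l a \<union> {x \<in> {0<..<1}. a \<le> x \<and> x < b})"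
        using H_sets ab by (intro finite_measure_mono) auto
      also have "\<dots> \<le> measure leb01 (H l a) + (b - a)"
        using measure_Un_le[OF H_sets ab, of l a] eq by simp
      finally show ?thesis by simp
    qed
    have **: "measure leb01 (H l a) \<le> measure leb01 (H l b)" if "a \<le> b" for a b
      using H_mono[OF that] H_sets by (intro finite_measure_mono) auto
    show "1-lipschitz_on {0..1} (\<lambda>a. measure leb01 (H l a))"
    proof (rule lipschitz_onI)
      fix a b :: real assume "a \<in> {0..1}" "b \<in> {0..1}"
      then show "dist (measure leb01 (H l a)) (measure leb01 (H l b)) \<le> 1 * dist a b"
        using *[of a b] *[of b a] **[of a b] **[of b a]
        by (cases "a \<le> b") (auto simp: dist_real_def)
    qed simp
  qed
  have "\<exists>a. measure leb01 (H (rearr01 f t) a) = t" if t: "t \<in> {0<..<1}" for t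
  proof -
    let ?l = "rearr01 f t"
    have "H ?l 0 = {x \<in> {0<..<1}. ?l < f x}" by (auto simp: H_def)
    then have "emeasure leb01 (H ?l 0) \<le> ennreal t"
      using less_rearr01_iff[OF f, of ?l t] by (simp add: not_less)
    then have lo: "measure leb01 (H ?l 0) \<le> t"
      using t by (simp add: emeasure_eq_measure)
    have "H ?l 1 = {x \<in> {0<..<1}. ?l \<le> f x}" by (auto simp: H_def)
    then have "ennreal t \<le> emeasure leb01 (H ?l 1)"
      using emeasure_rearr01_le_level[OF f t] by simp
    then have "t \<le> measure leb01 (H ?l 1)"
      using t by (simp add: emeasure_eq_measure)
    then show ?thesis
      using IVT'[OF lo _ _ cont] by auto
  qed
  then obtain a where a: "\<And>t. t \<in> {0<..<1} \<Longrightarrow> measure leb01 (H (rearr01 f t) (a t)) = t"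
    by metis
  show thesis
  proof (rule that[of "\<lambda>t. H (rearr01 f t) (a t)"])
    fix s t :: real assume st: "s \<in> {0<..<1}" "t \<in> {0<..<1}" "s \<le> t"
    consider "s = t" | "rearr01 f t < rearr01 f s" | "s < t" "rearr01 f t = rearr01 f s"
      using st(3) rearrangement_antimono[OF st(3), of leb01 "\<lambda>x. enn2ereal (f x)"] by fastforce
    then show "H (rearr01 f s) (a s) \<subseteq> H (rearr01 f t) (a t)"
    proof cases
      case 2
      have "rearr01 f t < f x" if "x \<in> H (rearr01 f s) (a s)" for x
        using that 2 by (intro less_le_trans[OF 2]) (auto simp: H_def)
      then show ?thesis by (auto simp: H_def)
    next
      case 3
      \<comment> \<open>The cut points are merely chosen, so their order is not built in; on a
        common level it is forced by the measures s < t.\<close>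
      have "a s \<le> a t"
      proof (rule ccontr)
        assume "\<not> a s \<le> a t"
        then have "measure leb01 (H (rearr01 f t) (a t)) \<le> measure leb01 (H (rearr01 f t) (a s))"
          using H_mono H_sets by (intro finite_measure_mono) auto
        then show False using a[OF st(1)] a[OF st(2)] 3 by simp
      qed
      then show ?thesis using 3 H_mono by simp
    qed simp
  qed (use H_sets a in \<open>auto simp: H_def\<close>)
qed

text \<open>The map \<^term>\<open>\<sigma>\<close> is the measure-preserving map of Ryff's theorem; only the inequality
  between \<^term>\<open>f\<close> and its rearrangement composed with \<^term>\<open>\<sigma>\<close> is recorded, as it suffices
  for resonance.\<close>

lemma measure_preserving_rearrangement:
  assumes f: "f \<in> Mplus"
  obtains \<sigma> :: "real \<Rightarrow> real"
  where "\<sigma> \<in> borel_measurable leb01"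
    and "distr leb01 borel \<sigma> = distr leb01 borel (\<lambda>x. x)"
    and "\<And>x. x \<in> {0<..<1} \<Longrightarrow> rearr01 f (\<sigma> x) \<le> f x"
proof -
  interpret finite_measure leb01 by (rule finite_measure_leb01)
  obtain E :: "real \<Rightarrow> real set" where E:
    "\<And>t. t \<in> {0<..<1} \<Longrightarrow> E t \<in> sets leb01"
    "\<And>t. t \<in> {0<..<1} \<Longrightarrow> measure leb01 (E t) = t"
    "\<And>t x. t \<in> {0<..<1} \<Longrightarrow> x \<in> E t \<Longrightarrow> rearr01 f t \<le> f x"
    "\<And>s t. s \<in> {0<..<1} \<Longrightarrow> t \<in> {0<..<1} \<Longrightarrow> s \<le> t \<Longrightarrow> E s \<subseteq> E t"
    by (rule nested_level_sets[OF f]) (rule that; assumption)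
  \<comment> \<open>By nestedness this is the time at which x enters the family E; the inserted 0
    gives a value to points that lie in every E t.\<close>
  define \<sigma> where "\<sigma> x = Sup (insert 0 {t \<in> {0<..<1}. x \<notin> E t})" for x
  have bdd: "bdd_above (insert 0 {t \<in> {0<..<1}. x \<notin> E t})" for x
    by (rule bdd_aboveI[of _ 1]) auto
  have less: "b < \<sigma> x \<longleftrightarrow> b < 0 \<or> (\<exists>t\<in>{0<..<1}. b < t \<and> x \<notin> E t)" for b x
    unfolding \<sigma>_def by (subst less_cSup_iff[OF _ bdd]) auto
  let ?U = "\<lambda>b. {x \<in> {0<..<1}. b < \<sigma> x}"
  \<comment> \<open>Measurability: nestedness replaces the uncountable union over t by one over
    rationals.\<close>
  have rat: "?U b = (\<Union>q\<in>{q \<in> \<rat>. max 0 b < q \<and> q < 1}. {0<..<1} - E q)" if b: "0 \<le> b" for b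
  proof (intro equalityI subsetI)
    fix x assume "x \<in> ?U b"
    then obtain t where t: "x \<in> {0<..<1}" "t \<in> {0<..<1}" "b < t" "x \<notin> E t"
      using b by (auto simp: less)
    then obtain q where q: "q \<in> \<rat>" "max 0 b < q" "q < t"
      using Rats_dense_in_real[of "max 0 b" t] by auto
    then have "x \<notin> E q" using E(4)[of q t] t by auto
    then show "x \<in> (\<Union>q\<in>{q \<in> \<rat>. max 0 b < q \<and> q < 1}. {0<..<1} - E q)"
      using q t by auto
  qed (auto simp: less)
  have U_sets: "?U b \<in> sets leb01" for b
  proof (cases "0 \<le> b")
    case True
    have "countable {q::real \<in> \<rat>. max 0 b < q \<and> q < 1}"
      using countable_rat by (rule countable_subset[rotated]) auto
    then show ?thesis
      unfolding rat[OF True] using E(1) sets.top[of leb01]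
      by (intro sets.countable_UN') auto
  next
    case False
    then have "?U b = space leb01" by (auto simp: less)
    then show ?thesis using sets.top[of leb01] by simp
  qed
  have \<sigma>: "\<sigma> \<in> borel_measurable leb01"
    using U_sets by (auto simp: borel_measurable_iff_greater)
  have comp: "measure leb01 ({0<..<1} - E t) = 1 - t" if "t \<in> {0<..<1}" for t
    using finite_measure_compl[OF E(1)[OF that]] E(2)[OF that] by (simp add: measure_restrict_space)
  \<comment> \<open>The set where \<sigma> exceeds b is contained in the complement of E b and
    contains the complement of E t for every t > b; letting t decrease to b closes the gap.\<close>
  have U_eq: "measure leb01 (?U b) = 1 - b" if b: "0 \<le> b" "b < 1" for b
  proof (rule antisym)
    show "measure leb01 (?U b) \<le> 1 - b"
    proof (cases "b = 0")
      case True
      then show ?thesis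
        using emeasure_leb01_le_1[of "?U b"] by (simp add: emeasure_eq_measure)
    next
      case False
      with b have b': "b \<in> {0<..<1}" by auto
      have "?U b \<subseteq> {0<..<1} - E b"
      proof
        fix x assume x: "x \<in> ?U b"
        then obtain t where t: "t \<in> {0<..<1}" "b < t" "x \<notin> E t"
          using b by (auto simp: less)
        then have "E b \<subseteq> E t" using E(4)[OF b', of t] by simp
        then show "x \<in> {0<..<1} - E b" using x t by auto
      qed
      then have "measure leb01 (?U b) \<le> measure leb01 ({0<..<1} - E b)"
        using E(1)[OF b'] sets.top[of leb01] by (intro finite_measure_mono) auto
      then show ?thesis using comp[OF b'] by simp
    qed
    show "1 - b \<le> measure leb01 (?U b)"
    proof (rule field_le_epsilon)
        fix e :: real assume "0 < e"
        define t where "t = min (b + e) ((b + 1) / 2)"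
        have t: "t \<in> {0<..<1}" "b < t" "t \<le> b + e"
          using b \<open>0 < e\<close> by (auto simp: t_def min_def)
        have "{0<..<1} - E t \<subseteq> ?U b"
          using t by (auto simp: less)
        then have "measure leb01 ({0<..<1} - E t) \<le> measure leb01 (?U b)"
          using U_sets by (intro finite_measure_mono) auto
        then show "1 - b \<le> measure leb01 (?U b) + e"
          using comp[OF t(1)] t by simp
    qed
  qed
  have V_eq: "measure leb01 {x \<in> {0<..<1}. b < x} = 1 - b" if b: "0 \<le> b" "b < 1" for b
  proof -
    have "{x \<in> {0<..<1}. b < x} = {b<..<1}" using b by auto
    moreover have "measure leb01 {b<..<1} = measure lebesgue {b<..<1}"
      using b by (intro measure_restrict_space) auto
    ultimately have "measure leb01 {x \<in> {0<..<1}. b < x} = measure lebesgue {b<..<1}"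
      by (rule ssubst)
    also have "\<dots> = 1 - b" using b by simp
    finally show ?thesis .
  qed
  have "distr leb01 borel \<sigma> = distr leb01 borel (\<lambda>x. x)"
  proof (rule measure_eqI_lessThan)
    fix b :: real
    have 1: "emeasure (distr leb01 borel \<sigma>) {b<..} = emeasure leb01 (?U b)"
      using \<sigma> by (subst emeasure_distr) (auto simp: vimage_def Int_def conj_commute)
    have 2: "emeasure (distr leb01 borel (\<lambda>x. x)) {b<..} = emeasure leb01 {x \<in> {0<..<1}. b < x}"
      by (subst emeasure_distr) (auto simp: vimage_def Int_def conj_commute)
    show "emeasure (distr leb01 borel \<sigma>) {b<..} < \<infinity>"
      unfolding 1 by (rule le_less_trans[OF emeasure_leb01_le_1]) simp
    consider "b < 0" | "0 \<le> b" "b < 1" | "1 \<le> b" by linarith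
    then have "emeasure leb01 (?U b) = emeasure leb01 {x \<in> {0<..<1}. b < x}"
    proof cases
      case 1
      then have "?U b = {x \<in> {0<..<1}. b < x}" by (auto simp: less)
      then show ?thesis by simp
    next
      case 2
      then show ?thesis using U_eq V_eq by (simp add: emeasure_eq_measure)
    next
      case 3
      then have "?U b = {}" "{x \<in> {0<..<1}. b < x} = {}" by (auto simp: less)
      then show ?thesis by (simp only:)
    qed
    then show "emeasure (distr leb01 borel \<sigma>) {b<..} = emeasure (distr leb01 borel (\<lambda>x. x)) {b<..}"
      unfolding 1 2 .
  qed auto
  \<comment> \<open>Otherwise some t lies strictly between \<sigma> x and the measure m of the set
    where f exceeds \<open>f x\<close>. Then x is in E t, so \<open>rearr01 f t\<close> is at most
    \<open>f x\<close>, whereas t < m says the opposite.\<close>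
  moreover have "rearr01 f (\<sigma> x) \<le> f x" for x
  proof (rule ccontr)
    assume "\<not> rearr01 f (\<sigma> x) \<le> f x"
    then have *: "ennreal (\<sigma> x) < emeasure leb01 {y \<in> {0<..<1}. f x < f y}"
      by (simp only: not_le less_rearr01_iff[OF f])
    define m where "m = measure leb01 {y \<in> {0<..<1}. f x < f y}"
    have "0 \<le> \<sigma> x"
      using less[of "\<sigma> x" x] by auto
    then have "\<sigma> x < m"
      using * by (simp add: emeasure_eq_measure m_def ennreal_less_iff)
    moreover have "m \<le> 1"
      using emeasure_leb01_le_1[of "{y \<in> {0<..<1}. f x < f y}"]
      by (simp add: emeasure_eq_measure m_def)
    ultimately obtain t where t: "\<sigma> x < t" "t < m" "t \<in> {0<..<1}"
      using dense[of "\<sigma> x" m] \<open>0 \<le> \<sigma> x\<close> by auto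
    then have "x \<in> E t"
      using less[of "\<sigma> x" x] by auto
    then have "rearr01 f t \<le> f x" using E(3) t by auto
    moreover have "f x < rearr01 f t"
      using t by (subst less_rearr01_iff[OF f]) (simp add: emeasure_eq_measure m_def ennreal_less_iff)
    ultimately show False by simp
  qed
  ultimately show thesis using that \<sigma> by blast
qed

text \<open>The witness is \<open>rearr01 g\<close> composed with the measure-preserving map
  \<sigma> of f. It is equimeasurable with g, and after transport by \<sigma> the left integrand is
  bounded pointwise because \<open>rearr01 f\<close> composed with \<sigma> is at most f. So the
  Hardy--Littlewood bound is reached within the class of functions equimeasurable with g.\<close>

theorem resonance:
  assumes f: "f \<in> Mplus" and g: "g \<in> Mplus"
  obtains h where "h \<in> Mplus" "\<And>s. rearr01 h s = rearr01 g s"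
    "(\<integral>\<^sup>+x. rearr01 f x * rearr01 g x \<partial>leb01) \<le> (\<integral>\<^sup>+x. f x * h x \<partial>leb01)"
proof -
  obtain \<sigma> :: "real \<Rightarrow> real" where \<sigma> [measurable]: "\<sigma> \<in> borel_measurable leb01"
    and distr: "distr leb01 borel \<sigma> = distr leb01 borel (\<lambda>x. x)"
    and le: "\<And>x. x \<in> {0<..<1} \<Longrightarrow> rearr01 f (\<sigma> x) \<le> f x"
    by (rule measure_preserving_rearrangement[OF f]) (rule that; assumption)
  have transport: "(\<integral>\<^sup>+x. \<phi> (\<sigma> x) \<partial>leb01) = (\<integral>\<^sup>+x. \<phi> x \<partial>leb01)"
    if [measurable]: "\<phi> \<in> borel_measurable borel" for \<phi> :: "real \<Rightarrow> ennreal"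
  proof -
    have "(\<integral>\<^sup>+x. \<phi> (\<sigma> x) \<partial>leb01) = (\<integral>\<^sup>+x. \<phi> x \<partial>distr leb01 borel \<sigma>)"
      by (rule nn_integral_distr[symmetric]) simp_all
    also have "\<dots> = (\<integral>\<^sup>+x. \<phi> x \<partial>leb01)"
      unfolding distr by (rule nn_integral_distr) simp_all
    finally show ?thesis .
  qed
  let ?h = "\<lambda>x. rearr01 g (\<sigma> x)"
  have h: "?h \<in> Mplus" by measurable
  show thesis
  proof (rule that[OF h])
    fix s
    have "emeasure leb01 {x \<in> {0<..<1}. c < ?h x} = emeasure leb01 {x \<in> {0<..<1}. c < rearr01 g x}" for c
    proof -
      have "emeasure leb01 {x \<in> {0<..<1}. c < ?h x} = (\<integral>\<^sup>+x. indicator {y. c < rearr01 g y} (\<sigma> x) \<partial>leb01)"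
        using nn_integral_indicator_leb01[OF Mplus_sets[OF h]] by (simp add: indicator_def)
      also have "\<dots> = (\<integral>\<^sup>+x. indicator {y. c < rearr01 g y} x \<partial>leb01)"
        by (intro transport) measurable
      also have "\<dots> = emeasure leb01 {x \<in> {0<..<1}. c < rearr01 g x}"
        by (intro nn_integral_indicator_leb01 Mplus_sets) measurable
      finally show ?thesis .
    qed
    then have "rearr01 ?h s = rearr01 (rearr01 g) s"
      by (intro rearr01_cong h) measurable
    then show "rearr01 ?h s = rearr01 g s"
      using rearr01_rearr01[OF g] by simp
  next
    have "(\<integral>\<^sup>+x. rearr01 f x * rearr01 g x \<partial>leb01) = (\<integral>\<^sup>+x. rearr01 f (\<sigma> x) * rearr01 g (\<sigma> x) \<partial>leb01)"
      by (intro transport[symmetric]) measurable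
    also have "\<dots> \<le> (\<integral>\<^sup>+x. f x * ?h x \<partial>leb01)"
      by (intro nn_integral_mono mult_right_mono) (auto intro: le)
    finally show "(\<integral>\<^sup>+x. rearr01 f x * rearr01 g x \<partial>leb01) \<le> (\<integral>\<^sup>+x. f x * ?h x \<partial>leb01)" .
  qed
qed

section \<open>Associate norms\<close>

lemma Mplus_const [measurable]: "(\<lambda>x. c) \<in> Mplus" for c :: ennreal
  by simp

lemma associate_norm_cong:
  assumes "\<And>s. s \<in> {0<..<1} \<Longrightarrow> f s = g s"
  shows "associate_norm N f = associate_norm N g"
proof -
  have "(\<integral>\<^sup>+s. h s * f s \<partial>leb01) = (\<integral>\<^sup>+s. h s * g s \<partial>leb01)" for h
    using assms by (intro nn_integral_cong) simp
  then show ?thesis by (simp add: associate_norm_def)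
qed

lemma associate_norm_mono:
  assumes "\<And>s. s \<in> {0<..<1} \<Longrightarrow> f s \<le> g s"
  shows "associate_norm N f \<le> associate_norm N g"
  unfolding associate_norm_def
  using assms by (intro SUP_mono') (auto intro!: nn_integral_mono mult_left_mono)

lemma associate_norm_upper:
  assumes "f \<in> Mplus" "N f \<le> 1"
  shows "(\<integral>\<^sup>+s. f s * g s \<partial>leb01) \<le> associate_norm N g"
  unfolding associate_norm_def using assms by (intro SUP_upper) auto

lemma associate_norm_least:
  assumes "\<And>f. f \<in> Mplus \<Longrightarrow> N f \<le> 1 \<Longrightarrow> (\<integral>\<^sup>+s. f s * g s \<partial>leb01) \<le> C"
  shows "associate_norm N g \<le> C"
  unfolding associate_norm_def using assms by (intro SUP_least) auto

lemma associate_norm_scale: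
  assumes "g \<in> Mplus"
  shows "associate_norm N (\<lambda>x. c * g x) = c * associate_norm N g"
proof -
  have "(\<integral>\<^sup>+s. f s * (c * g s) \<partial>leb01) = c * (\<integral>\<^sup>+s. f s * g s \<partial>leb01)" if "f \<in> Mplus" for f
  proof -
    have "(\<integral>\<^sup>+s. f s * (c * g s) \<partial>leb01) = (\<integral>\<^sup>+s. c * (f s * g s) \<partial>leb01)"
      by (intro nn_integral_cong) (simp add: mult_ac)
    also have "\<dots> = c * (\<integral>\<^sup>+s. f s * g s \<partial>leb01)"
      using assms that by (intro nn_integral_cmult) measurable
    finally show ?thesis .
  qed
  then have "associate_norm N (\<lambda>x. c * g x) =
      (SUP f \<in> {f \<in> Mplus. N f \<le> 1}. c * (\<integral>\<^sup>+s. f s * g s \<partial>leb01))"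
    unfolding associate_norm_def by (intro SUP_cong) auto
  then show ?thesis
    by (simp add: associate_norm_def SUP_mult_left_ennreal)
qed

lemma associate_norm_add:
  assumes "f \<in> Mplus" "g \<in> Mplus"
  shows "associate_norm N (\<lambda>x. f x + g x) \<le> associate_norm N f + associate_norm N g"
proof (rule associate_norm_least)
  fix h assume h: "h \<in> Mplus" "N h \<le> 1"
  have "(\<integral>\<^sup>+s. h s * (f s + g s) \<partial>leb01) = (\<integral>\<^sup>+s. h s * f s + h s * g s \<partial>leb01)"
    by (simp add: distrib_left)
  also have "\<dots> = (\<integral>\<^sup>+s. h s * f s \<partial>leb01) + (\<integral>\<^sup>+s. h s * g s \<partial>leb01)"
    using h(1) assms by (intro nn_integral_add borel_measurable_times_ennreal)
  also have "\<dots> \<le> associate_norm N f + associate_norm N g"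
    using h by (intro add_mono associate_norm_upper) auto
  finally show "(\<integral>\<^sup>+s. h s * (f s + g s) \<partial>leb01) \<le> associate_norm N f + associate_norm N g" .
qed

lemma associate_norm_suminf:
  assumes "\<And>j. F j \<in> Mplus"
  shows "associate_norm N (\<lambda>x. \<Sum>j. F j x) \<le> (\<Sum>j. associate_norm N (F j))"
proof (rule associate_norm_least)
  fix h assume h: "h \<in> Mplus" "N h \<le> 1"
  have "(\<integral>\<^sup>+s. h s * (\<Sum>j. F j s) \<partial>leb01) = (\<integral>\<^sup>+s. (\<Sum>j. h s * F j s) \<partial>leb01)"
    by simp
  also have "\<dots> = (\<Sum>j. \<integral>\<^sup>+s. h s * F j s \<partial>leb01)"
    using h(1) assms by (intro nn_integral_suminf) measurable
  also have "\<dots> \<le> (\<Sum>j. associate_norm N (F j))"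
    using h by (intro suminf_le associate_norm_upper) auto
  finally show "(\<integral>\<^sup>+s. h s * (\<Sum>j. F j s) \<partial>leb01) \<le> (\<Sum>j. associate_norm N (F j))" .
qed

text \<open>Hardy--Littlewood gives one inequality. For the other, resonance trades the test
  function f for an equimeasurable one, which has the same N and is therefore still admissible. Only
  invariance of N is assumed, so that functionals not yet known to be norms are covered.\<close>

lemma associate_norm_rearr:
  assumes inv: "\<And>f g. f \<in> Mplus \<Longrightarrow> g \<in> Mplus \<Longrightarrow>
      (\<forall>s\<in>{0<..<1}. rearr01 f s = rearr01 g s) \<Longrightarrow> N f = N g"
    and g: "g \<in> Mplus"
  shows "associate_norm N g =
    (SUP f \<in> {f \<in> Mplus. N f \<le> 1}. \<integral>\<^sup>+s. rearr01 f s * rearr01 g s \<partial>leb01)" (is "_ = ?R")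
proof (rule antisym)
  show "associate_norm N g \<le> ?R"
    unfolding associate_norm_def using g by (intro SUP_subset_mono) (auto intro: hardy_littlewood)
  show "?R \<le> associate_norm N g"
  proof (rule SUP_least)
    fix f assume "f \<in> {f \<in> Mplus. N f \<le> 1}"
    then have f: "f \<in> Mplus" "N f \<le> 1" by auto
    obtain h where h: "h \<in> Mplus" "\<And>s. rearr01 h s = rearr01 f s"
      "(\<integral>\<^sup>+x. rearr01 g x * rearr01 f x \<partial>leb01) \<le> (\<integral>\<^sup>+x. g x * h x \<partial>leb01)"
      by (rule resonance[OF g f(1)]) (rule that; assumption)
    have "N h = N f" using h f by (intro inv) auto
    then have "(\<integral>\<^sup>+x. h x * g x \<partial>leb01) \<le> associate_norm N g"
      using h f by (intro associate_norm_upper) auto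
    then show "(\<integral>\<^sup>+x. rearr01 f x * rearr01 g x \<partial>leb01) \<le> associate_norm N g"
      using h(3) by (simp add: mult.commute)
  qed
qed

lemma associate_norm_rearr_mono:
  assumes inv: "\<And>f g. f \<in> Mplus \<Longrightarrow> g \<in> Mplus \<Longrightarrow>
      (\<forall>s\<in>{0<..<1}. rearr01 f s = rearr01 g s) \<Longrightarrow> N f = N g"
    and "f \<in> Mplus" "g \<in> Mplus" "\<And>s. s \<in> {0<..<1} \<Longrightarrow> rearr01 f s \<le> rearr01 g s"
  shows "associate_norm N f \<le> associate_norm N g"
proof -
  have "associate_norm N u = (SUP h \<in> {h \<in> Mplus. N h \<le> 1}. \<integral>\<^sup>+s. rearr01 h s * rearr01 u s \<partial>leb01)"
    if "u \<in> Mplus" for u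
    using inv that by (rule associate_norm_rearr)
  then show ?thesis
    using assms(2-4) by (auto intro!: SUP_subset_mono nn_integral_mono mult_left_mono)
qed

text \<open>Homogeneity allows testing with multiples of f inside the unit ball. If
  \<open>N f\<close> vanishes, every multiple is admissible, which forces the integral to be 0;
  otherwise the multiple 1 / \<open>N f\<close> gives the bound.\<close>

lemma associate_norm_hoelder:
  assumes scale: "\<And>f c. f \<in> Mplus \<Longrightarrow> (0::real) \<le> c \<Longrightarrow> N (\<lambda>x. ennreal c * f x) = ennreal c * N f"
    and f: "f \<in> Mplus" and g: "g \<in> Mplus" and le: "associate_norm N g \<le> ennreal C" and "0 < C"
  shows "(\<integral>\<^sup>+s. f s * g s \<partial>leb01) \<le> ennreal C * N f"
proof -
  have *: "ennreal c * (\<integral>\<^sup>+s. f s * g s \<partial>leb01) \<le> ennreal C" if "0 \<le> c" "ennreal c * N f \<le> 1" for c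
  proof -
    have "(\<integral>\<^sup>+s. (ennreal c * f s) * g s \<partial>leb01) \<le> associate_norm N g"
      using f that by (intro associate_norm_upper) (auto simp: scale)
    also note le
    also have "(\<integral>\<^sup>+s. (ennreal c * f s) * g s \<partial>leb01) = ennreal c * (\<integral>\<^sup>+s. f s * g s \<partial>leb01)"
      using f g by (subst nn_integral_cmult[symmetric]) (auto simp: mult.assoc)
    finally show ?thesis .
  qed
  consider "N f = 0" | "N f = top" | r where "N f = ennreal r" "0 < r"
    using \<open>0 < C\<close> by (cases "N f") (auto simp: less_le)
  then show ?thesis
  proof cases
    case 1
    then have fin: "ennreal (real n) * (\<integral>\<^sup>+s. f s * g s \<partial>leb01) \<le> ennreal C" for n
      using *[of "real n"] by simp
    have "(\<integral>\<^sup>+s. f s * g s \<partial>leb01) = 0"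
    proof (cases "\<integral>\<^sup>+s. f s * g s \<partial>leb01")
      case (real y)
      have "real n * y \<le> C" for n
        using fin[of n] real \<open>0 < C\<close> by (simp add: ennreal_mult[symmetric])
      then have "y \<le> 0"
        using reals_Archimedean3[of y] by (metis linorder_not_less)
      then show ?thesis using real by simp
    next
      case top
      then show ?thesis using fin[of 1] by (simp add: top_unique)
    qed
    then show ?thesis by simp
  next
    case 2
    then show ?thesis using \<open>0 < C\<close> by (simp add: ennreal_mult_top)
  next
    case 3
    then have "ennreal (1 / r) * (\<integral>\<^sup>+s. f s * g s \<partial>leb01) \<le> ennreal C"
      by (intro *) (auto simp: ennreal_mult[symmetric])
    then have "ennreal r * (ennreal (1 / r) * (\<integral>\<^sup>+s. f s * g s \<partial>leb01)) \<le> ennreal r * ennreal C"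
      by (rule mult_left_mono) simp
    moreover have "ennreal r * (ennreal (1 / r) * z) = z" for z
      using 3 by (simp add: mult.assoc[symmetric] ennreal_mult[symmetric])
    ultimately show ?thesis using 3 by (simp add: mult.commute)
  qed
qed

text \<open>A positive constant in the unit ball of N, used as a test function, detects where g is
  nonzero.\<close>

lemma associate_norm_zero_iff:
  assumes c: "0 < c" "N (\<lambda>x. ennreal c) \<le> 1" and g: "g \<in> Mplus"
  shows "associate_norm N g = 0 \<longleftrightarrow> (AE x in leb01. g x = 0)"
proof
  assume "associate_norm N g = 0"
  then have "(\<integral>\<^sup>+s. ennreal c * g s \<partial>leb01) \<le> 0"
    using associate_norm_upper[of "\<lambda>x. ennreal c" N g] c(2) by simp
  then have "(\<integral>\<^sup>+s. ennreal c * g s \<partial>leb01) = 0" by simp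
  then have "AE x in leb01. ennreal c * g x = 0"
    using g by (subst (asm) nn_integral_0_iff_AE) auto
  then show "AE x in leb01. g x = 0"
    using c(1) by simp
next
  assume *: "AE x in leb01. g x = 0"
  have "(\<integral>\<^sup>+s. f s * g s \<partial>leb01) \<le> 0" for f
  proof -
    have "(\<integral>\<^sup>+s. f s * g s \<partial>leb01) = (\<integral>\<^sup>+s. 0 \<partial>leb01)"
      using * by (intro nn_integral_cong_AE) (auto elim: eventually_mono)
    then show ?thesis by simp
  qed
  then show "associate_norm N g = 0"
    using associate_norm_least[of N g 0] by simp
qed

text \<open>Monotone convergence turns each test integral into a supremum over j, and suprema over j
  and over test functions commute.\<close>

lemma associate_norm_monotone_convergence:
  assumes F: "\<And>j. F j \<in> Mplus" and f: "f \<in> Mplus"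
    and conv: "AE x in leb01. incseq (\<lambda>j. F j x) \<and> (\<lambda>j. F j x) \<longlonglongrightarrow> f x"
  shows "incseq (\<lambda>j. associate_norm N (F j)) \<and>
    (\<lambda>j. associate_norm N (F j)) \<longlonglongrightarrow> associate_norm N f"
proof -
  have mono: "associate_norm N u \<le> associate_norm N v" if "AE x in leb01. u x \<le> v x" for u v
    unfolding associate_norm_def using that
    by (intro SUP_subset_mono nn_integral_mono_AE order_refl) (auto elim!: eventually_mono intro: mult_left_mono)
  have inc: "incseq (\<lambda>j. associate_norm N (F j))"
    using conv by (intro incseq_SucI mono) (auto elim!: eventually_mono dest: incseq_SucD)
  have sup: "AE x in leb01. f x = (SUP j. F j x)"
    using conv by (rule eventually_mono) (auto dest!: LIMSEQ_SUP intro: LIMSEQ_unique)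
  have int: "(\<integral>\<^sup>+x. h x * f x \<partial>leb01) = (SUP j. \<integral>\<^sup>+x. h x * F j x \<partial>leb01)" if "h \<in> Mplus" for h
  proof -
    have "(\<integral>\<^sup>+x. h x * f x \<partial>leb01) = (\<integral>\<^sup>+x. (SUP j. h x * F j x) \<partial>leb01)"
      using sup by (intro nn_integral_cong_AE) (auto elim!: eventually_mono simp: SUP_mult_left_ennreal)
    also have "\<dots> = (SUP j. \<integral>\<^sup>+x. h x * F j x \<partial>leb01)"
    proof (rule nn_integral_monotone_convergence_SUP_AE)
      show "AE x in leb01. h x * F i x \<le> h x * F (Suc i) x" for i
        using conv by (auto elim!: eventually_mono dest: incseq_SucD intro: mult_left_mono)
    qed (use that F in measurable)
    finally show ?thesis .
  qed
  have "associate_norm N f = (SUP j. associate_norm N (F j))"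
    unfolding associate_norm_def
    by (subst SUP_commute) (auto intro!: SUP_cong simp: int)
  then show ?thesis
    using inc LIMSEQ_SUP[OF inc] by simp
qed

text \<open>A supremum of integrals is automatically homogeneous, subadditive, monotone and
  continuous along increasing sequences. The constant in the unit ball yields definiteness and P5,
  the bound C on integrals yields P4, and \<open>inv\<close> yields P6 through resonance. It is
  stated for a bare functional N so that it applies to the functionals prescribed by
  \<open>assoc_functional\<close>.\<close>

lemma ri_function_norm_associate_norm:
  assumes inv: "\<And>f g. f \<in> Mplus \<Longrightarrow> g \<in> Mplus \<Longrightarrow>
      (\<forall>s\<in>{0<..<1}. rearr01 f s = rearr01 g s) \<Longrightarrow> N f = N g"
    and c: "0 < c" "N (\<lambda>x. ennreal c) \<le> 1"
    and C: "\<And>f. f \<in> Mplus \<Longrightarrow> N f \<le> 1 \<Longrightarrow> (\<integral>\<^sup>+x. f x \<partial>leb01) \<le> ennreal C"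
  shows "ri_function_norm (associate_norm N)"
proof
  fix f :: "real \<Rightarrow> ennreal" assume f: "f \<in> Mplus"
  show "associate_norm N f = 0 \<longleftrightarrow> (AE x in leb01. f x = 0)"
    by (rule associate_norm_zero_iff[of c]) (fact c f)+
next
  fix f :: "real \<Rightarrow> ennreal" and c :: real assume f: "f \<in> Mplus"
  show "associate_norm N (\<lambda>x. ennreal c * f x) = ennreal c * associate_norm N f"
    using f by (rule associate_norm_scale)
next
  fix f g :: "real \<Rightarrow> ennreal" assume "f \<in> Mplus" "g \<in> Mplus"
  then show "associate_norm N (\<lambda>x. f x + g x) \<le> associate_norm N f + associate_norm N g"
    by (rule associate_norm_add)
next
  fix f g :: "real \<Rightarrow> ennreal" assume "AE x in leb01. f x \<le> g x"
  then show "associate_norm N f \<le> associate_norm N g"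
    unfolding associate_norm_def
    by (intro SUP_subset_mono nn_integral_mono_AE order_refl) (auto elim!: eventually_mono intro: mult_left_mono)
next
  fix F :: "nat \<Rightarrow> real \<Rightarrow> ennreal" and f :: "real \<Rightarrow> ennreal"
  assume "\<And>j. F j \<in> Mplus" "f \<in> Mplus"
    "AE x in leb01. incseq (\<lambda>j. F j x) \<and> (\<lambda>j. F j x) \<longlonglongrightarrow> f x"
  then show "incseq (\<lambda>j. associate_norm N (F j)) \<and>
      (\<lambda>j. associate_norm N (F j)) \<longlonglongrightarrow> associate_norm N f"
    by (rule associate_norm_monotone_convergence)
next
  have "associate_norm N (\<lambda>x. 1) \<le> ennreal C"
    using C by (intro associate_norm_least) simp
  then show "associate_norm N (\<lambda>x. 1) < \<infinity>"
    by (simp add: le_less_trans)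
next
  have "(\<integral>\<^sup>+x. f x \<partial>leb01) \<le> ennreal (1 / c) * associate_norm N f" if f: "f \<in> Mplus" for f
  proof -
    have "ennreal c * (\<integral>\<^sup>+x. f x \<partial>leb01) = (\<integral>\<^sup>+x. ennreal c * f x \<partial>leb01)"
      using f by (rule nn_integral_cmult[symmetric])
    also have "\<dots> \<le> associate_norm N f"
      using c(2) by (intro associate_norm_upper) auto
    finally have "ennreal (1 / c) * (ennreal c * (\<integral>\<^sup>+x. f x \<partial>leb01)) \<le> ennreal (1 / c) * associate_norm N f"
      by (rule mult_left_mono) simp
    then show ?thesis
      using c(1) by (simp add: mult.assoc[symmetric] ennreal_mult[symmetric])
  qed
  then show "\<exists>C::real. 0 \<le> C \<and> (\<forall>f\<in>Mplus. (\<integral>\<^sup>+x. f x \<partial>leb01) \<le> ennreal C * associate_norm N f)"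
    using c(1) by (intro exI[of _ "1 / c"]) auto
next
  fix f g :: "real \<Rightarrow> ennreal"
  assume fg: "f \<in> Mplus" "g \<in> Mplus" and eq: "\<forall>s\<in>{0<..<1}. rearr01 f s = rearr01 g s"
  show "associate_norm N f = associate_norm N g"
    by (intro antisym associate_norm_rearr_mono[of N, OF inv] fg) (use eq in auto)
qed

context ri_function_norm
begin

lemma associate_norm_const_finite: "\<exists>C::real. 0 < C \<and> associate_norm N (\<lambda>x. 1) \<le> ennreal C"
proof -
  obtain C :: real where C: "0 \<le> C" "\<And>f. f \<in> Mplus \<Longrightarrow> (\<integral>\<^sup>+x. f x \<partial>leb01) \<le> ennreal C * N f"
    using P5 by auto
  have "associate_norm N (\<lambda>x. 1) \<le> ennreal (C + 1)"
  proof (rule associate_norm_least)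
    fix f assume f: "f \<in> Mplus" "N f \<le> 1"
    have "(\<integral>\<^sup>+x. f x * 1 \<partial>leb01) \<le> ennreal C * N f" using C f by simp
    also have "\<dots> \<le> ennreal C * 1" using f by (intro mult_left_mono) auto
    also have "\<dots> \<le> ennreal (C + 1)" by (simp add: ennreal_leI)
    finally show "(\<integral>\<^sup>+x. f x * 1 \<partial>leb01) \<le> ennreal (C + 1)" .
  qed
  with C show ?thesis by (intro exI[of _ "C + 1"]) auto
qed

lemma exists_unit_const: "\<exists>c::real. 0 < c \<and> N (\<lambda>x. ennreal c) \<le> 1"
proof -
  obtain r where r: "0 \<le> r" "N (\<lambda>x. 1) = ennreal r"
    using P4 by (cases "N (\<lambda>x. 1)") auto
  have "N (\<lambda>x. ennreal (1 / (r + 1)) * 1) = ennreal (1 / (r + 1)) * N (\<lambda>x. 1)"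
    using r by (intro P1_scale) auto
  also have "\<dots> \<le> 1"
    using r by (simp add: ennreal_mult[symmetric])
  finally show ?thesis using r by (intro exI[of _ "1 / (r + 1)"]) auto
qed

lemma ae_cong: "f \<in> Mplus \<Longrightarrow> g \<in> Mplus \<Longrightarrow> AE x in leb01. f x = g x \<Longrightarrow> N f = N g"
  by (intro antisym P2) (auto elim: eventually_mono)

lemma fatou:
  assumes F: "\<And>j. F j \<in> Mplus" and f: "f \<in> Mplus" and lim: "AE x in leb01. (\<lambda>j. F j x) \<longlonglongrightarrow> f x"
    and le: "\<And>j. N (F j) \<le> C"
  shows "N f \<le> C"
proof -
  define G where "G j x = (INF i\<in>{j..}. F i x)" for j x
  have G: "G j \<in> Mplus" for j
    unfolding G_def using F by (intro borel_measurable_INF) auto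
  have "incseq (\<lambda>j. G j x)" for x
    unfolding G_def incseq_def by (auto intro!: INF_superset_mono)
  moreover have "(\<lambda>j. G j x) \<longlonglongrightarrow> f x" if "(\<lambda>j. F j x) \<longlonglongrightarrow> f x" for x
  proof -
    have "(\<lambda>j. G j x) \<longlonglongrightarrow> (SUP j. G j x)"
      using \<open>incseq (\<lambda>j. G j x)\<close> by (rule LIMSEQ_SUP)
    also have "(SUP j. G j x) = liminf (\<lambda>j. F j x)"
      by (simp add: G_def liminf_SUP_INF)
    also have "\<dots> = f x"
      using that by (intro lim_imp_Liminf) auto
    finally show ?thesis .
  qed
  ultimately have "AE x in leb01. incseq (\<lambda>j. G j x) \<and> (\<lambda>j. G j x) \<longlonglongrightarrow> f x"
    by (intro eventually_mono[OF lim]) auto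
  then have "(\<lambda>j. N (G j)) \<longlonglongrightarrow> N f"
    using P3[of G f] G f by auto
  moreover have "N (G j) \<le> C" for j
  proof -
    have "N (G j) \<le> N (F j)"
      using G F by (intro P2) (auto simp: G_def intro!: INF_lower)
    also note le
    finally show ?thesis .
  qed
  ultimately show ?thesis
    by (intro LIMSEQ_le_const2[of "\<lambda>j. N (G j)"]) auto
qed

end

section \<open>The Lorentz--Luxemburg theorem\<close>

lemma SUP_min_of_nat: "(SUP n::nat. min h (of_nat n)) = (h::ennreal)"
proof (rule antisym)
  show "h \<le> (SUP n::nat. min h (of_nat n))"
  proof (rule ccontr)
    assume "\<not> ?thesis"
    then obtain y where y: "(SUP n::nat. min h (of_nat n)) < y" "y < h"
      using dense[of "SUP n::nat. min h (of_nat n)" h] by (auto simp: not_le)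
    then have "y < top" by (auto simp: less_top dest: less_le_trans[OF _ top_greatest])
    then obtain n :: nat where "y < of_nat n"
      using ennreal_Ex_less_of_nat[of y] by (auto simp: less_top)
    then have "y \<le> min h (of_nat n)" using y by (intro min.boundedI less_imp_le)
    also have "\<dots> \<le> (SUP n::nat. min h (of_nat n))" by (rule SUP_upper) simp
    finally show False using y by simp
  qed
qed (auto intro: SUP_least)

lemma incseq_min_of_nat: "incseq (\<lambda>n::nat. min (h::ennreal) (of_nat n))"
  unfolding incseq_def by (auto intro: min.coboundedI2 simp: min_le_iff_disj)

text \<open>Truncation at n makes the passage to real values lossless, which gives access to
  mean-square arguments with Bochner integrals.\<close>

lemma real_truncation:
  fixes h :: "real \<Rightarrow> ennreal"
  assumes [measurable]: "h \<in> Mplus"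
  shows "(\<lambda>x. enn2real (min (h x) (of_nat n))) \<in> borel_measurable leb01"
    and "ennreal (enn2real (min (h x) (of_nat n))) = min (h x) (of_nat n)"
    and "enn2real (min (h x) (of_nat n)) \<le> real n"
proof -
  have "min (h x) (of_nat n) < top"
    by (rule le_less_trans[of _ "of_nat n"]) (auto simp: of_nat_less_top)
  then show *: "ennreal (enn2real (min (h x) (of_nat n))) = min (h x) (of_nat n)"
    by simp
  have "enn2real (min (h x) (of_nat n)) \<le> enn2real (of_nat n)"
    by (intro enn2real_mono) (auto simp: of_nat_less_top)
  then show "enn2real (min (h x) (of_nat n)) \<le> real n" by simp
qed measurable

text \<open>This is the first-order condition at a minimiser. Instead of a limit, the single value t
  = min 1 (A / (S + 1)) is tested: it would give 2A \<le> t S \<le> A.\<close>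

lemma le_if_quadratic_le:
  fixes A S :: real
  assumes "\<And>t. 0 < t \<Longrightarrow> t \<le> 1 \<Longrightarrow> 2 * t * A \<le> t\<^sup>2 * S" "0 \<le> S"
  shows "A \<le> 0"
proof (rule ccontr)
  assume "\<not> A \<le> 0"
  define t where "t = min 1 (A / (S + 1))"
  have t: "0 < t" "t \<le> 1" "t * (S + 1) \<le> A"
  proof -
    show "0 < t" "t \<le> 1"
      using \<open>\<not> A \<le> 0\<close> \<open>0 \<le> S\<close> by (auto simp: t_def)
    have "t * (S + 1) \<le> A / (S + 1) * (S + 1)"
      using \<open>0 \<le> S\<close> by (intro mult_right_mono) (auto simp: t_def)
    then show "t * (S + 1) \<le> A" using \<open>0 \<le> S\<close> by simp
  qed
  have "t * (2 * A) \<le> t * (t * S)"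
    using assms(1)[OF t(1,2)] by (simp add: power2_eq_square mult_ac)
  then have "2 * A \<le> t * S" using t(1) by simp
  also have "\<dots> \<le> t * (S + 1)" using t(1) by simp
  finally show False using t(3) \<open>\<not> A \<le> 0\<close> by simp
qed

context ri_function_norm
begin

lemma zero: "N (\<lambda>x. 0) = 0"
  by (simp add: P1_zero)

lemma convex_combination:
  assumes u: "u \<in> Mplus" "N u \<le> c" and v: "v \<in> Mplus" "N v \<le> c" and t: "0 \<le> t" "t \<le> 1"
  shows "N (\<lambda>x. ennreal (1 - t) * u x + ennreal t * v x) \<le> c"
proof -
  have "N (\<lambda>x. ennreal (1 - t) * u x + ennreal t * v x) \<le>
      N (\<lambda>x. ennreal (1 - t) * u x) + N (\<lambda>x. ennreal t * v x)"
    using u v by (intro P1_triangle) auto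
  also have "\<dots> = ennreal (1 - t) * N u + ennreal t * N v"
    using u v t by (simp add: P1_scale)
  also have "\<dots> \<le> ennreal (1 - t) * c + ennreal t * c"
    using u v by (intro add_mono mult_left_mono) auto
  also have "\<dots> = ennreal ((1 - t) + t) * c"
    using t by (subst ennreal_plus) (auto simp: distrib_right)
  finally show ?thesis by simp
qed

text \<open>The separating functional is the difference of \<^term>\<open>f\<close> and its nearest point in the
  ball of radius \<^term>\<open>c\<close> in the mean-square sense.\<close>

lemma separation:
  fixes f :: "real \<Rightarrow> real"
  assumes f [measurable]: "f \<in> borel_measurable leb01" and f_bd: "\<And>x. 0 \<le> f x" "\<And>x. f x \<le> B"
    and out: "ennreal c < N (\<lambda>x. ennreal (f x))"
  obtains g :: "real \<Rightarrow> ennreal" and \<gamma> :: real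
  where "g \<in> Mplus" "0 < \<gamma>" "(\<integral>\<^sup>+x. ennreal (f x) * g x \<partial>leb01) = ennreal \<gamma>"
    "\<And>h. h \<in> Mplus \<Longrightarrow> N h \<le> ennreal c \<Longrightarrow> (\<integral>\<^sup>+x. h x * g x \<partial>leb01) \<le> ennreal \<gamma>"
proof -
  note integrable_const_bound = finite_measure.integrable_const_bound[OF finite_measure_leb01]
    and emeasure_eq_measure = finite_measure.emeasure_eq_measure[OF finite_measure_leb01]
    and [simp] = finite_measure.integrable_const[OF finite_measure_leb01]
  have B: "0 \<le> B" using f_bd(1)[of 0] f_bd(2)[of 0] by (rule order_trans)
  have int_bd: "integrable leb01 u" if "u \<in> borel_measurable leb01" "\<And>x. \<bar>u x\<bar> \<le> M" for u :: "real \<Rightarrow> real" and M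
    using that by (intro integrable_const_bound[of _ M]) auto
  \<comment> \<open>The constraint b \<le> f keeps all competitors bounded by B, so that every
    mean-square distance is finite.\<close>
  define K where "K = {b \<in> borel_measurable leb01. (\<forall>x. 0 \<le> b x \<and> b x \<le> f x) \<and> N (\<lambda>x. ennreal (b x)) \<le> ennreal c}"
  define D where "D b = (\<integral>x. (f x - b x)\<^sup>2 \<partial>leb01)" for b :: "real \<Rightarrow> real"
  have K_bd: "\<bar>b x\<bar> \<le> B" if "b \<in> K" for b x
  proof -
    have "0 \<le> b x" "b x \<le> f x" using that by (auto simp: K_def)
    then show ?thesis using f_bd(2)[of x] by linarith
  qed
  have K_meas: "b \<in> borel_measurable leb01" if "b \<in> K" for b
    using that by (simp add: K_def)
  have sq_bd: "\<bar>(u - v)\<^sup>2\<bar> \<le> (M + L)\<^sup>2" if "\<bar>u\<bar> \<le> M" "\<bar>v\<bar> \<le> L" for u v M L :: real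
  proof -
    have "\<bar>u - v\<bar> \<le> \<bar>M + L\<bar>" using that by linarith
    then show ?thesis by (simp add: abs_le_square_iff)
  qed
  have diff_bd: "\<bar>u - v\<bar> \<le> M + L" if "\<bar>u\<bar> \<le> M" "\<bar>v\<bar> \<le> L" for u v M L :: real
    using that by linarith
  have fB: "\<bar>f x\<bar> \<le> B" for x using f_bd[of x] by simp
  have D_int: "integrable leb01 (\<lambda>x. (f x - b x)\<^sup>2)"
    if [measurable]: "b \<in> borel_measurable leb01" and "\<And>x. \<bar>b x\<bar> \<le> L" for b L
    using that(2) fB by (intro int_bd[of _ "(B + L)\<^sup>2"] sq_bd) auto
  have D_nonneg: "0 \<le> D b" for b
    unfolding D_def by (intro integral_nonneg_AE) auto
  define d where "d = Inf (D ` K)"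
  have "(\<lambda>x. 0) \<in> K" using f_bd by (simp add: K_def zero)
  then have K_ne: "D ` K \<noteq> {}" by auto
  have bdd: "bdd_below (D ` K)" using D_nonneg by (intro bdd_belowI[of _ 0]) auto
  have d_le: "d \<le> D b" if "b \<in> K" for b
    unfolding d_def using that bdd by (intro cInf_lower) auto
  \<comment> \<open>Near-minimisers at the rate 4^(-n) have consecutive mean distances of order
    2^(-n). These are summable, so the sequence itself converges almost everywhere.\<close>
  have "\<exists>b\<in>K. D b < d + (1/4) ^ n" for n :: nat
    using cInf_lessD[OF K_ne, of "d + (1/4) ^ n"] by (auto simp: d_def)
  then obtain b where b: "\<And>n. b n \<in> K" "\<And>n::nat. D (b n) < d + (1/4) ^ n"
    by metis
  have [measurable]: "b n \<in> borel_measurable leb01" for n using b(1) K_meas by auto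
  have mid: "(\<lambda>x. (u x + v x) / 2) \<in> K" if uv: "u \<in> K" "v \<in> K" for u v
  proof -
    have "ennreal ((u x + v x) / 2) = ennreal (1 - 1/2) * ennreal (u x) + ennreal (1/2) * ennreal (v x)" for x
    proof -
      have nn: "0 \<le> u x" "0 \<le> v x" using uv by (auto simp: K_def)
      then have "ennreal (1 - 1/2) * ennreal (u x) + ennreal (1/2) * ennreal (v x) =
          ennreal ((1 - 1/2) * u x) + ennreal (1/2 * v x)"
        by (intro arg_cong2[where f = "(+)"] ennreal_mult[symmetric]) auto
      also have "\<dots> = ennreal ((1 - 1/2) * u x + 1/2 * v x)"
        using nn by (intro ennreal_plus[symmetric]) auto
      finally show ?thesis by (simp add: add_divide_distrib)
    qed
    then have "N (\<lambda>x. ennreal ((u x + v x) / 2)) \<le> ennreal c"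
      using convex_combination[of "\<lambda>x. ennreal (u x)" "ennreal c" "\<lambda>x. ennreal (v x)" "1/2"] uv
      by (simp add: K_def)
    moreover have "(u x + v x) / 2 \<le> f x" "0 \<le> (u x + v x) / 2" for x
    proof -
      have "u x \<le> f x" "v x \<le> f x" "0 \<le> u x" "0 \<le> v x" using uv by (auto simp: K_def)
      then show "(u x + v x) / 2 \<le> f x" "0 \<le> (u x + v x) / 2" by simp_all
    qed
    ultimately show ?thesis using uv by (auto simp: K_def)
  qed
  have cauchy: "(\<integral>x. \<bar>b (Suc n) x - b n x\<bar> \<partial>leb01) \<le> 5 * (1/2) ^ n" for n
  proof -
    let ?u = "b n" and ?v = "b (Suc n)"
    let ?m = "\<lambda>x. (?u x + ?v x) / 2"
    have m: "?m \<in> K" using mid b(1) by auto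
    have i: "integrable leb01 (\<lambda>x. (f x - w x)\<^sup>2)" if "w \<in> K" for w
      using K_bd[OF that] K_meas[OF that] by (intro D_int)
    \<comment> \<open>Parallelogram identity; the midpoint belongs to K, so its squared distance to
      f is at least d.\<close>
    have "(\<integral>x. (?v x - ?u x)\<^sup>2 \<partial>leb01) =
        (\<integral>x. 2 * (f x - ?u x)\<^sup>2 + 2 * (f x - ?v x)\<^sup>2 - 4 * (f x - ?m x)\<^sup>2 \<partial>leb01)"
      by (intro Bochner_Integration.integral_cong) (auto simp: power2_eq_square field_simps)
    also have "\<dots> = 2 * D ?u + 2 * D ?v - 4 * D ?m"
      using i[OF b(1)[of n]] i[OF b(1)[of "Suc n"]] i[OF m] by (simp add: D_def)
    also have "\<dots> \<le> 4 * (1/4) ^ n"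
    proof -
      have "(1/4::real) ^ Suc n \<le> (1/4) ^ n" by simp
      then show ?thesis using b(2)[of n] b(2)[of "Suc n"] d_le[OF m] by linarith
    qed
    finally have sq: "(\<integral>x. (?v x - ?u x)\<^sup>2 \<partial>leb01) \<le> 4 * (1/4) ^ n" .
    have iv: "integrable leb01 (\<lambda>x. (?v x - ?u x)\<^sup>2)"
      using K_bd[OF b(1)] by (intro int_bd[of _ "(B + B)\<^sup>2"] sq_bd) auto
    \<comment> \<open>Passing from mean square to mean: z \<le> 2^(-n) + 2^n z^2 for every z. The
      weight balances both terms, giving 2^(-n) + 4 times 2^(-n) and hence the factor 5.\<close>
    have "(\<integral>x. \<bar>?v x - ?u x\<bar> \<partial>leb01) \<le> (\<integral>x. (1/2) ^ n + 2 ^ n * (?v x - ?u x)\<^sup>2 \<partial>leb01)"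
    proof (rule integral_mono)
      show "integrable leb01 (\<lambda>x. \<bar>?v x - ?u x\<bar>)"
        using K_bd[OF b(1)] by (intro integrable_abs int_bd[of _ "B + B"] diff_bd) auto
      show "integrable leb01 (\<lambda>x. (1/2) ^ n + 2 ^ n * (?v x - ?u x)\<^sup>2)"
        using iv by auto
      show "\<bar>?v x - ?u x\<bar> \<le> (1/2) ^ n + 2 ^ n * (?v x - ?u x)\<^sup>2" for x
      proof -
        define z where "z = \<bar>?v x - ?u x\<bar>"
        have "0 \<le> (1/2) ^ n * (2 ^ n * z - 1/2)\<^sup>2 + (3/4) * (1/2) ^ n" by simp
        also have "\<dots> = (1/2) ^ n * (2 ^ n * 2 ^ n) * z\<^sup>2 - ((1/2) ^ n * 2 ^ n) * z + (1/2) ^ n"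
          by (simp add: power2_eq_square algebra_simps)
        also have "(1/2::real) ^ n * 2 ^ n = 1" by (simp add: power_mult_distrib[symmetric])
        also have "(1/2::real) ^ n * (2 ^ n * 2 ^ n) = 2 ^ n"
          by (simp add: power_mult_distrib[symmetric] mult.assoc[symmetric])
        finally have "z \<le> (1/2) ^ n + 2 ^ n * z\<^sup>2" by simp
        then show ?thesis by (simp add: z_def)
      qed
    qed
    also have "\<dots> = (1/2) ^ n * measure leb01 (space leb01) + 2 ^ n * (\<integral>x. (?v x - ?u x)\<^sup>2 \<partial>leb01)"
      using iv by simp
    also have "\<dots> \<le> (1/2) ^ n * 1 + 2 ^ n * (4 * (1/4) ^ n)"
      using sq emeasure_leb01_le_1[of "space leb01"]
      by (intro add_mono mult_left_mono) (auto simp: emeasure_eq_measure)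
    also have "2 ^ n * (4 * (1/4) ^ n) = 4 * (1/2::real) ^ n"
      by (simp add: power_mult_distrib[symmetric] mult.left_commute)
    finally show ?thesis by simp
  qed
  have conv: "AE x in leb01. convergent (\<lambda>n. b n x)"
  proof -
    have "(\<integral>\<^sup>+x. (\<Sum>n. ennreal \<bar>b (Suc n) x - b n x\<bar>) \<partial>leb01) =
        (\<Sum>n. \<integral>\<^sup>+x. ennreal \<bar>b (Suc n) x - b n x\<bar> \<partial>leb01)"
      by (intro nn_integral_suminf) measurable
    also have "\<dots> \<le> (\<Sum>n. ennreal (5 * (1/2) ^ n))"
    proof (intro suminf_le)
      fix n
      have "integrable leb01 (\<lambda>x. \<bar>b (Suc n) x - b n x\<bar>)"
        using K_bd[OF b(1)] by (intro integrable_abs int_bd[of _ "B + B"] diff_bd) auto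
      then have "(\<integral>\<^sup>+x. ennreal \<bar>b (Suc n) x - b n x\<bar> \<partial>leb01) = ennreal (\<integral>x. \<bar>b (Suc n) x - b n x\<bar> \<partial>leb01)"
        by (intro nn_integral_eq_integral) auto
      also have "\<dots> \<le> ennreal (5 * (1/2) ^ n)"
        by (intro ennreal_leI cauchy)
      finally show "(\<integral>\<^sup>+x. ennreal \<bar>b (Suc n) x - b n x\<bar> \<partial>leb01) \<le> ennreal (5 * (1/2) ^ n)" .
    qed auto
    also have "\<dots> = ennreal (\<Sum>n. 5 * (1/2) ^ n)"
      by (intro suminf_ennreal2) (auto intro: summable_mult summable_geometric)
    also have "\<dots> < top" by simp
    finally have "AE x in leb01. (\<Sum>n. ennreal \<bar>b (Suc n) x - b n x\<bar>) \<noteq> \<infinity>"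
      by (intro nn_integral_noteq_infinite) (auto simp: less_top)
    then show ?thesis
    proof (rule eventually_mono)
      fix x assume "(\<Sum>n. ennreal \<bar>b (Suc n) x - b n x\<bar>) \<noteq> \<infinity>"
      then have "summable (\<lambda>n. \<bar>b (Suc n) x - b n x\<bar>)"
        by (intro summable_suminf_not_top) auto
      then have "summable (\<lambda>n. b (Suc n) x - b n x)"
        by (rule summable_rabs_cancel)
      then have "convergent (\<lambda>n. (\<Sum>i<n. b (Suc i) x - b i x))"
        by (simp add: summable_iff_convergent)
      then have "convergent (\<lambda>n. b n x - b 0 x)"
        by (subst (asm) sum_lessThan_telescope)
      then show "convergent (\<lambda>n. b n x)"
        by (simp add: convergent_diff_const_right_iff)
    qed
  qed
  \<comment> \<open>Clipping to [0, f] makes the constraints of K hold at every point, also where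
    the sequence does not converge.\<close>
  define b0 where "b0 x = max 0 (min (f x) (lim (\<lambda>n. b n x)))" for x
  have b0_bd: "0 \<le> b0 x" "b0 x \<le> f x" for x
    using f_bd[of x] by (auto simp: b0_def)
  have b0_meas [measurable]: "b0 \<in> borel_measurable leb01"
    unfolding b0_def by measurable
  have lim: "AE x in leb01. (\<lambda>n. b n x) \<longlonglongrightarrow> b0 x"
    using conv
  proof (rule eventually_mono)
    fix x assume "convergent (\<lambda>n. b n x)"
    then have L: "(\<lambda>n. b n x) \<longlonglongrightarrow> lim (\<lambda>n. b n x)" by (simp add: convergent_LIMSEQ_iff)
    have "0 \<le> lim (\<lambda>n. b n x)" "lim (\<lambda>n. b n x) \<le> f x"
      using b(1) by (auto intro!: LIMSEQ_le_const[OF L] LIMSEQ_le_const2[OF L] simp: K_def)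
    with L show "(\<lambda>n. b n x) \<longlonglongrightarrow> b0 x" by (simp add: b0_def max_def min_def)
  qed
  have b0_norm: "N (\<lambda>x. ennreal (b0 x)) \<le> ennreal c"
  proof (rule fatou[of "\<lambda>n x. ennreal (b n x)"])
    show "AE x in leb01. (\<lambda>n. ennreal (b n x)) \<longlonglongrightarrow> ennreal (b0 x)"
      using lim by (rule eventually_mono) (rule tendsto_ennrealI)
    show "N (\<lambda>x. ennreal (b n x)) \<le> ennreal c" for n
      using b(1)[of n] by (simp add: K_def)
  qed measurable
  have b0_K: "b0 \<in> K" using b0_bd b0_norm by (simp add: K_def)
  have D_b0: "D b0 \<le> d"
  proof -
    have "(\<lambda>n. D (b n)) \<longlonglongrightarrow> D b0"
      unfolding D_def
    proof (rule integral_dominated_convergence[where w = "\<lambda>x. (B + B)\<^sup>2"])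
      show "AE x in leb01. (\<lambda>n. (f x - b n x)\<^sup>2) \<longlonglongrightarrow> (f x - b0 x)\<^sup>2"
        using lim by (rule eventually_mono) (intro tendsto_intros)
      show "AE x in leb01. norm ((f x - b n x)\<^sup>2) \<le> (B + B)\<^sup>2" for n
        using sq_bd[OF fB K_bd[OF b(1)]] by (intro AE_I2) (simp only: real_norm_def)
    qed auto
    moreover have "(\<lambda>n. d + (1/4) ^ n) \<longlonglongrightarrow> d + 0"
      by (intro tendsto_intros LIMSEQ_realpow_zero) auto
    ultimately have "D b0 \<le> d + 0"
      by (rule LIMSEQ_le) (use b(2) in \<open>auto intro: less_imp_le\<close>)
    then show ?thesis by simp
  qed
  define g where "g x = f x - b0 x" for x
  have g_bd: "0 \<le> g x" "g x \<le> B" "\<bar>g x\<bar> \<le> B" for x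
    using b0_bd[of x] f_bd[of x] by (auto simp: g_def)
  have g_meas [measurable]: "g \<in> borel_measurable leb01" unfolding g_def by measurable
  have g_int: "integrable leb01 (\<lambda>x. g x * u x)"
    if [measurable]: "u \<in> borel_measurable leb01" and "\<And>x. \<bar>u x\<bar> \<le> L" for u L
    using that(2) g_bd B by (intro int_bd[of _ "B * L"]) (auto simp: abs_mult intro!: mult_mono)
  have key: "(\<integral>x. g x * h x \<partial>leb01) \<le> (\<integral>x. g x * b0 x \<partial>leb01)"
    if h [measurable]: "h \<in> borel_measurable leb01" and h_bd: "\<And>x. 0 \<le> h x" "\<And>x. h x \<le> L"
      and hN: "N (\<lambda>x. ennreal (h x)) \<le> ennreal c" for h L
  proof -
    define A where "A = (\<integral>x. g x * (h x - b0 x) \<partial>leb01)"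
    define S where "S = (\<integral>x. (h x - b0 x)\<^sup>2 \<partial>leb01)"
    have hL: "\<bar>h x\<bar> \<le> L" for x using h_bd[of x] by simp
    have iA: "integrable leb01 (\<lambda>x. g x * (h x - b0 x))"
      using hL K_bd[OF b0_K] by (intro g_int[of _ "L + B"] diff_bd) auto
    have iS: "integrable leb01 (\<lambda>x. (h x - b0 x)\<^sup>2)"
      using hL K_bd[OF b0_K] by (intro int_bd[of _ "(L + B)\<^sup>2"] sq_bd) auto
    have iG: "integrable leb01 (\<lambda>x. (g x)\<^sup>2)"
      unfolding g_def using K_bd[OF b0_K] by (intro D_int) auto
    have "A \<le> 0"
    proof (rule le_if_quadratic_le)
      show "0 \<le> S" unfolding S_def by (intro integral_nonneg_AE) auto
      fix t :: real assume t: "0 < t" "t \<le> 1"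
      define p where "p x = (1 - t) * b0 x + t * h x" for x
      \<comment> \<open>The segment from b0 towards h may leave the region below f. Cutting it off
        at f reduces both its norm and its distance to f, so q is a competitor in K.\<close>
      define q where "q x = min (f x) (p x)" for x
      have p_nn: "0 \<le> p x" for x using b0_bd[of x] h_bd[of x] t by (simp add: p_def)
      have [measurable]: "p \<in> borel_measurable leb01" "q \<in> borel_measurable leb01"
        unfolding p_def q_def by measurable
      have "N (\<lambda>x. ennreal (q x)) \<le> N (\<lambda>x. ennreal (p x))"
        by (intro P2 AE_I2) (auto simp: q_def intro!: ennreal_leI)
      also have "(\<lambda>x. ennreal (p x)) = (\<lambda>x. ennreal (1 - t) * ennreal (b0 x) + ennreal t * ennreal (h x))"
        using b0_bd h_bd t by (simp add: p_def ennreal_mult[symmetric] ennreal_plus[symmetric] del: ennreal_plus)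
      also have "N \<dots> \<le> ennreal c"
        using b0_norm hN t by (intro convex_combination) auto
      finally have "q \<in> K" using p_nn f_bd by (auto simp: K_def q_def)
      then have "d \<le> D q" by (rule d_le)
      also have "\<dots> \<le> (\<integral>x. (g x)\<^sup>2 - 2 * t * (g x * (h x - b0 x)) + t\<^sup>2 * (h x - b0 x)\<^sup>2 \<partial>leb01)"
        unfolding D_def
      proof (rule integral_mono)
        show "integrable leb01 (\<lambda>x. (f x - q x)\<^sup>2)"
          using K_bd[OF \<open>q \<in> K\<close>] by (intro D_int) auto
        show "integrable leb01 (\<lambda>x. (g x)\<^sup>2 - 2 * t * (g x * (h x - b0 x)) + t\<^sup>2 * (h x - b0 x)\<^sup>2)"
          using iA iS iG by auto
        fix x
        have "(f x - q x)\<^sup>2 \<le> (f x - p x)\<^sup>2"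
          by (auto simp: q_def min_def)
        also have "\<dots> = (g x)\<^sup>2 - 2 * t * (g x * (h x - b0 x)) + t\<^sup>2 * (h x - b0 x)\<^sup>2"
          by (simp add: p_def g_def power2_eq_square algebra_simps)
        finally show "(f x - q x)\<^sup>2 \<le> (g x)\<^sup>2 - 2 * t * (g x * (h x - b0 x)) + t\<^sup>2 * (h x - b0 x)\<^sup>2" .
      qed
      also have "\<dots> = D b0 - 2 * t * A + t\<^sup>2 * S"
        using iA iS iG by (simp add: A_def S_def D_def g_def[symmetric])
      finally show "2 * t * A \<le> t\<^sup>2 * S" using D_b0 by simp
    qed
    moreover have "A = (\<integral>x. g x * h x \<partial>leb01) - (\<integral>x. g x * b0 x \<partial>leb01)"
      unfolding A_def right_diff_distrib
      using g_int[OF h hL] g_int[OF b0_meas K_bd[OF b0_K]] by simp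
    ultimately show ?thesis by simp
  qed
  define \<gamma> where "\<gamma> = (\<integral>x. g x * f x \<partial>leb01)"
  \<comment> \<open>The gap between the value of the functional at f and at b0 is the squared
    distance \<open>D b0\<close>, which is positive because f lies outside the ball.\<close>
  have \<gamma>_eq: "\<gamma> = D b0 + (\<integral>x. g x * b0 x \<partial>leb01)"
  proof -
    have "\<gamma> = (\<integral>x. (f x - b0 x)\<^sup>2 + g x * b0 x \<partial>leb01)"
      unfolding \<gamma>_def
      by (intro Bochner_Integration.integral_cong) (auto simp: g_def power2_eq_square algebra_simps)
    then show ?thesis
      using D_int[OF b0_meas K_bd[OF b0_K]] g_int[OF b0_meas K_bd[OF b0_K]] by (simp add: D_def)
  qed
  have "D b0 \<noteq> 0"
  proof
    assume "D b0 = 0"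
    then have "AE x in leb01. (f x - b0 x)\<^sup>2 = 0"
      unfolding D_def using D_int[OF b0_meas K_bd[OF b0_K]]
      by (subst (asm) integral_nonneg_eq_0_iff_AE) auto
    then have "AE x in leb01. ennreal (f x) = ennreal (b0 x)"
      by (rule eventually_mono) auto
    then have "N (\<lambda>x. ennreal (f x)) = N (\<lambda>x. ennreal (b0 x))"
      by (intro ae_cong) auto
    then show False using out b0_norm by simp
  qed
  moreover have "0 \<le> (\<integral>x. g x * b0 x \<partial>leb01)"
    using g_bd b0_bd by (intro integral_nonneg_AE) auto
  ultimately have \<gamma>: "0 < \<gamma>" "(\<integral>x. g x * b0 x \<partial>leb01) \<le> \<gamma>"
    using D_nonneg[of b0] by (auto simp: \<gamma>_eq)
  show thesis
  proof (rule that[of "\<lambda>x. ennreal (g x)" \<gamma>])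
    have "(\<integral>\<^sup>+x. ennreal (f x) * ennreal (g x) \<partial>leb01) = (\<integral>\<^sup>+x. ennreal (g x * f x) \<partial>leb01)"
      using f_bd g_bd by (simp add: ennreal_mult mult.commute)
    also have "\<dots> = ennreal \<gamma>"
      unfolding \<gamma>_def using g_bd f_bd g_int[OF f fB] by (intro nn_integral_eq_integral) auto
    finally show "(\<integral>\<^sup>+x. ennreal (f x) * ennreal (g x) \<partial>leb01) = ennreal \<gamma>" .
    \<comment> \<open>The variational inequality covers bounded h only; truncations and monotone
      convergence give the rest of the ball.\<close>
    fix h :: "real \<Rightarrow> ennreal" assume h [measurable]: "h \<in> Mplus" and hN: "N h \<le> ennreal c"
    have "(\<integral>\<^sup>+x. h x * ennreal (g x) \<partial>leb01) = (\<integral>\<^sup>+x. (SUP n::nat. ennreal (g x) * min (h x) (of_nat n)) \<partial>leb01)"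
      by (simp add: SUP_mult_left_ennreal[symmetric] SUP_min_of_nat mult.commute)
    also have "\<dots> = (SUP n::nat. \<integral>\<^sup>+x. ennreal (g x) * min (h x) (of_nat n) \<partial>leb01)"
    proof (rule nn_integral_monotone_convergence_SUP)
      show "incseq (\<lambda>(n::nat) x. ennreal (g x) * min (h x) (of_nat n))"
        using incseq_min_of_nat by (auto simp: incseq_def le_fun_def intro!: mult_left_mono)
    qed measurable
    also have "\<dots> \<le> ennreal \<gamma>"
    proof (rule SUP_least)
      fix n :: nat
      let ?h = "\<lambda>x. enn2real (min (h x) (of_nat n))"
      note h' = real_truncation[OF h, where n = n]
      have "N (\<lambda>x. ennreal (?h x)) \<le> N h"
        using h'(1) by (intro P2) (auto simp: h'(2))
      then have *: "(\<integral>x. g x * ?h x \<partial>leb01) \<le> \<gamma>"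
      proof -
        have "N (\<lambda>x. ennreal (?h x)) \<le> ennreal c"
          using \<open>N (\<lambda>x. ennreal (?h x)) \<le> N h\<close> hN by (rule order_trans)
        then have "(\<integral>x. g x * ?h x \<partial>leb01) \<le> (\<integral>x. g x * b0 x \<partial>leb01)"
          using h'(1) h'(3) by (intro key[of ?h "real n"]) auto
        then show ?thesis using \<gamma>(2) by (rule order_trans)
      qed
      have "(\<integral>\<^sup>+x. ennreal (g x) * min (h x) (of_nat n) \<partial>leb01) = (\<integral>\<^sup>+x. ennreal (g x * ?h x) \<partial>leb01)"
        using g_bd by (simp add: ennreal_mult h'(2))
      also have "\<dots> = ennreal (\<integral>x. g x * ?h x \<partial>leb01)"
        using h' g_bd by (intro nn_integral_eq_integral g_int[of _ "real n"]) auto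
      also have "\<dots> \<le> ennreal \<gamma>" using * by (rule ennreal_leI)
      finally show "(\<integral>\<^sup>+x. ennreal (g x) * min (h x) (of_nat n) \<partial>leb01) \<le> ennreal \<gamma>" .
    qed
    finally show "(\<integral>\<^sup>+x. h x * ennreal (g x) \<partial>leb01) \<le> ennreal \<gamma>" .
  qed (use \<gamma> in auto)
qed

text \<open>If the second associate norm of f were smaller than \<open>N f\<close>, then by P3 some
  c would lie strictly between it and the norm of a truncation of f. A functional g separating that
  truncation from the ball of radius c, rescaled by c / \<gamma>, has associate norm at most 1 and
  integral exactly c against the truncation, so the second associate norm of f would be at least
  c.\<close>

theorem lorentz_luxemburg:
  assumes f: "f \<in> Mplus"
  shows "N f \<le> associate_norm (associate_norm N) f"
proof (rule ccontr)
  let ?f = "\<lambda>n x. min (f x) (of_nat n)"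
  assume "\<not> ?thesis"
  then have less: "associate_norm (associate_norm N) f < N f" by simp
  have m: "?f n \<in> Mplus" for n :: nat using f by measurable
  have "(\<lambda>n. N (?f n)) \<longlonglongrightarrow> N f"
  proof -
    have "AE x in leb01. incseq (\<lambda>n. ?f n x) \<and> (\<lambda>n. ?f n x) \<longlonglongrightarrow> f x"
    proof (intro AE_I2 conjI incseq_min_of_nat)
      fix x
      show "(\<lambda>n. ?f n x) \<longlonglongrightarrow> f x"
        using LIMSEQ_SUP[OF incseq_min_of_nat, of "f x"] by (simp add: SUP_min_of_nat)
    qed
    from P3[OF m f this] show ?thesis by (rule conjunct2)
  qed
  then have "eventually (\<lambda>n. associate_norm (associate_norm N) f < N (?f n)) sequentially"
    using less by (rule order_tendstoD(1))
  then obtain n where n: "associate_norm (associate_norm N) f < N (?f n)"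
    by (auto simp: eventually_sequentially)
  then obtain c' where c': "associate_norm (associate_norm N) f < c'" "c' < N (?f n)"
    using dense[OF n] by (elim exE conjE) (rule that; assumption)
  then obtain c where c: "c' = ennreal c" "0 < c"
    by (cases c') (auto simp: ennreal_less_iff dest: le_less_trans[OF zero_le])
  let ?r = "\<lambda>x. enn2real (?f n x)"
  note r = real_truncation[OF f, where n = n]
  have r0: "0 \<le> ?r x" for x by simp
  have out: "ennreal c < N (\<lambda>x. ennreal (?r x))"
    using c'(2) unfolding r(2) c(1) .
  obtain g :: "real \<Rightarrow> ennreal" and \<gamma> :: real where g: "g \<in> Mplus" "0 < \<gamma>"
    "(\<integral>\<^sup>+x. ennreal (?r x) * g x \<partial>leb01) = ennreal \<gamma>"
    "\<And>h. h \<in> Mplus \<Longrightarrow> N h \<le> ennreal c \<Longrightarrow> (\<integral>\<^sup>+x. h x * g x \<partial>leb01) \<le> ennreal \<gamma>"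
    by (rule separation[OF r(1) r0 r(3) out]) (rule that; assumption)
  let ?g = "\<lambda>x. ennreal (c / \<gamma>) * g x"
  have "associate_norm N ?g \<le> 1"
  proof (rule associate_norm_least)
    fix h assume h: "h \<in> Mplus" "N h \<le> 1"
    have "(\<integral>\<^sup>+x. (ennreal c * h x) * g x \<partial>leb01) \<le> ennreal \<gamma>"
    proof (rule g(4))
      have "N (\<lambda>x. ennreal c * h x) = ennreal c * N h" using h c by (intro P1_scale) auto
      also have "\<dots> \<le> ennreal c * 1" using h by (intro mult_left_mono) auto
      finally show "N (\<lambda>x. ennreal c * h x) \<le> ennreal c" by simp
    qed (use h in measurable)
    then have "ennreal (1 / \<gamma>) * (\<integral>\<^sup>+x. (ennreal c * h x) * g x \<partial>leb01) \<le> ennreal (1 / \<gamma>) * ennreal \<gamma>"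
      by (rule mult_left_mono) simp
    also have "\<dots> = 1" using g(2) by (simp add: ennreal_mult[symmetric])
    also have "ennreal (1 / \<gamma>) * (\<integral>\<^sup>+x. (ennreal c * h x) * g x \<partial>leb01) =
        (\<integral>\<^sup>+x. ennreal (1 / \<gamma>) * ((ennreal c * h x) * g x) \<partial>leb01)"
      using h g(1) by (intro nn_integral_cmult[symmetric]) measurable
    also have "\<dots> = (\<integral>\<^sup>+x. h x * ?g x \<partial>leb01)"
    proof (intro nn_integral_cong)
      fix x
      have "ennreal (c / \<gamma>) = ennreal (1 / \<gamma>) * ennreal c"
        using c g(2) by (simp add: ennreal_mult[symmetric])
      then show "ennreal (1 / \<gamma>) * ((ennreal c * h x) * g x) = h x * ?g x"
        by (simp add: mult_ac)
    qed
    finally show "(\<integral>\<^sup>+x. h x * ?g x \<partial>leb01) \<le> 1" .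
  qed
  then have "(\<integral>\<^sup>+x. ?g x * ?f n x \<partial>leb01) \<le> associate_norm (associate_norm N) (?f n)"
    using g(1) by (intro associate_norm_upper) auto
  also have "\<dots> \<le> associate_norm (associate_norm N) f"
    by (intro associate_norm_mono) simp
  finally have "(\<integral>\<^sup>+x. ?g x * ?f n x \<partial>leb01) \<le> associate_norm (associate_norm N) f" .
  moreover have "(\<integral>\<^sup>+x. ?g x * ?f n x \<partial>leb01) = ennreal c"
  proof -
    have "(\<integral>\<^sup>+x. ?g x * ?f n x \<partial>leb01) = (\<integral>\<^sup>+x. ennreal (c / \<gamma>) * (ennreal (?r x) * g x) \<partial>leb01)"
      by (intro nn_integral_cong) (simp add: r(2) mult_ac)
    also have "\<dots> = ennreal (c / \<gamma>) * ennreal \<gamma>"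
    proof -
      have "(\<lambda>x. ennreal (?r x) * g x) \<in> Mplus"
        using g(1) r(1) by measurable
      then show ?thesis by (subst nn_integral_cmult) (simp_all only: g(3))
    qed
    also have "\<dots> = ennreal c"
      using c g(2) by (simp add: ennreal_mult[symmetric])
    finally show ?thesis .
  qed
  ultimately have "c' \<le> associate_norm (associate_norm N) f"
    unfolding c(1) by (rule subst[rotated])
  then show False using c'(1) by (rule leD[THEN notE])
qed

end

section \<open>Optimal norms\<close>

text \<open>Since the kernel is nonincreasing in \<open>r\<close>, \<^term>\<open>Z\<close> is a supremum of integrals of
  \<open>f\<^sup>*\<close> against nonincreasing weights, hence already an associate norm: no bipolar argument is
  needed for \<open>Z'' = Z\<close>.\<close>

lemma associate_norm_of_kernel_norm:
  fixes \<kappa> :: "real \<Rightarrow> real \<Rightarrow> ennreal"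
  assumes X: "ri_function_norm X"
    and \<kappa> [measurable]: "case_prod \<kappa> \<in> borel_measurable (leb01 \<Otimes>\<^sub>M leb01)"
    and anti: "\<And>s r r'. s \<in> {0<..<1} \<Longrightarrow> r \<in> {0<..<1} \<Longrightarrow> r \<le> r' \<Longrightarrow> r' < 1 \<Longrightarrow> \<kappa> s r' \<le> \<kappa> s r"
    and fin: "\<And>s. s \<in> {0<..<1} \<Longrightarrow> (\<integral>\<^sup>+r. \<kappa> s r \<partial>leb01) \<le> ennreal C"
    and pos: "0 < \<delta>" "\<delta> < 1" "0 < c"
      "\<And>s r. s \<in> {0<..<1} \<Longrightarrow> 1 / 2 < s \<Longrightarrow> r \<in> {0<..<1} \<Longrightarrow> r < \<delta> \<Longrightarrow> ennreal c \<le> \<kappa> s r"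
  defines "Z \<equiv> \<lambda>f. associate_norm X (\<lambda>s. \<integral>\<^sup>+r. \<kappa> s r * rearr01 f r \<partial>leb01)"
  shows "ri_function_norm (associate_norm Z)"
    and "\<And>f. f \<in> Mplus \<Longrightarrow> associate_norm (associate_norm Z) f = Z f"
proof -
  interpret X: ri_function_norm X by (rule X)
  interpret pair_sigma_finite leb01 leb01
    unfolding pair_sigma_finite_def using sigma_finite_leb01 by blast
  let ?T = "\<lambda>f s. \<integral>\<^sup>+r. \<kappa> s r * f r \<partial>leb01"
  have T_meas: "?T f \<in> Mplus" if [measurable]: "f \<in> Mplus" for f
    by measurable
  have inv: "Z f = Z g"
    if "f \<in> Mplus" "g \<in> Mplus" "\<forall>s\<in>{0<..<1}. rearr01 f s = rearr01 g s" for f g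
  proof -
    have "?T (rearr01 f) s = ?T (rearr01 g) s" for s
      using that(3) by (intro nn_integral_cong) auto
    then show ?thesis by (simp add: Z_def)
  qed
  have scale: "Z (\<lambda>x. ennreal c * f x) = ennreal c * Z f" if f: "f \<in> Mplus" "0 \<le> c" for f c
  proof -
    have "?T (rearr01 (\<lambda>x. ennreal c * f x)) s = ennreal c * ?T (rearr01 f) s"
      if "s \<in> {0<..<1}" for s
    proof -
      have "?T (rearr01 (\<lambda>x. ennreal c * f x)) s = (\<integral>\<^sup>+r. ennreal c * (\<kappa> s r * rearr01 f r) \<partial>leb01)"
        using f by (intro nn_integral_cong) (simp add: rearr01_scale mult_ac)
      also have "\<dots> = ennreal c * ?T (rearr01 f) s"
        using that by (intro nn_integral_cmult) measurable
      finally show ?thesis .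
    qed
    then have "Z (\<lambda>x. ennreal c * f x) = associate_norm X (\<lambda>s. ennreal c * ?T (rearr01 f) s)"
      unfolding Z_def by (intro associate_norm_cong) auto
    also have "\<dots> = ennreal c * Z f"
      unfolding Z_def by (intro associate_norm_scale T_meas) measurable
    finally show ?thesis .
  qed
  have one: "Z (\<lambda>x. 1) < top"
  proof -
    obtain A :: real where A: "0 < A" "associate_norm X (\<lambda>x. 1) \<le> ennreal A"
      using X.associate_norm_const_finite by auto
    have "?T (rearr01 (\<lambda>x. 1)) s \<le> ennreal C * 1" if s: "s \<in> {0<..<1}" for s
    proof -
      have "rearr01 (\<lambda>x. 1) r \<le> 1" if "r \<in> {0<..<1}" for r
        using that by (intro rearr01_le_of_antimono[where s = r]) auto
      then have "?T (rearr01 (\<lambda>x. 1)) s \<le> (\<integral>\<^sup>+r. \<kappa> s r * 1 \<partial>leb01)"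
        by (intro nn_integral_mono mult_left_mono) auto
      with fin[OF s] show ?thesis by simp
    qed
    then have "Z (\<lambda>x. 1) \<le> associate_norm X (\<lambda>s. ennreal C * 1)"
      unfolding Z_def by (intro associate_norm_mono) auto
    also have "\<dots> = ennreal C * associate_norm X (\<lambda>s. 1)"
      by (intro associate_norm_scale) simp
    also have "\<dots> \<le> ennreal C * ennreal A"
      using A by (intro mult_left_mono) auto
    also have "\<dots> < top" by (simp add: ennreal_mult_less_top)
    finally show ?thesis .
  qed
  obtain z where z: "0 \<le> z" "Z (\<lambda>x. 1) = ennreal z"
    using one by (cases "Z (\<lambda>x. 1)") auto
  have unit: "Z (\<lambda>x. ennreal (1 / (z + 1))) \<le> 1"
  proof -
    have "Z (\<lambda>x. ennreal (1 / (z + 1)) * 1) = ennreal (1 / (z + 1)) * Z (\<lambda>x. 1)"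
      using z by (intro scale) auto
    also have "\<dots> \<le> 1" using z by (simp add: ennreal_mult[symmetric])
    finally show ?thesis by simp
  qed
  have total: "\<exists>C'. \<forall>f\<in>Mplus. Z f \<le> 1 \<longrightarrow> (\<integral>\<^sup>+x. f x \<partial>leb01) \<le> ennreal C'"
  proof -
    obtain a where a: "0 < a" "X (\<lambda>x. ennreal a) \<le> 1"
      using X.exists_unit_const by auto
    \<comment> \<open>Testing with the constant a, and keeping only s > 1/2 (measure 1/2) and r <
      \<delta> (kernel at least c), bounds \<open>Z f\<close> below by a c / 2 times the integral of
      \<open>rearr01 f\<close> over (0,\<delta>). That integral is at least \<delta> times the
      integral of f.\<close>
    have "(\<integral>\<^sup>+x. f x \<partial>leb01) \<le> ennreal (2 / (a * c * \<delta>))" if f: "f \<in> Mplus" "Z f \<le> 1" for f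
    proof -
      have ind: "ennreal a * indicator {1/2<..} s * (ennreal c * (\<integral>\<^sup>+r. indicator {..<\<delta>} r * rearr01 f r \<partial>leb01))
          \<le> ennreal a * ?T (rearr01 f) s" if s: "s \<in> {0<..<1}" for s
      proof (cases "1/2 < s")
        case True
        have "ennreal c * (\<integral>\<^sup>+r. indicator {..<\<delta>} r * rearr01 f r \<partial>leb01) =
            (\<integral>\<^sup>+r. ennreal c * (indicator {..<\<delta>} r * rearr01 f r) \<partial>leb01)"
          by (intro nn_integral_cmult[symmetric]) measurable
        also have "\<dots> \<le> ?T (rearr01 f) s"
        proof (intro nn_integral_mono)
          fix r assume "r \<in> space leb01"
          then show "ennreal c * (indicator {..<\<delta>} r * rearr01 f r) \<le> \<kappa> s r * rearr01 f r"
            using pos(4)[OF s True, of r] by (auto simp: indicator_def intro: mult_right_mono)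
        qed
        finally show ?thesis using True by (auto intro: mult_left_mono)
      qed auto
      \<comment> \<open>The mean of a nonincreasing function over (0,\<delta>) is at least its mean
        over (0,1). Level by level this is \<delta> e \<le> min \<delta> e for \<delta>, e in
        [0,1].\<close>
      have low: "ennreal \<delta> * (\<integral>\<^sup>+x. f x \<partial>leb01) \<le> (\<integral>\<^sup>+r. indicator {..<\<delta>} r * rearr01 f r \<partial>leb01)"
      proof -
        have "ennreal \<delta> * emeasure leb01 {x \<in> {0<..<1}. l < f x}
            \<le> emeasure leb01 {x \<in> {0<..<1}. x < \<delta> \<and> l < rearr01 f x}" for l
        proof -
          let ?e = "emeasure leb01 {x \<in> {0<..<1}. l < f x}"
          have e1: "?e \<le> 1" by (rule emeasure_leb01_le_1)
          have "ennreal \<delta> * ?e \<le> min (ennreal \<delta>) ?e"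
            using mult_left_mono[OF e1, of "ennreal \<delta>"] mult_right_mono[of "ennreal \<delta>" 1 ?e] pos
            by auto
          also have "\<dots> = emeasure leb01 {x \<in> {0<..<1}. ennreal x < min (ennreal \<delta>) ?e}"
            using e1 by (intro emeasure_leb01_ennreal_lessThan[symmetric]) (simp add: min.coboundedI2)
          also have "{x \<in> {0<..<1}. ennreal x < min (ennreal \<delta>) ?e} = {x \<in> {0<..<1}. x < \<delta> \<and> l < rearr01 f x}"
            using less_rearr01_iff[OF f(1)] by (auto simp: ennreal_less_iff)
          finally show ?thesis .
        qed
        note le = this
        have "ennreal \<delta> * (\<integral>\<^sup>+x. f x * 1 \<partial>leb01) =
            ennreal \<delta> * (\<integral>\<^sup>+l. indicator {0<..} l * emeasure leb01 {x \<in> {0<..<1}. ennreal l < f x} \<partial>lborel)"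
        proof -
          have "(\<integral>\<^sup>+x. indicator {x. ennreal l < f x} x * 1 \<partial>leb01) = emeasure leb01 {x \<in> {0<..<1}. ennreal l < f x}" for l
            using nn_integral_indicator_leb01[OF Mplus_sets[OF f(1)]] by simp
          then show ?thesis by (simp only: layer_cake[OF f(1) Mplus_const])
        qed
        also have "\<dots> = (\<integral>\<^sup>+l. ennreal \<delta> * (indicator {0<..} l * emeasure leb01 {x \<in> {0<..<1}. ennreal l < f x}) \<partial>lborel)"
        proof (intro nn_integral_cmult[symmetric])
          have "antimono (\<lambda>l. emeasure leb01 {x \<in> {0<..<1}. ennreal l < f x})"
            by (intro antimonoI emeasure_mono Mplus_sets f)
              (auto dest: le_less_trans[OF ennreal_leI])
          then have "(\<lambda>l. emeasure leb01 {x \<in> {0<..<1}. ennreal l < f x}) \<in> borel_measurable borel"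
            by (rule borel_measurable_antimono_ennreal)
          then show "(\<lambda>l. indicator {0<..} l * emeasure leb01 {x \<in> {0<..<1}. ennreal l < f x}) \<in> borel_measurable lborel"
            by (intro borel_measurable_times_ennreal) auto
        qed
        also have "\<dots> \<le> (\<integral>\<^sup>+l. indicator {0<..} l * emeasure leb01 {x \<in> {0<..<1}. x < \<delta> \<and> ennreal l < rearr01 f x} \<partial>lborel)"
          using le by (intro nn_integral_mono) (auto simp: indicator_def)
        also have "\<dots> = (\<integral>\<^sup>+l. indicator {0<..} l *
            (\<integral>\<^sup>+x. indicator {x. ennreal l < rearr01 f x} x * indicator {..<\<delta>} x \<partial>leb01) \<partial>lborel)"
        proof (intro nn_integral_cong arg_cong2[where f = times] refl)
          fix l
          have *: "{x \<in> {0<..<1}. x < \<delta> \<and> ennreal l < rearr01 f x} \<in> sets leb01"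
          proof -
            have "{x \<in> space leb01. x < \<delta> \<and> ennreal l < rearr01 f x} \<in> sets leb01"
              by measurable
            then show ?thesis by simp
          qed
          have "emeasure leb01 {x \<in> {0<..<1}. x < \<delta> \<and> ennreal l < rearr01 f x} =
              (\<integral>\<^sup>+x. indicator {x. x < \<delta> \<and> ennreal l < rearr01 f x} x \<partial>leb01)"
            using nn_integral_indicator_leb01[OF *] by simp
          also have "\<dots> = (\<integral>\<^sup>+x. indicator {x. ennreal l < rearr01 f x} x * indicator {..<\<delta>} x \<partial>leb01)"
            by (intro nn_integral_cong) (auto simp: indicator_def)
          finally show "emeasure leb01 {x \<in> {0<..<1}. x < \<delta> \<and> ennreal l < rearr01 f x} = \<dots>" .
        qed
        also have "\<dots> = (\<integral>\<^sup>+r. rearr01 f r * indicator {..<\<delta>} r \<partial>leb01)"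
          by (intro layer_cake[symmetric]) measurable
        finally show ?thesis by (simp add: mult.commute)
      qed
      let ?I = "\<integral>\<^sup>+x. f x \<partial>leb01"
      have half: "emeasure leb01 {x \<in> {0<..<1}. 1/2 < x} = ennreal (1/2)"
      proof -
        have "{x \<in> {0<..<1}. 1/2 < x} = {1/2<..<1::real}" by auto
        moreover have "emeasure leb01 {1/2<..<1} = emeasure lebesgue {1/2<..<1::real}"
          by (intro emeasure_restrict_space) auto
        ultimately have "emeasure leb01 {x \<in> {0<..<1}. 1/2 < x} = emeasure lebesgue {1/2<..<1::real}"
          by (rule ssubst)
        then show ?thesis by simp
      qed
      have "ennreal (a * c * \<delta> / 2) * ?I = ennreal (1/2) * (ennreal a * (ennreal c * (ennreal \<delta> * ?I)))"
      proof -
        have "ennreal (1/2) * (ennreal a * (ennreal c * ennreal \<delta>)) = ennreal (1/2 * (a * (c * \<delta>)))"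
          using a pos by (simp only: ennreal_mult[symmetric] less_imp_le mult_nonneg_nonneg)
        also have "1/2 * (a * (c * \<delta>)) = a * c * \<delta> / 2" by simp
        finally show ?thesis by (simp only: mult.assoc[symmetric])
      qed
      also have "\<dots> \<le> ennreal (1/2) * (ennreal a * (ennreal c * (\<integral>\<^sup>+r. indicator {..<\<delta>} r * rearr01 f r \<partial>leb01)))"
        using low by (intro mult_left_mono) auto
      also have "\<dots> = (\<integral>\<^sup>+s. indicator {s. 1/2 < s} s * (ennreal a * (ennreal c * (\<integral>\<^sup>+r. indicator {..<\<delta>} r * rearr01 f r \<partial>leb01))) \<partial>leb01)"
      proof (subst nn_integral_multc)
        have half_sets: "{s \<in> {0<..<1::real}. 1/2 < s} \<in> sets leb01"
          using borel_measurable_less[of "\<lambda>_. 1/2" leb01 "\<lambda>x. x"] by simp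
        show "ennreal (1/2) * (ennreal a * (ennreal c * (\<integral>\<^sup>+r. indicator {..<\<delta>} r * rearr01 f r \<partial>leb01))) =
            (\<integral>\<^sup>+s. indicator {s. 1/2 < s} s \<partial>leb01) * (ennreal a * (ennreal c * (\<integral>\<^sup>+r. indicator {..<\<delta>} r * rearr01 f r \<partial>leb01)))"
          by (simp only: nn_integral_indicator_leb01[OF half_sets] half)
        show "indicator {s. 1/2 < s} \<in> Mplus"
          by (intro borel_imp_Mplus borel_measurable_indicator) (simp add: greaterThan_def[symmetric])
      qed
      also have "\<dots> \<le> (\<integral>\<^sup>+s. ennreal a * ?T (rearr01 f) s \<partial>leb01)"
        using ind by (intro nn_integral_mono) (auto simp: mult_ac greaterThan_def)
      also have "\<dots> \<le> Z f"
        unfolding Z_def using a(2) by (intro associate_norm_upper) auto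
      also have "\<dots> \<le> 1" by (rule f(2))
      finally have "ennreal (2 / (a * c * \<delta>)) * (ennreal (a * c * \<delta> / 2) * ?I) \<le> ennreal (2 / (a * c * \<delta>)) * 1"
        by (rule mult_left_mono) simp
      then show ?thesis
        using a pos by (simp add: mult.assoc[symmetric] ennreal_mult[symmetric])
    qed
    then show ?thesis by blast
  qed
  then obtain C' where C': "\<And>f. f \<in> Mplus \<Longrightarrow> Z f \<le> 1 \<Longrightarrow> (\<integral>\<^sup>+x. f x \<partial>leb01) \<le> ennreal C'"
    by blast
  show ri: "ri_function_norm (associate_norm Z)"
  proof (rule ri_function_norm_associate_norm)
    show "0 < 1 / (z + 1)" using z by simp
  qed (fact inv unit C')+
  fix f assume f: "f \<in> Mplus"
  show "associate_norm (associate_norm Z) f = Z f"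
  proof (rule antisym)
    show "associate_norm (associate_norm Z) f \<le> Z f"
    proof (rule associate_norm_least)
      fix g assume g: "g \<in> Mplus" "associate_norm Z g \<le> 1"
      have "(\<integral>\<^sup>+s. f s * g s \<partial>leb01) \<le> ennreal 1 * Z f"
        using g f by (intro associate_norm_hoelder scale) auto
      then show "(\<integral>\<^sup>+s. g s * f s \<partial>leb01) \<le> Z f"
        by (simp add: mult.commute)
    qed
    show "Z f \<le> associate_norm (associate_norm Z) f"
    proof -
      have "(\<integral>\<^sup>+s. g s * ?T (rearr01 f) s \<partial>leb01) \<le> associate_norm (associate_norm Z) f"
        if g: "g \<in> Mplus" "X g \<le> 1" for g
      proof -
        note [measurable] = g(1)
        \<comment> \<open>By Tonelli, testing the transformed function with g is the same as testing
          the function itself with w. This weight inherits monotonicity from the kernel, so its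
          rearrangement does not exceed it; that puts w into the unit ball of the associate norm of
          Z.\<close>
        define w where "w r = (\<integral>\<^sup>+s. g s * \<kappa> s r \<partial>leb01)" for r
        have w [measurable]: "w \<in> Mplus" unfolding w_def by measurable
        have swap: "(\<integral>\<^sup>+s. g s * ?T u s \<partial>leb01) = (\<integral>\<^sup>+r. u r * w r \<partial>leb01)"
          if [measurable]: "u \<in> Mplus" for u
        proof -
          have "(\<integral>\<^sup>+s. g s * ?T u s \<partial>leb01) = (\<integral>\<^sup>+s. (\<integral>\<^sup>+r. g s * (\<kappa> s r * u r) \<partial>leb01) \<partial>leb01)"
            by (intro nn_integral_cong nn_integral_cmult[symmetric]) measurable
          also have "\<dots> = (\<integral>\<^sup>+r. (\<integral>\<^sup>+s. g s * (\<kappa> s r * u r) \<partial>leb01) \<partial>leb01)"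
            by (rule Fubini'[symmetric]) measurable
          also have "\<dots> = (\<integral>\<^sup>+r. u r * w r \<partial>leb01)"
          proof (intro nn_integral_cong)
            fix r :: real assume "r \<in> space leb01"
            then have "(\<integral>\<^sup>+s. u r * (g s * \<kappa> s r) \<partial>leb01) = u r * w r"
              unfolding w_def by (intro nn_integral_cmult) measurable
            then show "(\<integral>\<^sup>+s. g s * (\<kappa> s r * u r) \<partial>leb01) = u r * w r"
              by (simp add: mult_ac)
          qed
          finally show ?thesis .
        qed
        have w_anti: "w r' \<le> w r" if "r \<in> {0<..<1}" "r \<le> r'" "r' < 1" for r r'
          unfolding w_def using that anti by (intro nn_integral_mono mult_left_mono) auto
        have w_rearr: "rearr01 w s \<le> w s" if "s \<in> {0<..<1}" for s
          using that by (intro rearr01_le_of_antimono[OF w that] w_anti) auto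
        have "associate_norm Z w \<le> 1"
        proof (rule associate_norm_least)
          fix u assume u: "u \<in> Mplus" "Z u \<le> 1"
          have "(\<integral>\<^sup>+s. u s * w s \<partial>leb01) \<le> (\<integral>\<^sup>+s. rearr01 u s * rearr01 w s \<partial>leb01)"
            by (rule hardy_littlewood[OF u(1) w])
          also have "\<dots> \<le> (\<integral>\<^sup>+s. rearr01 u s * w s \<partial>leb01)"
            using w_rearr by (intro nn_integral_mono mult_left_mono) auto
          also have "\<dots> = (\<integral>\<^sup>+s. g s * ?T (rearr01 u) s \<partial>leb01)"
            by (rule swap[symmetric]) measurable
          also have "\<dots> \<le> Z u"
            unfolding Z_def using g by (rule associate_norm_upper)
          finally show "(\<integral>\<^sup>+s. u s * w s \<partial>leb01) \<le> 1" using u(2) by simp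
        qed
        have "(\<integral>\<^sup>+s. g s * ?T (rearr01 f) s \<partial>leb01) = (\<integral>\<^sup>+s. rearr01 f s * w s \<partial>leb01)"
          by (rule swap) measurable
        also have "\<dots> \<le> (\<integral>\<^sup>+s. rearr01 (rearr01 f) s * rearr01 w s \<partial>leb01)"
          by (intro hardy_littlewood w) measurable
        also have "\<dots> = (\<integral>\<^sup>+s. rearr01 w s * rearr01 f s \<partial>leb01)"
          using f by (simp add: rearr01_rearr01 mult.commute)
        also have "\<dots> \<le> (SUP h \<in> {h \<in> Mplus. associate_norm Z h \<le> 1}. \<integral>\<^sup>+s. rearr01 h s * rearr01 f s \<partial>leb01)"
          using w \<open>associate_norm Z w \<le> 1\<close> by (intro SUP_upper) auto
        also have "\<dots> = associate_norm (associate_norm Z) f"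
          using ri_function_norm.P6[OF ri] f by (rule associate_norm_rearr[symmetric])
        finally show ?thesis .
      qed
      moreover have "Z f = associate_norm X (?T (rearr01 f))"
        by (simp only: Z_def)
      ultimately show ?thesis
        by (simp only: associate_norm_least)
    qed
  qed
qed

section \<open>The power and logarithmic kernels\<close>

definition kern :: "nat \<Rightarrow> real \<Rightarrow> real \<Rightarrow> real \<Rightarrow> ennreal" where
  "kern m \<alpha> s r =
    (if 0 < r \<and> r < s
     then if \<alpha> = 1 then ennreal (1 / s) * ennreal (ln (s / r) ^ (m - 1))
          else ennreal (s powr (- 1 + real m * (1 - \<alpha>)))
     else 0)"

definition T_op :: "nat \<Rightarrow> real \<Rightarrow> (real \<Rightarrow> ennreal) \<Rightarrow> real \<Rightarrow> ennreal" where
  "T_op m \<alpha> f s = (\<integral>\<^sup>+r. kern m \<alpha> s r * f r \<partial>leb01)"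

lemma kern_borel [measurable]:
  assumes [measurable]: "f \<in> borel_measurable M" "g \<in> borel_measurable M"
  shows "(\<lambda>x. kern m \<alpha> (f x) (g x)) \<in> borel_measurable M"
  unfolding kern_def by measurable

lemma kern_leb01_pair [measurable]: "case_prod (kern m \<alpha>) \<in> borel_measurable (leb01 \<Otimes>\<^sub>M leb01)"
proof -
  have [measurable]: "fst \<in> borel_measurable (leb01 \<Otimes>\<^sub>M leb01)" "snd \<in> borel_measurable (leb01 \<Otimes>\<^sub>M leb01)"
    by (auto intro: measurable_compose[OF measurable_fst leb01_id] measurable_compose[OF measurable_snd leb01_id])
  show ?thesis unfolding split_beta' by measurable
qed

lemma nn_integral_leb01: "(\<integral>\<^sup>+x. f x \<partial>leb01) = (\<integral>\<^sup>+x. f x * indicator {0<..<1} x \<partial>lborel)"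
  by (simp add: nn_integral_restrict_space nn_integral_completion)

lemma T_op_cong: "(\<And>r. r \<in> {0<..<1} \<Longrightarrow> f r = g r) \<Longrightarrow> T_op m \<alpha> f s = T_op m \<alpha> g s"
  unfolding T_op_def by (intro nn_integral_cong) auto

lemma T_op_mono: "(\<And>r. r \<in> {0<..<1} \<Longrightarrow> f r \<le> g r) \<Longrightarrow> T_op m \<alpha> f s \<le> T_op m \<alpha> g s"
  unfolding T_op_def by (intro nn_integral_mono mult_left_mono) auto

lemma T_op_Mplus [measurable]:
  assumes [measurable]: "f \<in> Mplus"
  shows "T_op m \<alpha> f \<in> Mplus"
proof -
  interpret sigma_finite_measure leb01 by (rule sigma_finite_leb01)
  have "(\<lambda>(s, r). kern m \<alpha> s r * f r) \<in> borel_measurable (leb01 \<Otimes>\<^sub>M leb01)"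
    using kern_leb01_pair[of m \<alpha>] unfolding split_beta' by measurable
  then show ?thesis
    unfolding T_op_def by (rule borel_measurable_nn_integral)
qed

lemma assoc_functional_eq:
  "assoc_functional m \<alpha> N f = associate_norm N (T_op m \<alpha> (rearr01 f))"
proof -
  have int: "(\<integral>\<^sup>+r. (if 0 < r \<and> r < s then ennreal c * \<phi> r else 0) * rearr01 f r \<partial>leb01) =
      ennreal c * (\<integral>\<^sup>+r\<in>{0<..<s}. \<phi> r * rearr01 f r \<partial>lebesgue)"
    if s: "s \<in> {0<..<1}" and [measurable]: "\<phi> \<in> borel_measurable borel" for s c and \<phi> :: "real \<Rightarrow> ennreal"
  proof -
    have "(\<integral>\<^sup>+r. (if 0 < r \<and> r < s then ennreal c * \<phi> r else 0) * rearr01 f r \<partial>leb01) =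
        (\<integral>\<^sup>+r. ennreal c * (\<phi> r * rearr01 f r * indicator {0<..<s} r) \<partial>lborel)"
      unfolding nn_integral_leb01 using s
      by (intro nn_integral_cong) (auto simp: indicator_def mult_ac)
    also have "\<dots> = ennreal c * (\<integral>\<^sup>+r. \<phi> r * rearr01 f r * indicator {0<..<s} r \<partial>lborel)"
      using that by (intro nn_integral_cmult borel_measurable_times_ennreal) (simp_all add: rearrangement_borel)
    finally show ?thesis by (simp add: nn_integral_completion)
  qed
  show ?thesis
  proof (cases "\<alpha> = 1")
    case True
    show ?thesis
      unfolding assoc_functional_def if_P[OF True]
    proof (rule associate_norm_cong)
      fix s :: real assume s: "s \<in> {0<..<1}"
      have "T_op m \<alpha> (rearr01 f) s = (\<integral>\<^sup>+r. (if 0 < r \<and> r < s then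
          ennreal (1 / s) * ennreal (ln (s / r) ^ (m - 1)) else 0) * rearr01 f r \<partial>leb01)"
        unfolding T_op_def using True by (intro nn_integral_cong) (simp add: kern_def)
      also have "\<dots> = ennreal (1 / s) * (\<integral>\<^sup>+r\<in>{0<..<s}. ennreal (ln (s / r) ^ (m - 1)) * rearr01 f r \<partial>lebesgue)"
        using s by (rule int) measurable
      finally show "ennreal (1 / s) * (\<integral>\<^sup>+r\<in>{0<..<s}. ennreal (ln (s / r) ^ (m - 1)) * rearr01 f r \<partial>lebesgue)
        = T_op m \<alpha> (rearr01 f) s" by simp
    qed
  next
    case False
    show ?thesis
      unfolding assoc_functional_def if_not_P[OF False]
    proof (rule associate_norm_cong)
      fix s :: real assume s: "s \<in> {0<..<1}"
      have "T_op m \<alpha> (rearr01 f) s = (\<integral>\<^sup>+r. (if 0 < r \<and> r < s then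
          ennreal (s powr (- 1 + real m * (1 - \<alpha>))) * 1 else 0) * rearr01 f r \<partial>leb01)"
        unfolding T_op_def using False by (intro nn_integral_cong) (simp add: kern_def)
      also have "\<dots> = ennreal (s powr (- 1 + real m * (1 - \<alpha>))) * (\<integral>\<^sup>+r\<in>{0<..<s}. 1 * rearr01 f r \<partial>lebesgue)"
        using s by (rule int) measurable
      finally show "ennreal (s powr (- 1 + real m * (1 - \<alpha>))) * (\<integral>\<^sup>+r\<in>{0<..<s}. rearr01 f r \<partial>lebesgue)
        = T_op m \<alpha> (rearr01 f) s" by simp
    qed
  qed
qed

text \<open>The cut-off r < s is built into \<open>kern\<close>, whose value drops to 0 there, so
  monotonicity holds across r = s as well.\<close>

lemma kern_antimono:
  assumes "0 < r" "r \<le> r'"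
  shows "kern m \<alpha> s r' \<le> kern m \<alpha> s r"
proof -
  have "ln (s / r') ^ (m - 1) \<le> ln (s / r) ^ (m - 1)" if "r' < s"
  proof (intro power_mono)
    show "ln (s / r') \<le> ln (s / r)"
      using assms that by (subst ln_le_cancel_iff) (auto simp: divide_left_mono)
    show "0 \<le> ln (s / r')"
      using assms that by (intro ln_ge_zero) auto
  qed
  then show ?thesis
    using assms by (auto simp: kern_def intro!: mult_left_mono ennreal_leI)
qed

lemma nn_integral_powr:
  assumes "-1 < a" "0 \<le> c"
  shows "(\<integral>\<^sup>+x. ennreal (x powr a) * indicator {0<..<c} x \<partial>lborel) = ennreal (c powr (a + 1) / (a + 1))"
proof -
  have "((\<lambda>x. if x \<in> {0..c} then x powr a else 0) has_integral (c powr (a + 1) / (a + 1))) UNIV"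
    using has_integral_powr_from_0[OF assms] by (subst has_integral_restrict_UNIV)
  then have "integral\<^sup>N lborel (\<lambda>x. if x \<in> {0..c} then x powr a else 0) = ennreal (c powr (a + 1) / (a + 1))"
    by (intro nn_integral_has_integral_lborel) auto
  moreover have "integral\<^sup>N lborel (\<lambda>x. if x \<in> {0..c} then x powr a else 0) =
      (\<integral>\<^sup>+x. ennreal (x powr a) * indicator {0<..<c} x \<partial>lborel)"
  proof (rule nn_integral_cong_AE)
    show "AE x in lborel. ennreal (if x \<in> {0..c} then x powr a else 0) = ennreal (x powr a) * indicator {0<..<c} x"
      using AE_lborel_singleton[of 0] AE_lborel_singleton[of c]
      by eventually_elim (auto simp: indicator_def)
  qed
  ultimately show ?thesis by simp
qed

text \<open>This makes the prescribed functional finite at the constant 1. For \<alpha> = 1 the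
  logarithm is absorbed by a square root of s / r, whose integral scales so that the bound is
  uniform in s.\<close>

lemma kern_integral_bounded:
  assumes "1 \<le> m" "\<alpha> \<le> 1"
  shows "\<exists>C. \<forall>s\<in>{0<..<1}. (\<integral>\<^sup>+r. kern m \<alpha> s r \<partial>leb01) \<le> ennreal C"
proof (cases "\<alpha> = 1")
  case True
  \<comment> \<open>From ln y \<le> 2m y^(1/(2m)), raised to the power m-1; the resulting exponent
    (m-1)/(2m) is at most 1/2.\<close>
  define K where "K = (2 * real m) ^ (m - 1)"
  have K: "0 \<le> K" by (simp add: K_def)
  have log: "ln y ^ (m - 1) \<le> K * y powr (1/2)" if "1 \<le> y" for y
  proof -
    have "ln y ^ (m - 1) \<le> (y powr (1 / (2 * real m)) / (1 / (2 * real m))) ^ (m - 1)"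
      using that assms by (intro power_mono ln_powr_bound ln_ge_zero) auto
    also have "\<dots> = K * y powr (real (m - 1) / (2 * real m))"
      using that by (simp add: K_def power_mult_distrib powr_power mult.commute)
    also have "\<dots> \<le> K * y powr (1/2)"
      using that assms K by (intro mult_left_mono powr_mono) (auto simp: field_simps of_nat_diff)
    finally show ?thesis .
  qed
  have "(\<integral>\<^sup>+r. kern m \<alpha> s r \<partial>leb01) \<le> ennreal (2 * K)" if s: "s \<in> {0<..<1}" for s
  proof -
    have "(\<integral>\<^sup>+r. kern m \<alpha> s r \<partial>leb01) \<le>
        (\<integral>\<^sup>+r. ennreal (K * s powr (-1/2)) * (ennreal (r powr (-1/2)) * indicator {0<..<s} r) \<partial>lborel)"
      unfolding nn_integral_leb01
    proof (intro nn_integral_mono)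
      fix r :: real
      have "1 / s * ln (s / r) ^ (m - 1) \<le> K * s powr (-1/2) * r powr (-1/2)" if r: "0 < r" "r < s"
      proof -
        have "1 / s * ln (s / r) ^ (m - 1) \<le> 1 / s * (K * (s / r) powr (1/2))"
          using r by (intro mult_left_mono log) auto
        also have "\<dots> = K * (s powr (1/2) / s) * r powr (-1/2)"
          using r by (simp add: powr_divide powr_minus_divide)
        also have "s powr (1/2) / s = s powr (-1/2)"
          using r powr_diff[of s "1/2" 1] by simp
        finally show ?thesis .
      qed
      moreover have "0 \<le> ln (s / r)" if "0 < r" "r < s"
        using that by (intro ln_ge_zero) auto
      ultimately show "kern m \<alpha> s r * indicator {0<..<1} r \<le>
          ennreal (K * s powr (-1/2)) * (ennreal (r powr (-1/2)) * indicator {0<..<s} r)"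
        using True K s by (auto simp: kern_def indicator_def ennreal_mult[symmetric] mult.assoc intro!: ennreal_leI)
    qed
    also have "\<dots> = ennreal (K * s powr (-1/2)) * ennreal (s powr (1/2) / (1/2))"
      using nn_integral_powr[of "-1/2" s] s by (subst nn_integral_cmult) auto
    also have "\<dots> = ennreal (2 * K * (s powr (-1/2) * s powr (1/2)))"
      using K by (simp add: ennreal_mult[symmetric] mult_ac)
    also have "s powr (-1/2) * s powr (1/2) = 1"
      using s by (simp add: powr_add[symmetric])
    finally show ?thesis by simp
  qed
  then show ?thesis by blast
next
  case False
  have "(\<integral>\<^sup>+r. kern m \<alpha> s r \<partial>leb01) \<le> ennreal 1" if s: "s \<in> {0<..<1}" for s
  proof -
    define a where "a = real m * (1 - \<alpha>)"
    have a: "0 < a" using False assms by (simp add: a_def)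
    have "(\<integral>\<^sup>+r. kern m \<alpha> s r \<partial>leb01) \<le> (\<integral>\<^sup>+r. ennreal (s powr (-1 + a)) * indicator {0<..<s} r \<partial>lborel)"
      unfolding nn_integral_leb01 using False s
      by (intro nn_integral_mono) (auto simp: kern_def indicator_def a_def)
    also have "\<dots> = ennreal (s powr (-1 + a)) * ennreal s"
      using s by (subst nn_integral_cmult_indicator) auto
    also have "\<dots> = ennreal (s powr a)"
      using s powr_mult_base[of s "-1 + a"] by (simp add: ennreal_mult[symmetric] mult.commute)
    also have "\<dots> \<le> ennreal 1"
      using s a by (intro ennreal_leI powr_le1) auto
    finally show ?thesis .
  qed
  then show ?thesis by blast
qed

text \<open>For s > 1/2 and r < 1/6 the quotient s / r exceeds 3, hence e, and the logarithm is at
  least 1. In the power case s^(-1+a) \<ge> s^a \<ge> (1/2)^a with a = m(1-\<alpha>); for \<alpha> =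
  1 the same constant equals 1.\<close>

lemma kern_lower:
  assumes "1 \<le> m" "\<alpha> \<le> 1" "s \<in> {0<..<1}" "1/2 < s" "0 < r" "r < 1/6"
  shows "ennreal ((1/2) powr (real m * (1 - \<alpha>))) \<le> kern m \<alpha> s r"
proof (cases "\<alpha> = 1")
  case True
  have "1 \<le> ln (s / r)"
  proof -
    have "r * exp 1 \<le> r * 3"
      using assms exp_le by (intro mult_left_mono) auto
    then have "r * exp 1 \<le> s" using assms by linarith
    then have "exp 1 \<le> s / r"
      using assms by (simp add: pos_le_divide_eq mult.commute)
    then have "ln (exp 1) \<le> ln (s / r)"
      using assms by (subst ln_le_cancel_iff) auto
    then show ?thesis by simp
  qed
  then have "1 \<le> 1 / s * ln (s / r) ^ (m - 1)"
    using assms mult_mono[of 1 "1 / s" 1 "ln (s / r) ^ (m - 1)"] by (auto simp: one_le_power)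
  then show ?thesis
    using True assms by (auto simp: kern_def ennreal_mult[symmetric] intro!: ennreal_leI)
next
  case False
  define a where "a = real m * (1 - \<alpha>)"
  have a: "0 < a" using False assms by (simp add: a_def)
  have "(1/2) powr a \<le> s powr a" using assms a by (intro powr_mono2) auto
  also have "\<dots> \<le> s powr (-1 + a)" using assms by (intro powr_mono') auto
  finally show ?thesis
    using False assms by (auto simp: kern_def a_def intro!: ennreal_leI)
qed

text \<open>The associate norm of the prescribed functional Z is a witness for the choice operator,
  since its own associate norm is Z again.\<close>

theorem ri_function_norm_optimal_norm:
  assumes X: "ri_function_norm X" and m: "1 \<le> m" and \<alpha>: "\<alpha> \<le> 1"
  shows "ri_function_norm (optimal_norm m \<alpha> X)"
    and "\<And>f. f \<in> Mplus \<Longrightarrow> associate_norm (optimal_norm m \<alpha> X) f = associate_norm X (T_op m \<alpha> (rearr01 f))"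
proof -
  obtain C where C: "\<And>s. s \<in> {0<..<1} \<Longrightarrow> (\<integral>\<^sup>+r. kern m \<alpha> s r \<partial>leb01) \<le> ennreal C"
    using kern_integral_bounded[OF m \<alpha>] by blast
  define Z where "Z = (\<lambda>f. associate_norm X (\<lambda>s. \<integral>\<^sup>+r. kern m \<alpha> s r * rearr01 f r \<partial>leb01))"
  have Z_eq: "Z f = associate_norm X (T_op m \<alpha> (rearr01 f))" for f
    by (simp add: Z_def T_op_def[abs_def])
  have "ri_function_norm (associate_norm Z)"
    and "\<And>f. f \<in> Mplus \<Longrightarrow> associate_norm (associate_norm Z) f = Z f"
    using associate_norm_of_kernel_norm[OF X kern_leb01_pair[of m \<alpha>], of C "1/6" "(1/2) powr (real m * (1 - \<alpha>))"]
      kern_antimono C kern_lower[OF m \<alpha>] unfolding Z_def by auto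
  then have "\<exists>Y. ri_function_norm Y \<and> (\<forall>f\<in>Mplus. associate_norm Y f = assoc_functional m \<alpha> X f)"
    by (intro exI[of _ "associate_norm Z"]) (simp add: assoc_functional_eq Z_eq)
  from someI_ex[OF this] show "ri_function_norm (optimal_norm m \<alpha> X)"
    and "\<And>f. f \<in> Mplus \<Longrightarrow> associate_norm (optimal_norm m \<alpha> X) f = associate_norm X (T_op m \<alpha> (rearr01 f))"
    unfolding optimal_norm_def[symmetric] by (auto simp: assoc_functional_eq)
qed

section \<open>Iteration\<close>

declare leb01_id [measurable del]

text \<open>For positive s this is the mean of f over (0,s) after the substitution r = s u. In this
  form monotonicity in s can be read off under the integral.\<close>

definition avg :: "(real \<Rightarrow> ennreal) \<Rightarrow> real \<Rightarrow> ennreal" where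
  "avg f s = (\<integral>\<^sup>+u. f (s * u) * indicator {0<..<1} u \<partial>lborel)"

lemma T_op_lborel:
  assumes "s \<le> 1"
  shows "T_op m \<alpha> f s = (\<integral>\<^sup>+r. kern m \<alpha> s r * f r \<partial>lborel)"
  unfolding T_op_def nn_integral_leb01 using assms
  by (intro nn_integral_cong) (auto simp: kern_def indicator_def)

lemma T_op_scaled:
  assumes [measurable]: "f \<in> borel_measurable borel" and s: "s \<in> {0<..<1}"
  shows "T_op m \<alpha> f s = ennreal s * (\<integral>\<^sup>+u. kern m \<alpha> s (s * u) * f (s * u) \<partial>lborel)"
proof -
  have "T_op m \<alpha> f s = (\<integral>\<^sup>+r. kern m \<alpha> s r * f r \<partial>lborel)"
    using s by (intro T_op_lborel) auto
  also have "\<dots> = ennreal \<bar>s\<bar> * (\<integral>\<^sup>+u. kern m \<alpha> s (0 + s * u) * f (0 + s * u) \<partial>lborel)"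
    using s by (intro nn_integral_real_affine) auto
  finally show ?thesis using s by simp
qed

text \<open>The kernel is constant in r on (0,s), so operators of different order m differ only by a
  power of s.\<close>

lemma T_op_eq_avg:
  assumes [measurable]: "f \<in> borel_measurable borel" and s: "s \<in> {0<..<1}" and "\<alpha> \<noteq> 1"
  shows "T_op m \<alpha> f s = ennreal (s powr (real m * (1 - \<alpha>))) * avg f s"
proof -
  let ?a = "real m * (1 - \<alpha>)"
  have "(\<integral>\<^sup>+u. kern m \<alpha> s (s * u) * f (s * u) \<partial>lborel) =
      (\<integral>\<^sup>+u. ennreal (s powr (-1 + ?a)) * (f (s * u) * indicator {0<..<1} u) \<partial>lborel)"
    using s \<open>\<alpha> \<noteq> 1\<close>
    by (intro nn_integral_cong) (auto simp: kern_def indicator_def zero_less_mult_iff)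
  also have "\<dots> = ennreal (s powr (-1 + ?a)) * avg f s"
    unfolding avg_def by (intro nn_integral_cmult) measurable
  finally have "T_op m \<alpha> f s = ennreal s * (ennreal (s powr (-1 + ?a)) * avg f s)"
    using T_op_scaled[OF assms(1) s] by simp
  also have "\<dots> = ennreal (s * s powr (-1 + ?a)) * avg f s"
    using s by (simp add: ennreal_mult mult.assoc)
  also have "s * s powr (-1 + ?a) = s powr ?a"
    using s powr_mult_base[of s "-1 + ?a"] by simp
  finally show ?thesis .
qed

lemma avg_antimono: "antimono f \<Longrightarrow> antimono (avg f)"
  unfolding avg_def
  by (intro antimonoI nn_integral_mono) (auto simp: indicator_def antimono_def mult_right_mono)

text \<open>Multiplying the mean by s undoes the normalisation and leaves the integral over (0,s).
  This complements \<open>avg_antimono\<close>: the mean falls, but no faster than 1/s.\<close>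

lemma mult_avg_mono:
  assumes [measurable]: "f \<in> borel_measurable borel" and "0 < t" "t \<le> s"
  shows "ennreal t * avg f t \<le> ennreal s * avg f s"
proof -
  have eq: "ennreal x * avg f x = (\<integral>\<^sup>+r. f r * indicator {0<..<x} r \<partial>lborel)" if "0 < x" for x
  proof -
    have "(\<integral>\<^sup>+r. f r * indicator {0<..<x} r \<partial>lborel) =
        ennreal \<bar>x\<bar> * (\<integral>\<^sup>+u. f (0 + x * u) * indicator {0<..<x} (0 + x * u) \<partial>lborel)"
      using that by (intro nn_integral_real_affine) auto
    also have "(\<integral>\<^sup>+u. f (0 + x * u) * indicator {0<..<x} (0 + x * u) \<partial>lborel) = avg f x"
      unfolding avg_def using that
      by (intro nn_integral_cong) (auto simp: indicator_def zero_less_mult_iff)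
    finally show ?thesis using that by simp
  qed
  show ?thesis
    using assms by (simp only: eq less_le_trans[OF assms(2,3)])
      (auto intro!: nn_integral_mono simp: indicator_def)
qed

text \<open>Hardy--Littlewood, applied to the kernel as a function of r: being nonincreasing, it
  dominates its own rearrangement.\<close>

lemma T_op_le_rearr:
  assumes [measurable]: "u \<in> Mplus" and s: "s \<in> {0<..<1}"
  shows "T_op m \<alpha> u s \<le> T_op m \<alpha> (rearr01 u) s"
proof -
  have k: "kern m \<alpha> s \<in> Mplus"
    by (intro borel_imp_Mplus kern_borel) auto
  have "T_op m \<alpha> u s \<le> (\<integral>\<^sup>+r. rearr01 (kern m \<alpha> s) r * rearr01 u r \<partial>leb01)"
    unfolding T_op_def by (intro hardy_littlewood k assms)
  also have "\<dots> \<le> T_op m \<alpha> (rearr01 u) s"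
    unfolding T_op_def
  proof (intro nn_integral_mono mult_right_mono)
    fix r assume "r \<in> space leb01"
    then show "rearr01 (kern m \<alpha> s) r \<le> kern m \<alpha> s r"
      by (intro rearr01_le_of_antimono[OF k] kern_antimono) auto
  qed simp
  finally show ?thesis .
qed

text \<open>On (0,s) the nonincreasing mean \<open>avg F\<close> is at least its value at s, so the
  mean of t^b \<open>avg F t\<close> over (0,s) is at least s^b / (b+1) times
  \<open>avg F s\<close>. This is the source of the constant b+1.\<close>

lemma T_op_power_lower:
  assumes F: "F \<in> borel_measurable borel" "antimono F" and \<alpha>: "\<alpha> < 1" and s: "s \<in> {0<..<1}"
  shows "T_op (k + h) \<alpha> F s \<le>
    ennreal (real h * (1 - \<alpha>) + 1) * T_op k \<alpha> (rearr01 (T_op h \<alpha> F)) s"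
proof -
  define a where "a = real k * (1 - \<alpha>)"
  define b where "b = real h * (1 - \<alpha>)"
  have ab: "0 \<le> a" "0 \<le> b" using \<alpha> by (auto simp: a_def b_def)
  have avg_F [measurable]: "avg F \<in> borel_measurable borel"
    using F(2) by (intro borel_measurable_antimono_ennreal avg_antimono)
  let ?G = "\<lambda>t. ennreal (t powr b) * avg F t"
  have "T_op (k + h) \<alpha> F s = ennreal (s powr (a + b)) * avg F s"
    using T_op_eq_avg[OF F(1) s, of \<alpha> "k + h"] \<alpha> by (simp add: a_def b_def algebra_simps)
  also have "\<dots> = ennreal (b + 1) * (ennreal (s powr a) * (ennreal (s powr b / (b + 1)) * avg F s))"
  proof -
    have e1: "ennreal (b + 1) * ennreal (s powr b / (b + 1)) = ennreal (s powr b)"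
    proof -
      have "b + 1 \<noteq> 0" "0 \<le> b + 1" using ab by linarith+
      then have "ennreal (b + 1) * ennreal (s powr b / (b + 1)) = ennreal ((b + 1) * (s powr b / (b + 1)))"
        by (intro ennreal_mult[symmetric]) auto
      also have "(b + 1) * (s powr b / (b + 1)) = s powr b"
        using \<open>b + 1 \<noteq> 0\<close> by simp
      finally show ?thesis .
    qed
    have e2: "ennreal (s powr (a + b)) = ennreal (s powr a) * ennreal (s powr b)"
      by (simp add: powr_add ennreal_mult)
    have "ennreal (s powr (a + b)) * avg F s =
        ennreal (s powr a) * (ennreal (b + 1) * ennreal (s powr b / (b + 1))) * avg F s"
      by (simp only: e1 e2)
    then show ?thesis by (simp only: mult_ac)
  qed
  finally have start: "T_op (k + h) \<alpha> F s =
      ennreal (b + 1) * (ennreal (s powr a) * (ennreal (s powr b / (b + 1)) * avg F s))" .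
  have avg_G: "ennreal (s powr b / (b + 1)) * avg F s \<le> avg ?G s"
  proof -
    have "ennreal (s powr b / (b + 1)) * avg F s =
        ennreal (s powr b) * (avg F s * (\<integral>\<^sup>+u. ennreal (u powr b) * indicator {0<..<1} u \<partial>lborel))"
    proof -
      have "(\<integral>\<^sup>+u. ennreal (u powr b) * indicator {0<..<1} u \<partial>lborel) = ennreal (1 / (b + 1))"
        using nn_integral_powr[of b 1] ab by simp
      moreover have "ennreal (s powr b / (b + 1)) = ennreal (s powr b) * ennreal (1 / (b + 1))"
        using ab by (subst ennreal_mult[symmetric]) auto
      ultimately show ?thesis by (simp only: mult_ac)
    qed
    also have "\<dots> = ennreal (s powr b) * (\<integral>\<^sup>+u. avg F s * (ennreal (u powr b) * indicator {0<..<1} u) \<partial>lborel)"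
      by (intro arg_cong2[where f = times] refl nn_integral_cmult[symmetric]) measurable
    also have "\<dots> = (\<integral>\<^sup>+u. ennreal (s powr b) * (avg F s * (ennreal (u powr b) * indicator {0<..<1} u)) \<partial>lborel)"
      by (intro nn_integral_cmult[symmetric]) measurable
    also have "\<dots> \<le> avg ?G s"
      unfolding avg_def[of ?G]
    proof (intro nn_integral_mono)
      fix u
      show "ennreal (s powr b) * (avg F s * (ennreal (u powr b) * indicator {0<..<1} u)) \<le>
          ennreal ((s * u) powr b) * avg F (s * u) * indicator {0<..<1} u"
      proof (cases "u \<in> {0<..<1}")
        case True
        then have "avg F s \<le> avg F (s * u)"
          using avg_antimono[OF F(2)] s by (auto simp: antimono_def)
        moreover have "ennreal ((s * u) powr b) = ennreal (s powr b) * ennreal (u powr b)"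
          using True s by (simp add: powr_mult ennreal_mult)
        ultimately have "ennreal (s powr b) * (avg F s * ennreal (u powr b)) \<le>
            ennreal ((s * u) powr b) * avg F (s * u)"
          using mult_right_mono[of "avg F s" "avg F (s * u)" "ennreal (s powr b) * ennreal (u powr b)"]
          by (simp only: mult_ac zero_le)
        then show ?thesis using True by simp
      qed simp
    qed
    finally show ?thesis .
  qed
  have "ennreal (s powr a) * avg ?G s = T_op k \<alpha> ?G s"
    unfolding a_def using s \<alpha> by (subst T_op_eq_avg) auto
  also have "T_op k \<alpha> ?G s = T_op k \<alpha> (T_op h \<alpha> F) s"
    using T_op_eq_avg[OF F(1), of _ \<alpha> h] \<alpha> by (intro T_op_cong) (auto simp: b_def)
  finally have "ennreal (s powr a) * avg ?G s = T_op k \<alpha> (T_op h \<alpha> F) s" .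
  moreover have "T_op k \<alpha> (T_op h \<alpha> F) s \<le> T_op k \<alpha> (rearr01 (T_op h \<alpha> F)) s"
    using F(1) by (intro T_op_le_rearr s T_op_Mplus borel_imp_Mplus)
  ultimately have "ennreal (s powr a) * (ennreal (s powr b / (b + 1)) * avg F s) \<le>
      T_op k \<alpha> (rearr01 (T_op h \<alpha> F)) s"
    using mult_left_mono[OF avg_G, of "ennreal (s powr a)"] by simp
  then show ?thesis
    unfolding start b_def[symmetric] by (rule mult_left_mono) simp
qed

text \<open>If \<open>\<alpha> < 1\<close> the function \<open>T\<^sub>h F\<close> need not be nonincreasing; its rearrangement at
  \<open>r\<close> is bounded by its supremum over \<open>[r, 1)\<close>, which is split at \<open>s\<close>. On
  \<open>[s, 1)\<close> the values on the dyadic block at \<open>2\<^sup>j s\<close> are comparable to the value at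
  \<open>2\<^sup>j s\<close>, so that only dilations of \<open>T\<^sub>k\<^sub>+\<^sub>h F\<close> appear.\<close>

lemma T_op_power_upper:
  assumes F: "F \<in> borel_measurable borel" "antimono F" and \<alpha>: "\<alpha> < 1"
    and kh: "1 \<le> k" "1 \<le> h" and s: "s \<in> {0<..<1}"
  defines "a \<equiv> real k * (1 - \<alpha>)" and "b \<equiv> real h * (1 - \<alpha>)"
  shows "T_op k \<alpha> (rearr01 (T_op h \<alpha> F)) s \<le>
    ennreal (1 / b + 1) * T_op (k + h) \<alpha> F s +
    (\<Sum>j. ennreal (2 powr b * (2 powr - a) ^ j) * (if 2 ^ j * s < 1 then T_op (k + h) \<alpha> F (2 ^ j * s) else 0))"
proof -
  have ab: "0 < a" "0 < b" using \<alpha> kh by (auto simp: a_def b_def)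
  let ?A = "avg F"
  have G_eq: "T_op h \<alpha> F t = ennreal (t powr b) * ?A t" if "t \<in> {0<..<1}" for t
    using T_op_eq_avg[OF F(1) that] \<alpha> by (simp add: b_def)
  have H_eq: "T_op (k + h) \<alpha> F t = ennreal (t powr a) * (ennreal (t powr b) * ?A t)" if "t \<in> {0<..<1}" for t
  proof -
    have "real (k + h) * (1 - \<alpha>) = a + b" by (simp add: a_def b_def algebra_simps)
    moreover have "ennreal (t powr (a + b)) = ennreal (t powr a) * ennreal (t powr b)"
      by (simp add: powr_add ennreal_mult)
    ultimately show ?thesis
      using T_op_eq_avg[OF F(1) that, of \<alpha> "k + h"] \<alpha> by (simp only: mult.assoc)
  qed
  \<comment> \<open>A sum over dyadic points in place of the supremum over [s,1): one term already
    dominates each value, and a sum can be estimated in norm term by term. Points beyond 1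
    contribute 0.\<close>
  define W where "W = (\<Sum>j. ennreal (2 powr b) * (if 2 ^ j * s < 1 then T_op h \<alpha> F (2 ^ j * s) else 0))"
  \<comment> \<open>For t in [r,s), T_h F at t is t^(b-1) times the integral of F over (0,t), which
    is at most the integral over (0,s). The power t^(b-1) may increase or decrease with t, so it is
    bounded by the sum of its values at both ends.\<close>
  have pt: "rearr01 (T_op h \<alpha> F) r \<le> ennreal (r powr (b - 1) + s powr (b - 1)) * (ennreal s * ?A s) + W"
    if r: "0 < r" "r < s" for r
  proof (rule rearr01_le_of_antimono)
    show "T_op h \<alpha> F \<in> Mplus" using F(1) by (intro T_op_Mplus borel_imp_Mplus)
    show "r \<in> {0<..<1}" using r s by auto
    fix t assume t: "t \<in> {0<..<1}" "r \<le> t"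
    show "T_op h \<alpha> F t \<le> ennreal (r powr (b - 1) + s powr (b - 1)) * (ennreal s * ?A s) + W"
    proof (cases "t < s")
      case True
      have "t powr (b - 1) \<le> r powr (b - 1) + s powr (b - 1)"
      proof (cases "b \<le> 1")
        case True
        then have "t powr (b - 1) \<le> r powr (b - 1)"
          using r t by (intro powr_mono2') auto
        then show ?thesis by (simp add: add_increasing2)
      next
        case False
        then have "t powr (b - 1) \<le> s powr (b - 1)"
          using True r t \<open>t < s\<close> by (intro powr_mono2) auto
        then show ?thesis by (simp add: add_increasing)
      qed
      moreover have "T_op h \<alpha> F t = ennreal (t powr (b - 1)) * (ennreal t * ?A t)"
      proof -
        have "t powr b = t powr (b - 1) * t"
          using t powr_mult_base[of t "b - 1"] by (simp add: mult.commute)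
        then show ?thesis using t by (simp add: G_eq ennreal_mult mult.assoc)
      qed
      moreover have "ennreal t * ?A t \<le> ennreal s * ?A s"
        using t True by (intro mult_avg_mono F) auto
      ultimately have "T_op h \<alpha> F t \<le> ennreal (r powr (b - 1) + s powr (b - 1)) * (ennreal s * ?A s)"
        by (simp only:) (rule mult_mono[OF ennreal_leI]; simp only: zero_le)
      then show ?thesis by (rule order_trans) simp
    next
      case False
      \<comment> \<open>The dyadic index with 2^j s \<le> t \<le> 2^(j+1) s: moving from t to 2^j s
        costs at most 2^b in the power and only increases the mean.\<close>
      define j where "j = nat \<lfloor>log 2 (t / s)\<rfloor>"
      have "0 \<le> log 2 (t / s)"
        using False s by (simp add: zero_le_log_cancel_iff)
      then have j: "real j \<le> log 2 (t / s)" "log 2 (t / s) < real j + 1"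
        by (auto simp: j_def)
      have lo: "2 ^ j * s \<le> t"
      proof -
        have "2 powr real j \<le> 2 powr log 2 (t / s)" using j(1) by (intro powr_mono) auto
        then show ?thesis using s t by (simp add: powr_realpow field_simps)
      qed
      have hi: "t \<le> 2 * (2 ^ j * s)"
      proof -
        have "2 powr log 2 (t / s) \<le> 2 powr (real j + 1)" using j(2) by (intro powr_mono) auto
        then show ?thesis using s t by (simp add: powr_realpow powr_add field_simps)
      qed
      let ?x = "2 ^ j * s"
      have x: "?x \<in> {0<..<1}" using lo t s by auto
      have "T_op h \<alpha> F t = ennreal (t powr b) * ?A t" using t by (simp add: G_eq)
      also have "\<dots> \<le> ennreal (2 powr b * ?x powr b) * ?A ?x"
      proof (intro mult_mono ennreal_leI)
        have "t powr b \<le> (2 * ?x) powr b" using hi t ab by (intro powr_mono2) auto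
        also have "\<dots> = 2 powr b * ?x powr b" using x by (intro powr_mult)
        finally show "t powr b \<le> 2 powr b * ?x powr b" .
        show "?A t \<le> ?A ?x" using avg_antimono[OF F(2)] lo by (auto simp: antimono_def)
      qed auto
      also have "\<dots> = ennreal (2 powr b) * T_op h \<alpha> F ?x"
        using x by (simp only: G_eq) (simp add: ennreal_mult mult.assoc)
      also have "\<dots> = ennreal (2 powr b) * (if ?x < 1 then T_op h \<alpha> F ?x else 0)"
        using x by simp
      also have "\<dots> \<le> W"
        unfolding W_def
        using sum_le_suminf[of "\<lambda>j. ennreal (2 powr b) * (if 2 ^ j * s < 1 then T_op h \<alpha> F (2 ^ j * s) else 0)" "{j}"]
        by simp
      finally show ?thesis by (rule order_trans) simp
    qed
  qed
  have "avg (rearr01 (T_op h \<alpha> F)) s \<le>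
      (\<integral>\<^sup>+u. (ennreal (s powr b) * ?A s) * ((ennreal (u powr (b - 1)) + 1) * indicator {0<..<1} u) + W * indicator {0<..<1} u \<partial>lborel)"
    unfolding avg_def[of "rearr01 (T_op h \<alpha> F)"]
  proof (intro nn_integral_mono)
    fix u
    show "rearr01 (T_op h \<alpha> F) (s * u) * indicator {0<..<1} u \<le>
        (ennreal (s powr b) * ?A s) * ((ennreal (u powr (b - 1)) + 1) * indicator {0<..<1} u) + W * indicator {0<..<1} u"
    proof (cases "u \<in> {0<..<1}")
      case True
      have "((s * u) powr (b - 1) + s powr (b - 1)) * s = (u powr (b - 1) + 1) * s powr b"
        using True s powr_mult_base[of s "b - 1"] by (simp add: powr_mult algebra_simps)
      then have "ennreal ((s * u) powr (b - 1) + s powr (b - 1)) * ennreal s = ennreal ((u powr (b - 1) + 1) * s powr b)"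
        using s by (subst ennreal_mult[symmetric]) auto
      also have "\<dots> = (ennreal (u powr (b - 1)) + 1) * ennreal (s powr b)"
        by (subst ennreal_mult) auto
      finally have e: "ennreal ((s * u) powr (b - 1) + s powr (b - 1)) * ennreal s =
          (ennreal (u powr (b - 1)) + 1) * ennreal (s powr b)" .
      have "ennreal ((s * u) powr (b - 1) + s powr (b - 1)) * (ennreal s * ?A s) =
          (ennreal ((s * u) powr (b - 1) + s powr (b - 1)) * ennreal s) * ?A s"
        by (simp only: mult.assoc)
      also have "\<dots> = ennreal (s powr b) * ?A s * (ennreal (u powr (b - 1)) + 1)"
        unfolding e by (simp only: mult_ac)
      finally have "ennreal ((s * u) powr (b - 1) + s powr (b - 1)) * (ennreal s * ?A s) =
          ennreal (s powr b) * ?A s * (ennreal (u powr (b - 1)) + 1)" .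
      then have "rearr01 (T_op h \<alpha> F) (s * u) \<le> ennreal (s powr b) * ?A s * (ennreal (u powr (b - 1)) + 1) + W"
        using pt[of "s * u"] True s by (simp only:) auto
      then show ?thesis
        using True by simp
    qed simp
  qed
  also have "\<dots> = ennreal (s powr b) * ?A s * (\<integral>\<^sup>+u. (ennreal (u powr (b - 1)) + 1) * indicator {0<..<1} u \<partial>lborel) + W"
  proof -
    have "(\<lambda>u. (ennreal (u powr (b - 1)) + 1) * indicator {0<..<1::real} u) \<in> borel_measurable lborel"
      by measurable
    then show ?thesis
      by (simp add: nn_integral_add nn_integral_cmult nn_integral_cmult_indicator)
  qed
  \<comment> \<open>Integrability at 0 of u^(b-1) uses b > 0 and gives 1/b; the added 1 comes from
    the other end of the interval.\<close>
  also have "(\<integral>\<^sup>+u. (ennreal (u powr (b - 1)) + 1) * indicator {0<..<1} u \<partial>lborel) = ennreal (1 / b + 1)"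
  proof -
    have "(\<integral>\<^sup>+u. (ennreal (u powr (b - 1)) + 1) * indicator {0<..<1::real} u \<partial>lborel) =
        (\<integral>\<^sup>+u. ennreal (u powr (b - 1)) * indicator {0<..<1} u + indicator {0<..<1} u \<partial>lborel)"
      by (intro nn_integral_cong) (auto simp: indicator_def)
    also have "\<dots> = ennreal (1 / b) + 1"
      using nn_integral_powr[of "b - 1" 1] ab by (subst nn_integral_add) auto
    finally show ?thesis using ab by simp
  qed
  finally have avg_le: "avg (rearr01 (T_op h \<alpha> F)) s \<le> ennreal (s powr b) * ?A s * ennreal (1 / b + 1) + W" .
  have "T_op k \<alpha> (rearr01 (T_op h \<alpha> F)) s = ennreal (s powr a) * avg (rearr01 (T_op h \<alpha> F)) s"
    unfolding a_def using s \<alpha> by (intro T_op_eq_avg rearrangement_borel) auto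
  also have "\<dots> \<le> ennreal (s powr a) * (ennreal (s powr b) * ?A s * ennreal (1 / b + 1) + W)"
    using avg_le by (intro mult_left_mono) auto
  also have "\<dots> = ennreal (1 / b + 1) * T_op (k + h) \<alpha> F s + ennreal (s powr a) * W"
    unfolding H_eq[OF s] distrib_left by (simp only: mult_ac)
  also have "ennreal (s powr a) * W = (\<Sum>j. ennreal (s powr a) * (ennreal (2 powr b) * (if 2 ^ j * s < 1 then T_op h \<alpha> F (2 ^ j * s) else 0)))"
    unfolding W_def by simp
  also have "\<dots> = (\<Sum>j. ennreal (2 powr b * (2 powr - a) ^ j) * (if 2 ^ j * s < 1 then T_op (k + h) \<alpha> F (2 ^ j * s) else 0))"
  proof (intro arg_cong[where f = suminf] ext)
    fix j :: nat
    let ?x = "2 ^ j * s"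
    show "ennreal (s powr a) * (ennreal (2 powr b) * (if ?x < 1 then T_op h \<alpha> F ?x else 0)) =
        ennreal (2 powr b * (2 powr - a) ^ j) * (if ?x < 1 then T_op (k + h) \<alpha> F ?x else 0)"
    proof (cases "?x < 1")
      case True
      have x: "?x \<in> {0<..<1}" using True s by auto
      \<comment> \<open>The outer factor s^a, rewritten at 2^j s, turns T_h into T_(k+h) there and
        leaves the decaying coefficient 2^(-a j).\<close>
      have "(2 powr - a) ^ j * ?x powr a = s powr a"
      proof -
        have "?x powr a = (2 ^ j) powr a * s powr a"
          using s by (intro powr_mult)
        also have "(2 ^ j) powr a = (2 powr a) ^ j"
          by (simp add: powr_realpow[symmetric] powr_powr mult.commute)
        finally show ?thesis
          by (simp add: mult.assoc[symmetric] power_mult_distrib[symmetric] powr_minus)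
      qed
      then have "ennreal (2 powr b * (2 powr - a) ^ j) * ennreal (?x powr a) = ennreal (s powr a) * ennreal (2 powr b)"
        by (simp add: ennreal_mult[symmetric] mult.assoc mult.commute)
      then show ?thesis
        using True x by (simp only: H_eq G_eq if_True) (simp only: mult.assoc[symmetric])
    qed simp
  qed
  finally show ?thesis .
qed

section \<open>The logarithmic case \<alpha> = 1: composition of kernels\<close>

lemma T_op_borel:
  assumes [measurable]: "f \<in> borel_measurable borel"
  shows "T_op m \<alpha> f \<in> borel_measurable borel"
  unfolding T_op_def[abs_def] nn_integral_leb01 by measurable

lemma nn_integral_inverse:
  assumes "0 < x" "x \<le> y"
  shows "(\<integral>\<^sup>+r. ennreal (1 / r) * indicator {x..y} r \<partial>lborel) = ennreal (ln y - ln x)"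
proof (rule nn_integral_FTC_Icc)
  fix r assume "r \<in> {x..y}"
  then have "0 < r" using assms by auto
  then show "(ln has_real_derivative 1 / r) (at r)" "0 \<le> 1 / r"
    by (auto intro: DERIV_ln_divide)
qed (use assms in auto)

text \<open>With L = ln (s/q), substituting the logarithm of r turns K into 1/s times a convolution
  of powers over an interval of length L. Both logarithms are at most L, which gives the upper
  bound; on the middle third, from x to y, both are at least L/3. Length and powers together lose
  3^(k+h-1).\<close>

lemma kern_log_convolution:
  assumes kh: "1 \<le> k" "1 \<le> h" and s: "s \<in> {0<..<1}" and q: "q \<in> {0<..<1}"
  defines "K \<equiv> \<integral>\<^sup>+r. kern k 1 s r * kern h 1 r q \<partial>leb01"
  shows "K \<le> kern (k + h) 1 s q"
    and "kern (k + h) 1 s q \<le> ennreal (3 ^ (k + h - 1)) * K"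
proof -
  define L where "L = ln (s / q)"
  define n where "n = (k - 1) + (h - 1)"
  have n: "k + h - 1 = Suc n" using kh by (simp add: n_def)
  have kern_eq: "kern k 1 s r * kern h 1 r q =
      ennreal (1 / s * (ln (s / r) ^ (k - 1) * ln (r / q) ^ (h - 1))) * ennreal (1 / r)"
    if "q < r" "r < s" for r
  proof -
    have "0 \<le> ln (s / r)" "0 \<le> ln (r / q)" using that q by (auto intro!: ln_ge_zero)
    then have nn: "0 \<le> ln (s / r) ^ (k - 1)" "0 \<le> ln (r / q) ^ (h - 1)" by auto
    then have "ennreal (1 / s * (ln (s / r) ^ (k - 1) * ln (r / q) ^ (h - 1))) =
        ennreal (1 / s) * ennreal (ln (s / r) ^ (k - 1) * ln (r / q) ^ (h - 1))"
      using s by (intro ennreal_mult mult_nonneg_nonneg) auto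
    also have "ennreal (ln (s / r) ^ (k - 1) * ln (r / q) ^ (h - 1)) =
        ennreal (ln (s / r) ^ (k - 1)) * ennreal (ln (r / q) ^ (h - 1))"
      using nn by (rule ennreal_mult)
    finally have "ennreal (1 / s * (ln (s / r) ^ (k - 1) * ln (r / q) ^ (h - 1))) =
        ennreal (1 / s) * (ennreal (ln (s / r) ^ (k - 1)) * ennreal (ln (r / q) ^ (h - 1)))" .
    then show ?thesis
      using that q by (simp add: kern_def mult_ac)
  qed
  have "K \<le> kern (k + h) 1 s q \<and> kern (k + h) 1 s q \<le> ennreal (3 ^ (k + h - 1)) * K"
  proof (cases "q < s")
    case False
    have "K = (\<integral>\<^sup>+r. 0 \<partial>leb01)"
      unfolding K_def using False by (intro nn_integral_cong) (auto simp: kern_def)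
    then show ?thesis using False by (simp add: kern_def)
  next
    case True
    have L: "0 < L" using True q by (simp add: L_def)
    have ln_s: "ln s = ln q + L" using s q by (simp add: L_def ln_div)
    have kern_sum: "kern (k + h) 1 s q = ennreal (1 / s * L ^ Suc n)"
      using True q s L by (simp add: kern_def n[unfolded One_nat_def] L_def[symmetric] ennreal_mult[symmetric])
    have "K \<le> (\<integral>\<^sup>+r. ennreal (1 / s * L ^ n) * (ennreal (1 / r) * indicator {q..s} r) \<partial>lborel)"
      unfolding K_def nn_integral_leb01
    proof (intro nn_integral_mono)
      fix r
      show "kern k 1 s r * kern h 1 r q * indicator {0<..<1} r \<le>
          ennreal (1 / s * L ^ n) * (ennreal (1 / r) * indicator {q..s} r)"
      proof (cases "q < r \<and> r < s")
        case True
        have "ln q \<le> ln r" "ln r \<le> ln s"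
          using True q by auto
        then have "0 \<le> ln (s / r)" "0 \<le> ln (r / q)" "ln (s / r) \<le> L" "ln (r / q) \<le> L"
          using True q s ln_s by (auto simp: ln_div)
        then have "ln (s / r) ^ (k - 1) * ln (r / q) ^ (h - 1) \<le> L ^ (k - 1) * L ^ (h - 1)"
          by (intro mult_mono power_mono) auto
        then have "1 / s * (ln (s / r) ^ (k - 1) * ln (r / q) ^ (h - 1)) \<le> 1 / s * L ^ n"
          using s unfolding n_def power_add by (intro mult_left_mono) auto
        then have "kern k 1 s r * kern h 1 r q \<le> ennreal (1 / s * L ^ n) * ennreal (1 / r)"
          using True by (simp only: kern_eq) (intro mult_right_mono ennreal_leI, auto)
        then show ?thesis using True q s by (simp add: indicator_def)
      next
        case False
        then have "kern k 1 s r * kern h 1 r q = 0" by (auto simp: kern_def)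
        then show ?thesis by (simp only: mult_zero_left zero_le)
      qed
    qed
    also have "\<dots> = ennreal (1 / s * L ^ n) * ennreal (ln s - ln q)"
      using True q by (subst nn_integral_cmult) (auto simp: nn_integral_inverse)
    also have "\<dots> = ennreal (1 / s * L ^ Suc n)"
      using L s by (simp add: ln_s ennreal_mult[symmetric] mult_ac)
    finally have upper: "K \<le> kern (k + h) 1 s q" by (simp add: kern_sum)
    define x where "x = q * exp (L / 3)"
    define y where "y = q * exp (2 * L / 3)"
    have s_eq: "s = q * exp L" using s q by (simp add: L_def)
    have xy: "0 < x" "q < x" "x \<le> y" "y < s"
      using q L by (auto simp: x_def y_def s_eq)
    have ln_xy: "ln x = ln q + L / 3" "ln y = ln q + 2 * L / 3"
      using q by (auto simp: x_def y_def ln_mult)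
    have "ennreal (1 / s * (L / 3) ^ n) * ennreal (L / 3) =
        ennreal (1 / s * (L / 3) ^ n) * (\<integral>\<^sup>+r. ennreal (1 / r) * indicator {x..y} r \<partial>lborel)"
      using xy by (simp add: nn_integral_inverse ln_xy)
    also have "\<dots> = (\<integral>\<^sup>+r. ennreal (1 / s * (L / 3) ^ n) * (ennreal (1 / r) * indicator {x..y} r) \<partial>lborel)"
      by (intro nn_integral_cmult[symmetric]) auto
    also have "\<dots> \<le> K"
      unfolding K_def nn_integral_leb01
    proof (intro nn_integral_mono)
      fix r
      show "ennreal (1 / s * (L / 3) ^ n) * (ennreal (1 / r) * indicator {x..y} r) \<le>
          kern k 1 s r * kern h 1 r q * indicator {0<..<1} r"
      proof (cases "r \<in> {x..y}")
        case True
        then have r: "q < r" "r < s" "0 < r" using xy q by auto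
        have "ln x \<le> ln r" "ln r \<le> ln y" using True xy by auto
        then have "L / 3 \<le> ln (s / r)" "L / 3 \<le> ln (r / q)"
          using r q s by (auto simp: ln_div ln_s ln_xy)
        then have "(L / 3) ^ (k - 1) * (L / 3) ^ (h - 1) \<le> ln (s / r) ^ (k - 1) * ln (r / q) ^ (h - 1)"
          using L by (intro mult_mono power_mono) auto
        then have "1 / s * (L / 3) ^ n \<le> 1 / s * (ln (s / r) ^ (k - 1) * ln (r / q) ^ (h - 1))"
          using s unfolding n_def power_add by (intro mult_left_mono) auto
        then have "ennreal (1 / s * (L / 3) ^ n) * ennreal (1 / r) \<le> kern k 1 s r * kern h 1 r q"
          using r by (simp only: kern_eq) (intro mult_right_mono ennreal_leI, auto)
        then show ?thesis using True r s by (simp add: indicator_def)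
      qed simp
    qed
    finally have "ennreal (1 / s * (L / 3) ^ n) * ennreal (L / 3) \<le> K" .
    then have "ennreal (3 ^ Suc n) * (ennreal (1 / s * (L / 3) ^ n) * ennreal (L / 3)) \<le> ennreal (3 ^ Suc n) * K"
      by (rule mult_left_mono) simp
    moreover have "ennreal (3 ^ Suc n) * (ennreal (1 / s * (L / 3) ^ n) * ennreal (L / 3)) = ennreal (1 / s * L ^ Suc n)"
    proof -
      have "3 ^ Suc n * ((1 / s * (L / 3) ^ n) * (L / 3)) = 1 / s * L ^ Suc n"
        by (simp add: power_divide)
      moreover have "0 \<le> 1 / s * (L / 3) ^ n" using L s by simp
      ultimately show ?thesis
        using L by (simp only: ennreal_mult[symmetric] less_imp_le mult_nonneg_nonneg zero_le_power zero_le_numeral divide_nonneg_nonneg)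
    qed
    ultimately show ?thesis using upper by (simp only: kern_sum n)
  qed
  then show "K \<le> kern (k + h) 1 s q" "kern (k + h) 1 s q \<le> ennreal (3 ^ (k + h - 1)) * K"
    by auto
qed

lemma T_op_log_iterate:
  assumes F: "F \<in> borel_measurable borel" and kh: "1 \<le> k" "1 \<le> h" and s: "s \<in> {0<..<1}"
  shows "T_op k 1 (T_op h 1 F) s \<le> T_op (k + h) 1 F s"
    and "T_op (k + h) 1 F s \<le> ennreal (3 ^ (k + h - 1)) * T_op k 1 (T_op h 1 F) s"
proof -
  interpret pair_sigma_finite leb01 leb01
    unfolding pair_sigma_finite_def using sigma_finite_leb01 by blast
  let ?K = "\<lambda>q. \<integral>\<^sup>+r. kern k 1 s r * kern h 1 r q \<partial>leb01"
  have [measurable]: "fst \<in> borel_measurable (leb01 \<Otimes>\<^sub>M leb01)" "snd \<in> borel_measurable (leb01 \<Otimes>\<^sub>M leb01)"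
    by (auto intro: measurable_compose[OF measurable_fst leb01_id] measurable_compose[OF measurable_snd leb01_id])
  have Fp: "(\<lambda>x. F (snd x)) \<in> borel_measurable (leb01 \<Otimes>\<^sub>M leb01)" "(\<lambda>x. F (fst x)) \<in> borel_measurable (leb01 \<Otimes>\<^sub>M leb01)"
    using F by measurable
  have kern_id: "(\<lambda>x. kern m 1 (u x) (v x)) \<in> Mplus"
    if "u \<in> borel_measurable leb01" "v \<in> borel_measurable leb01" for m u v
    using that by (rule kern_borel)
  have "T_op k 1 (T_op h 1 F) s = (\<integral>\<^sup>+r. (\<integral>\<^sup>+q. kern k 1 s r * (kern h 1 r q * F q) \<partial>leb01) \<partial>leb01)"
    unfolding T_op_def using F leb01_id
    by (intro nn_integral_cong nn_integral_cmult[symmetric] borel_measurable_times_ennreal kern_id borel_imp_Mplus) auto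
  also have "\<dots> = (\<integral>\<^sup>+q. (\<integral>\<^sup>+r. kern k 1 s r * (kern h 1 r q * F q) \<partial>leb01) \<partial>leb01)"
  proof (rule Fubini'[symmetric])
    show "(\<lambda>(r, q). kern k 1 s r * (kern h 1 r q * F q)) \<in> borel_measurable (leb01 \<Otimes>\<^sub>M leb01)"
      unfolding split_beta'
      by (intro borel_measurable_times_ennreal Fp kern_borel) auto
  qed
  also have "\<dots> = (\<integral>\<^sup>+q. ?K q * F q \<partial>leb01)"
    using leb01_id
    by (intro nn_integral_cong, subst mult.assoc[symmetric], intro nn_integral_multc borel_measurable_times_ennreal kern_id) auto
  finally have eq: "T_op k 1 (T_op h 1 F) s = (\<integral>\<^sup>+q. ?K q * F q \<partial>leb01)" .
  show "T_op k 1 (T_op h 1 F) s \<le> T_op (k + h) 1 F s"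
    unfolding eq T_op_def[of "k + h"]
    by (intro nn_integral_mono mult_right_mono kern_log_convolution kh s) auto
  have "T_op (k + h) 1 F s \<le> (\<integral>\<^sup>+q. ennreal (3 ^ (k + h - 1)) * (?K q * F q) \<partial>leb01)"
    unfolding T_op_def
  proof (intro nn_integral_mono)
    fix q assume "q \<in> space leb01"
    then have "kern (k + h) 1 s q \<le> ennreal (3 ^ (k + h - 1)) * ?K q"
      by (intro kern_log_convolution kh s) auto
    then show "kern (k + h) 1 s q * F q \<le> ennreal (3 ^ (k + h - 1)) * (?K q * F q)"
      unfolding mult.assoc[symmetric] by (rule mult_right_mono) simp
  qed
  also have "\<dots> = ennreal (3 ^ (k + h - 1)) * T_op k 1 (T_op h 1 F) s"
    unfolding eq
  proof (rule nn_integral_cmult)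
    have "(\<lambda>(q, r). kern k 1 s r * kern h 1 r q) \<in> borel_measurable (leb01 \<Otimes>\<^sub>M leb01)"
      unfolding split_beta' by (intro borel_measurable_times_ennreal kern_borel) auto
    then have "?K \<in> Mplus" by (rule sigma_finite_measure.borel_measurable_nn_integral[OF sigma_finite_leb01])
    then show "(\<lambda>q. ?K q * F q) \<in> Mplus"
      by (intro borel_measurable_times_ennreal borel_imp_Mplus[OF F])
  qed
  finally show "T_op (k + h) 1 F s \<le> ennreal (3 ^ (k + h - 1)) * T_op k 1 (T_op h 1 F) s" .
qed

text \<open>The kernel is homogeneous of degree -1, so after r = s u the weight ln(1/u)^(h-1) no
  longer depends on s, and F(s u) is nonincreasing in s.\<close>

lemma T_op_log_antimono:
  assumes F: "F \<in> borel_measurable borel" "antimono F" and st: "s \<in> {0<..<1}" "t \<in> {0<..<1}" "s \<le> t"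
  shows "T_op h 1 F t \<le> T_op h 1 F s"
proof -
  note [measurable] = F(1)
  have eq: "T_op h 1 F x = (\<integral>\<^sup>+u. ennreal (ln (1 / u) ^ (h - 1)) * indicator {0<..<1} u * F (x * u) \<partial>lborel)"
    if x: "x \<in> {0<..<1}" for x
  proof -
    have "T_op h 1 F x = (\<integral>\<^sup>+u. ennreal x * (kern h 1 x (x * u) * F (x * u)) \<partial>lborel)"
      unfolding T_op_scaled[OF F(1) x] by (intro nn_integral_cmult[symmetric]) measurable
    also have "\<dots> = (\<integral>\<^sup>+u. ennreal (ln (1 / u) ^ (h - 1)) * indicator {0<..<1} u * F (x * u) \<partial>lborel)"
    proof (intro nn_integral_cong)
      fix u
      have "ennreal x * kern h 1 x (x * u) = ennreal (ln (1 / u) ^ (h - 1)) * indicator {0<..<1} u"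
      proof (cases "u \<in> {0<..<1}")
        case True
        then have "kern h 1 x (x * u) = ennreal (1 / x) * ennreal (ln (1 / u) ^ (h - 1))"
          using x by (simp add: kern_def)
        then have "ennreal x * kern h 1 x (x * u) = (ennreal x * ennreal (1 / x)) * ennreal (ln (1 / u) ^ (h - 1))"
          by (simp only: mult.assoc)
        also have "ennreal x * ennreal (1 / x) = 1"
          using x by (simp add: ennreal_mult[symmetric])
        finally show ?thesis using True by simp
      next
        case False
        then show ?thesis using x by (auto simp: kern_def zero_less_mult_iff)
      qed
      then show "ennreal x * (kern h 1 x (x * u) * F (x * u)) =
          ennreal (ln (1 / u) ^ (h - 1)) * indicator {0<..<1} u * F (x * u)"
        by (simp only: mult.assoc[symmetric])
    qed
    finally show ?thesis .
  qed
  show ?thesis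
    unfolding eq[OF st(1)] eq[OF st(2)]
  proof (intro nn_integral_mono)
    fix u
    show "ennreal (ln (1 / u) ^ (h - 1)) * indicator {0<..<1} u * F (t * u) \<le>
        ennreal (ln (1 / u) ^ (h - 1)) * indicator {0<..<1} u * F (s * u)"
    proof (cases "u \<in> {0<..<1}")
      case True
      then have "s * u \<le> t * u" using st by (intro mult_right_mono) auto
      then show ?thesis using F(2) by (intro mult_left_mono) (auto simp: antimono_def)
    qed simp
  qed
qed

text \<open>The substitution y = c s shrinks the measure of every superlevel set by the factor c,
  and the extension by 0 adds no mass. The bound has constant 1, uniformly in c, as summing over all
  dyadic dilations requires.\<close>

lemma associate_norm_dilation:
  assumes inv: "\<And>f g. f \<in> Mplus \<Longrightarrow> g \<in> Mplus \<Longrightarrow>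
      (\<forall>s\<in>{0<..<1}. rearr01 f s = rearr01 g s) \<Longrightarrow> N f = N g"
    and g [measurable]: "g \<in> borel_measurable borel" and c: "1 \<le> c"
  shows "associate_norm N (\<lambda>s. if c * s < 1 then g (c * s) else 0) \<le> associate_norm N g"
    (is "associate_norm N ?E \<le> _")
proof (rule associate_norm_rearr_mono)
  have E [measurable]: "?E \<in> borel_measurable borel" by measurable
  show E': "?E \<in> Mplus" and g': "g \<in> Mplus" using E g by (auto intro: borel_imp_Mplus)
  fix s :: real
  show "rearr01 ?E s \<le> rearr01 g s"
  proof (rule rearr01_mono[OF E' g'])
    fix d
    let ?\<phi> = "\<lambda>y. indicator {y. d < g y} y * indicator {0<..<1} y :: ennreal"
    have meas: "?\<phi> \<in> borel_measurable borel"
      by (intro borel_measurable_times_ennreal borel_measurable_indicator) auto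
    have "emeasure leb01 {x \<in> {0<..<1}. d < ?E x} = (\<integral>\<^sup>+x. indicator {x. d < ?E x} x * indicator {0<..<1} x \<partial>lborel)"
      using nn_integral_indicator_leb01[OF Mplus_sets[OF E']] by (simp add: nn_integral_leb01)
    also have "\<dots> = (\<integral>\<^sup>+x. ?\<phi> (0 + c * x) \<partial>lborel)"
    proof (intro nn_integral_cong)
      fix x
      have "x < 1" if "0 < x" "c * x < 1"
      proof -
        have "1 * x \<le> c * x" using that c by (intro mult_right_mono) auto
        then show ?thesis using that(2) by linarith
      qed
      then show "indicator {x. d < ?E x} x * indicator {0<..<1} x = ?\<phi> (0 + c * x)"
        using c by (auto simp: indicator_def zero_less_mult_iff)
    qed
    also have "\<dots> \<le> ennreal \<bar>c\<bar> * (\<integral>\<^sup>+x. ?\<phi> (0 + c * x) \<partial>lborel)"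
      using c mult_right_mono[of 1 "ennreal c" "\<integral>\<^sup>+x. ?\<phi> (0 + c * x) \<partial>lborel"] by simp
    also have "\<dots> = (\<integral>\<^sup>+x. ?\<phi> x \<partial>lborel)"
      using c by (intro nn_integral_real_affine[symmetric] meas) auto
    also have "\<dots> = emeasure leb01 {x \<in> {0<..<1}. d < g x}"
      using nn_integral_indicator_leb01[OF Mplus_sets[OF g']] by (simp add: nn_integral_leb01)
    finally show "emeasure leb01 {x \<in> {0<..<1}. d < ?E x} \<le> emeasure leb01 {x \<in> {0<..<1}. d < g x}" .
  qed
qed (fact inv)

section \<open>Equivalence of the associate norms and duality\<close>

lemma iterated_norm_equiv:
  assumes X: "ri_function_norm X" and \<alpha>: "\<alpha> \<le> 1" and kh: "1 \<le> k" "1 \<le> h"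
  shows "\<exists>C\<^sub>1>0. \<exists>C\<^sub>2>0. \<forall>f\<in>Mplus.
    associate_norm X (T_op (k + h) \<alpha> (rearr01 f))
      \<le> ennreal C\<^sub>1 * associate_norm X (T_op k \<alpha> (rearr01 (T_op h \<alpha> (rearr01 f)))) \<and>
    associate_norm X (T_op k \<alpha> (rearr01 (T_op h \<alpha> (rearr01 f))))
      \<le> ennreal C\<^sub>2 * associate_norm X (T_op (k + h) \<alpha> (rearr01 f))"
proof (cases "\<alpha> = 1")
  case True
  have "associate_norm X (T_op (k + h) \<alpha> F)
      \<le> ennreal (3 ^ (k + h - 1)) * associate_norm X (T_op k \<alpha> (rearr01 (T_op h \<alpha> F))) \<and>
    associate_norm X (T_op k \<alpha> (rearr01 (T_op h \<alpha> F))) \<le> ennreal 1 * associate_norm X (T_op (k + h) \<alpha> F)"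
    if F: "F \<in> borel_measurable borel" "antimono F" for F
  proof
    have G: "T_op h 1 F \<in> Mplus" using F(1) by (intro borel_imp_Mplus T_op_borel)
    have "associate_norm X (T_op (k + h) 1 F) \<le>
        associate_norm X (\<lambda>s. ennreal (3 ^ (k + h - 1)) * T_op k 1 (rearr01 (T_op h 1 F)) s)"
    proof (rule associate_norm_mono)
      fix s :: real assume s: "s \<in> {0<..<1}"
      show "T_op (k + h) 1 F s \<le> ennreal (3 ^ (k + h - 1)) * T_op k 1 (rearr01 (T_op h 1 F)) s"
        using T_op_log_iterate(2)[OF F(1) kh s] mult_left_mono[OF T_op_le_rearr[OF G s, of k 1]]
        by (rule order_trans) simp
    qed
    also have "\<dots> = ennreal (3 ^ (k + h - 1)) * associate_norm X (T_op k 1 (rearr01 (T_op h 1 F)))"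
      by (intro associate_norm_scale borel_imp_Mplus T_op_borel rearrangement_borel)
    finally show "associate_norm X (T_op (k + h) \<alpha> F)
      \<le> ennreal (3 ^ (k + h - 1)) * associate_norm X (T_op k \<alpha> (rearr01 (T_op h \<alpha> F)))"
      using True by simp
    have "associate_norm X (T_op k 1 (rearr01 (T_op h 1 F))) \<le> associate_norm X (T_op (k + h) 1 F)"
    proof (rule associate_norm_mono)
      fix s :: real assume s: "s \<in> {0<..<1}"
      have "T_op k 1 (rearr01 (T_op h 1 F)) s \<le> T_op k 1 (T_op h 1 F) s"
      proof (rule T_op_mono)
        fix r :: real assume r: "r \<in> {0<..<1}"
        show "rearr01 (T_op h 1 F) r \<le> T_op h 1 F r"
          using r by (intro rearr01_le_of_antimono[OF G r] T_op_log_antimono F)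
      qed
      also have "\<dots> \<le> T_op (k + h) 1 F s"
        by (rule T_op_log_iterate(1)[OF F(1) kh s])
      finally show "T_op k 1 (rearr01 (T_op h 1 F)) s \<le> T_op (k + h) 1 F s" .
    qed
    then show "associate_norm X (T_op k \<alpha> (rearr01 (T_op h \<alpha> F))) \<le> ennreal 1 * associate_norm X (T_op (k + h) \<alpha> F)"
      using True by simp
  qed
  then show ?thesis
    by (intro exI[of _ "3 ^ (k + h - 1)"] conjI exI[of _ 1] ballI)
      (auto intro!: rearrangement_borel antimonoI rearrangement_antimono)
next
  case False
  with \<alpha> have \<alpha>: "\<alpha> < 1" by simp
  define a where "a = real k * (1 - \<alpha>)"
  define b where "b = real h * (1 - \<alpha>)"
  have ab: "0 < a" "0 < b" using \<alpha> kh by (auto simp: a_def b_def)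
  \<comment> \<open>The coefficient 1/b + 1 of the undilated term plus 2^b times the geometric
    series of ratio 2^(-a), which is below 1 because k \<ge> 1 and \<alpha> < 1.\<close>
  let ?C = "1 / b + 1 + 2 powr b * (1 / (1 - 2 powr - a))"
  have q: "0 \<le> 2 powr - a" "2 powr - a < 1"
    using ab powr_less_mono[of "- a" 0 2] by auto
  have C: "0 < 1 / b + 1" "0 \<le> 2 powr b * (1 / (1 - 2 powr - a))"
    using ab q by (auto simp: add_pos_pos)
  have "associate_norm X (T_op (k + h) \<alpha> F)
      \<le> ennreal (b + 1) * associate_norm X (T_op k \<alpha> (rearr01 (T_op h \<alpha> F))) \<and>
    associate_norm X (T_op k \<alpha> (rearr01 (T_op h \<alpha> F))) \<le> ennreal ?C * associate_norm X (T_op (k + h) \<alpha> F)"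
    if F: "F \<in> borel_measurable borel" "antimono F" for F
  proof
    let ?H = "T_op (k + h) \<alpha> F"
    have "associate_norm X ?H \<le> associate_norm X (\<lambda>s. ennreal (b + 1) * T_op k \<alpha> (rearr01 (T_op h \<alpha> F)) s)"
      unfolding b_def by (intro associate_norm_mono T_op_power_lower F \<alpha>)
    also have "\<dots> = ennreal (b + 1) * associate_norm X (T_op k \<alpha> (rearr01 (T_op h \<alpha> F)))"
      by (intro associate_norm_scale borel_imp_Mplus T_op_borel rearrangement_borel)
    finally show "associate_norm X ?H \<le> ennreal (b + 1) * associate_norm X (T_op k \<alpha> (rearr01 (T_op h \<alpha> F)))" .
    let ?E = "\<lambda>j s. if 2 ^ j * s < 1 then ?H (2 ^ j * s) else 0"
    let ?c = "\<lambda>j. 2 powr b * (2 powr - a) ^ j"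
    have H: "?H \<in> borel_measurable borel" using F(1) by (rule T_op_borel)
    have E: "?E j \<in> Mplus" for j :: nat
      by (intro borel_imp_Mplus measurable_If measurable_compose[OF _ H]) auto
    have E_le: "associate_norm X (?E j) \<le> associate_norm X ?H" for j :: nat
      using ri_function_norm.P6[OF X] H by (rule associate_norm_dilation) (assumption | rule one_le_power | simp)+
    have "associate_norm X (T_op k \<alpha> (rearr01 (T_op h \<alpha> F))) \<le>
        associate_norm X (\<lambda>s. ennreal (1 / b + 1) * ?H s + (\<Sum>j. ennreal (?c j) * ?E j s))"
      unfolding a_def b_def by (intro associate_norm_mono T_op_power_upper F \<alpha> kh)
    also have "\<dots> \<le> associate_norm X (\<lambda>s. ennreal (1 / b + 1) * ?H s) + associate_norm X (\<lambda>s. \<Sum>j. ennreal (?c j) * ?E j s)"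
      using H E by (intro associate_norm_add borel_measurable_suminf borel_measurable_times_ennreal borel_imp_Mplus[OF H]) auto
    also have "\<dots> \<le> ennreal (1 / b + 1) * associate_norm X ?H + (\<Sum>j. ennreal (?c j) * associate_norm X ?H)"
    proof (rule add_mono)
      show "associate_norm X (\<lambda>s. ennreal (1 / b + 1) * ?H s) \<le> ennreal (1 / b + 1) * associate_norm X ?H"
        using associate_norm_scale[OF borel_imp_Mplus[OF H], of X "ennreal (1 / b + 1)"] by (rule eq_refl)
      have "associate_norm X (\<lambda>s. \<Sum>j. ennreal (?c j) * ?E j s) \<le> (\<Sum>j. associate_norm X (\<lambda>s. ennreal (?c j) * ?E j s))"
        using E by (intro associate_norm_suminf borel_measurable_times_ennreal) auto
      also have "\<dots> \<le> (\<Sum>j. ennreal (?c j) * associate_norm X ?H)"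
      proof (intro suminf_le)
        fix j :: nat
        have "associate_norm X (\<lambda>s. ennreal (?c j) * ?E j s) = ennreal (?c j) * associate_norm X (?E j)"
          by (rule associate_norm_scale[OF E])
        also have "\<dots> \<le> ennreal (?c j) * associate_norm X ?H"
          by (intro mult_left_mono E_le) simp
        finally show "associate_norm X (\<lambda>s. ennreal (?c j) * ?E j s) \<le> ennreal (?c j) * associate_norm X ?H" .
      qed auto
      finally show "associate_norm X (\<lambda>s. \<Sum>j. ennreal (?c j) * ?E j s) \<le> (\<Sum>j. ennreal (?c j) * associate_norm X ?H)" .
    qed
    also have "(\<Sum>j. ennreal (?c j) * associate_norm X ?H) = (\<Sum>j. ennreal (?c j)) * associate_norm X ?H"
      by (rule ennreal_suminf_multc)
    also have "(\<Sum>j. ennreal (?c j)) = ennreal (2 powr b * (1 / (1 - 2 powr - a)))"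
    proof -
      have "?c sums (2 powr b * (1 / (1 - 2 powr - a)))"
        using q by (intro sums_mult geometric_sums) auto
      then show ?thesis
        by (intro suminf_ennreal_eq) (auto simp: q(1))
    qed
    also have "ennreal (1 / b + 1) * associate_norm X ?H + ennreal (2 powr b * (1 / (1 - 2 powr - a))) * associate_norm X ?H =
        ennreal ?C * associate_norm X ?H"
      unfolding distrib_right[symmetric] using C by (subst ennreal_plus[symmetric]) auto
    finally show "associate_norm X (T_op k \<alpha> (rearr01 (T_op h \<alpha> F))) \<le> ennreal ?C * associate_norm X ?H" .
  qed
  moreover have "0 < ?C" using C by (rule add_pos_nonneg)
  ultimately show ?thesis
    using ab
    by (intro exI[of _ "b + 1"] exI[of _ ?C] conjI ballI)
      (auto intro!: rearrangement_borel antimonoI rearrangement_antimono)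
qed

text \<open>Duality reverses the order: the unit ball of the associate norm of Y lies in C times
  that of Z, so Hoelder bounds the second associate norm of Y by C Z, and Lorentz--Luxemburg bounds
  Y by that second associate norm.\<close>

lemma norm_le_of_associate_norm_le:
  assumes Y: "ri_function_norm Y" and Z: "ri_function_norm Z" and "0 < C"
    and le: "\<And>g. g \<in> Mplus \<Longrightarrow> associate_norm Z g \<le> ennreal C * associate_norm Y g"
    and f: "f \<in> Mplus"
  shows "Y f \<le> ennreal C * Z f"
proof -
  have "associate_norm (associate_norm Y) f \<le> ennreal C * Z f"
  proof (rule associate_norm_least)
    fix g assume g: "g \<in> Mplus" "associate_norm Y g \<le> 1"
    have "associate_norm Z g \<le> ennreal C * associate_norm Y g" by (rule le[OF g(1)])
    also have "\<dots> \<le> ennreal C * 1" using g(2) by (rule mult_left_mono) simp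
    finally have "associate_norm Z g \<le> ennreal C" by simp
    then have "(\<integral>\<^sup>+s. f s * g s \<partial>leb01) \<le> ennreal C * Z f"
      using ri_function_norm.P1_scale[OF Z] f g(1) \<open>0 < C\<close> by (intro associate_norm_hoelder)
    then show "(\<integral>\<^sup>+s. g s * f s \<partial>leb01) \<le> ennreal C * Z f" by (simp add: mult.commute)
  qed
  with ri_function_norm.lorentz_luxemburg[OF Y f] show ?thesis by (rule order_trans)
qed

theorem theorem6p6:
  fixes \<Omega> :: "(real^'n) set" and \<alpha> n' :: real and k h :: nat
    and X :: "(real \<Rightarrow> ennreal) \<Rightarrow> ennreal"
  assumes "CARD('n) \<ge> 2"
    and "n' = real CARD('n) / (real CARD('n) - 1)"
    and "1 / n' \<le> \<alpha>" and "\<alpha> \<le> 1"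
    and "ri_function_norm X"
    and "k \<ge> 1" and "h \<ge> 1"
    and "\<Omega> \<in> mazya_class \<alpha>"
  shows "ri_space (optimal_norm h \<alpha> (optimal_norm k \<alpha> X)) \<Omega> = ri_space (optimal_norm (k + h) \<alpha> X) \<Omega>
    \<and> (\<exists>c>0. \<exists>C>0. \<forall>u \<in> ri_space (optimal_norm (k + h) \<alpha> X) \<Omega>.
          ennreal c * ri_norm_on (optimal_norm (k + h) \<alpha> X) \<Omega> u
            \<le> ri_norm_on (optimal_norm h \<alpha> (optimal_norm k \<alpha> X)) \<Omega> u
        \<and> ri_norm_on (optimal_norm h \<alpha> (optimal_norm k \<alpha> X)) \<Omega> u
            \<le> ennreal C * ri_norm_on (optimal_norm (k + h) \<alpha> X) \<Omega> u)"
proof -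
  note X = assms(5) and \<alpha> = assms(4) and k = assms(6) and h = assms(7)
  define Y where "Y = optimal_norm h \<alpha> (optimal_norm k \<alpha> X)"
  define Z where "Z = optimal_norm (k + h) \<alpha> X"
  note Xk = ri_function_norm_optimal_norm[OF X k \<alpha>]
  have kh: "1 \<le> k + h" using k by simp
  have Y: "ri_function_norm Y" unfolding Y_def by (rule ri_function_norm_optimal_norm(1)[OF Xk(1) h \<alpha>])
  have Z: "ri_function_norm Z" unfolding Z_def by (rule ri_function_norm_optimal_norm(1)[OF X kh \<alpha>])
  \<comment> \<open>The second rearrangement arises because T_h of \<open>rearr01 f\<close> is
    itself the argument of the associate norm of the inner space, which rearranges before applying
    T_k.\<close>
  have Y': "associate_norm Y f = associate_norm X (T_op k \<alpha> (rearr01 (T_op h \<alpha> (rearr01 f))))"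
    if f: "f \<in> Mplus" for f
  proof -
    have "associate_norm Y f = associate_norm (optimal_norm k \<alpha> X) (T_op h \<alpha> (rearr01 f))"
      unfolding Y_def by (rule ri_function_norm_optimal_norm(2)[OF Xk(1) h \<alpha> f])
    also have "\<dots> = associate_norm X (T_op k \<alpha> (rearr01 (T_op h \<alpha> (rearr01 f))))"
      by (intro Xk(2) borel_imp_Mplus T_op_borel rearrangement_borel)
    finally show ?thesis .
  qed
  have Z': "associate_norm Z f = associate_norm X (T_op (k + h) \<alpha> (rearr01 f))" if f: "f \<in> Mplus" for f
    unfolding Z_def by (rule ri_function_norm_optimal_norm(2)[OF X kh \<alpha> f])
  obtain C\<^sub>1 C\<^sub>2 :: real where C: "0 < C\<^sub>1" "0 < C\<^sub>2"
    "\<And>f. f \<in> Mplus \<Longrightarrow> associate_norm Z f \<le> ennreal C\<^sub>1 * associate_norm Y f"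
    "\<And>f. f \<in> Mplus \<Longrightarrow> associate_norm Y f \<le> ennreal C\<^sub>2 * associate_norm Z f"
    using iterated_norm_equiv[OF X \<alpha> k h] Y' Z' by auto
  let ?u = "\<lambda>u. rearrangement (lebesgue_on \<Omega>) u"
  \<comment> \<open>Norms over \<Omega> are evaluated at the rearrangement of u, a function in
    \<open>Mplus\<close>, so the comparison on (0,1) transfers. The constants change sides: bounding
    the associate norm of Z by that of Y bounds Y by Z.\<close>
  have YZ: "Y (?u u) \<le> ennreal C\<^sub>1 * Z (?u u)" for u
    by (rule norm_le_of_associate_norm_le[OF Y Z C(1)]) (assumption | rule C(3) rearrangement_Mplus)+
  have ZY: "Z (?u u) \<le> ennreal C\<^sub>2 * Y (?u u)" for u
    by (rule norm_le_of_associate_norm_le[OF Z Y C(2)]) (assumption | rule C(4) rearrangement_Mplus)+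
  have "Y (?u u) < \<infinity> \<longleftrightarrow> Z (?u u) < \<infinity>" for u
  proof
    assume "Y (?u u) < \<infinity>"
    then have "ennreal C\<^sub>2 * Y (?u u) < \<infinity>" by (simp add: ennreal_mult_less_top)
    with ZY show "Z (?u u) < \<infinity>" by (rule le_less_trans)
  next
    assume "Z (?u u) < \<infinity>"
    then have "ennreal C\<^sub>1 * Z (?u u) < \<infinity>" by (simp add: ennreal_mult_less_top)
    with YZ show "Y (?u u) < \<infinity>" by (rule le_less_trans)
  qed
  then have "ri_space Y \<Omega> = ri_space Z \<Omega>"
    by (simp add: ri_space_def ri_norm_on_def)
  moreover have "ennreal (1 / C\<^sub>2) * Z (?u u) \<le> Y (?u u)" for u
  proof -
    have "ennreal (1 / C\<^sub>2) * Z (?u u) \<le> ennreal (1 / C\<^sub>2) * (ennreal C\<^sub>2 * Y (?u u))"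
      using ZY by (rule mult_left_mono) simp
    also have "\<dots> = (ennreal (1 / C\<^sub>2) * ennreal C\<^sub>2) * Y (?u u)" by (simp only: mult.assoc)
    also have "ennreal (1 / C\<^sub>2) * ennreal C\<^sub>2 = 1"
      using C(2) by (simp add: ennreal_mult[symmetric])
    finally show ?thesis by simp
  qed
  moreover have "0 < 1 / C\<^sub>2" using C(2) by simp
  ultimately show ?thesis
    unfolding Y_def[symmetric] Z_def[symmetric] ri_norm_on_def using YZ C(1) by blast
qed

end
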